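(* (1) $\mathfrak b_\sigma(\mathrm{Fin})=\mathfrak b_s(\mathrm{Fin})=\mathfrak b<\infty=\mathrm{add}_\omega(\mathrm{Fin})$. (2) $\mathfrak b_\sigma(\mathrm{Fin}\otimes\{\emptyset\})=\mathfrak b_s(\mathrm{Fin}\otimes\{\emptyset\})=\mathfrak b<\infty=\mathrm{add}_\omega(\mathrm{Fin}\otimes\{\emptyset\})$. (3) $\mathfrak b_\sigma(\mathcal I_d)=\mathrm{add}_\omega(\mathcal I_d)=\mathrm{add}(\mathcal N)\le\mathfrak b=\mathfrak b_s(\mathcal I_d)$. (4) $\mathfrak b_\sigma(\mathcal I_{1/n})=\mathrm{add}_\omega(\mathcal I_{1/n})=\mathrm{add}(\mathcal N)\le\mathfrak b=\mathfrak b_s(\mathcal I_{1/n})$. (5) $\mathfrak b_\sigma(\mathrm{Fin}\otimes\mathrm{Fin})=\mathfrak b_s(\mathrm{Fin}\otimes\mathrm{Fin})=\mathrm{add}_\omega(\mathrm{Fin}\otimes\mathrm{Fin})=\mathfrak b$. (6) $\mathfrak b_\sigma(\{\emptyset\}\otimes\mathrm{Fin})=\mathfrak b_s(\{\emptyset\}\otimes\mathrm{Fin})=\mathrm{add}_\omega(\{\emptyset\}\otimes\mathrm{Fin})=\mathfrak b$. (7) $\mathfrak b_\sigma(\mathcal S)=\mathfrak b_s(\mathcal S)=\mathrm{add}_\omega(\mathcal S)=\omega_1$.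
   Context: An ideal on a countably infinite set $S$ is a family of subsets of $S$ closed under finite unions and subsets, containing all finite sets, not containing $S$. Ideals: $\mathrm{Fin}$ = finite subsets of $\omega$; $\mathrm{Fin}\otimes\{\emptyset\}=\{A\subseteq\omega\times\omega:\{x:(A)_x\ne\emptyset\}\text{ finite}\}$; $\mathrm{Fin}\otimes\mathrm{Fin}=\{A\subseteq\omega\times\omega:\{x:(A)_x\text{ infinite}\}\text{ finite}\}$; $\{\emptyset\}\otimes\mathrm{Fin}=\{A\subseteq\omega\times\omega:(A)_x\text{ finite for all }x\}$, where $(A)_x=\{y:(x,y)\in A\}$; $\mathcal I_d=\{A\subseteq\omega:\lim_n|A\cap\{0,\dots,n-1\}|/(n+1)=0\}$; $\mathcal I_{1/n}=\{A\subseteq\omega:\sum_{n\in A}1/(n+1)<\infty\}$; Solecki's ideal $\mathcal S$: with $\Omega$ the countable set of clopen subsets of $2^\omega$ of Lebesgue measure $1/2$, $\mathcal S$ consists of subsets of $\Omega$ covered by finitely many sets $G_x=\{A\in\Omega:x\in A\}$, $x\in2^\omega$. $\mathfrak b$ is the least size of a subset of $\omega^\omega$ unbounded under $\le^*$ (eventual domination); $\mathrm{add}(\mathcal N)$ is the least size of a family of Lebesgue null subsets of $\mathbb R$ whose union is not null. Cardinals (convention $\min\emptyset=\infty$, $\kappa<\infty$ for every cardinal), for an ideal $\mathcal I$ on countably infinite $S$: $\widehat{\mathcal P}_{\mathcal I}$ = sequences $(A_n)_{n\in\omega}\in\mathcal I^\omega$ of pairwise disjoint sets; $\mathcal P_{\mathcal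 I}$ = those with $\bigcup_nA_n=S$; $\mathcal M_{\mathcal I}$ = sequences $(E_k)\in\mathcal I^\omega$ with $E_k\subseteq E_{k+1}$. $\mathfrak b_s(\mathcal I)=\min\{|\mathcal E|:\mathcal E\subseteq\widehat{\mathcal P}_{\mathcal I}$ and for every $(A_n)\in\mathcal P_{\mathcal I}$ there is $(E_n)\in\mathcal E$ with $\bigcup_n(A_{n+1}\cap\bigcup_{i\le n}E_i)\notin\mathcal I\}$; $\mathfrak b_\sigma(\mathcal I)=\min\{|\mathcal E|:\mathcal E\subseteq\mathcal M_{\mathcal I}$ and for every $(A_n)\in\mathcal M_{\mathcal I}$ there is $(E_n)\in\mathcal E$ with $E_n\not\subseteq A_n$ for infinitely many $n\}$; $\mathrm{add}_\omega(\mathcal I)=\min\{|\mathcal A|:\mathcal A\subseteq\mathcal I$ and for every $(B_n)\in\mathcal I^\omega$ there is $A\in\mathcal A$ with $A\not\subseteq B_n$ for all $n\}$. *)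

theory Defs
  imports "HOL-Probability.Probability"
begin

text \<open>For a property P of sets, write min(P) for min{|X| : P X} (infinity if no X).
  Cardinalities of sets of different types are compared via card_of and ordLeq.\<close>

definition mincard_le :: "('a set \<Rightarrow> bool) \<Rightarrow> ('b set \<Rightarrow> bool) \<Rightarrow> bool" where
  "mincard_le P Q \<longleftrightarrow> (\<forall>Y. Q Y \<longrightarrow> (\<exists>X. P X \<and> (card_of X, card_of Y) \<in> ordLeq))"

definition mincard_eq :: "('a set \<Rightarrow> bool) \<Rightarrow> ('b set \<Rightarrow> bool) \<Rightarrow> bool" where
  "mincard_eq P Q \<longleftrightarrow> mincard_le P Q \<and> mincard_le Q P"

definition mincard_finite :: "('a set \<Rightarrow> bool) \<Rightarrow> bool" where
  "mincard_finite P \<longleftrightarrow> (\<exists>X. P X)"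

definition mincard_omega1 :: "('a set \<Rightarrow> bool) \<Rightarrow> bool" where
  "mincard_omega1 P \<longleftrightarrow> (\<forall>X. P X \<longrightarrow> \<not> countable X) \<and>
     (\<exists>X. P X \<and> (card_of X, cardSuc (card_of (UNIV :: nat set))) \<in> ordLeq)"

text \<open>An ideal on a countable set S is given by its carrier S and its membership predicate I.\<close>

definition Phat :: "'a set \<Rightarrow> ('a set \<Rightarrow> bool) \<Rightarrow> (nat \<Rightarrow> 'a set) set" where
  "Phat S I = {A. (\<forall>n. I (A n) \<and> A n \<subseteq> S) \<and> disjoint_family A}"

definition Ppart :: "'a set \<Rightarrow> ('a set \<Rightarrow> bool) \<Rightarrow> (nat \<Rightarrow> 'a set) set" where
  "Ppart S I = {A. A \<in> Phat S I \<and> (\<Union>n. A n) = S}"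

definition Mseq :: "'a set \<Rightarrow> ('a set \<Rightarrow> bool) \<Rightarrow> (nat \<Rightarrow> 'a set) set" where
  "Mseq S I = {E. \<forall>n. I (E n) \<and> E n \<subseteq> S \<and> E n \<subseteq> E (Suc n)}"

definition bs_wit :: "'a set \<Rightarrow> ('a set \<Rightarrow> bool) \<Rightarrow> (nat \<Rightarrow> 'a set) set \<Rightarrow> bool" where
  "bs_wit S I \<E> \<longleftrightarrow> \<E> \<subseteq> Phat S I \<and>
     (\<forall>A \<in> Ppart S I. \<exists>E \<in> \<E>. \<not> I (\<Union>n. A (Suc n) \<inter> (\<Union>i\<le>n. E i)))"

definition bsigma_wit :: "'a set \<Rightarrow> ('a set \<Rightarrow> bool) \<Rightarrow> (nat \<Rightarrow> 'a set) set \<Rightarrow> bool" where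
  "bsigma_wit S I \<E> \<longleftrightarrow> \<E> \<subseteq> Mseq S I \<and>
     (\<forall>A \<in> Mseq S I. \<exists>E \<in> \<E>. infinite {n. \<not> E n \<subseteq> A n})"

definition addw_wit :: "'a set \<Rightarrow> ('a set \<Rightarrow> bool) \<Rightarrow> 'a set set \<Rightarrow> bool" where
  "addw_wit S I \<A> \<longleftrightarrow> (\<forall>A \<in> \<A>. I A \<and> A \<subseteq> S) \<and>
     (\<forall>B :: nat \<Rightarrow> 'a set. (\<forall>n. I (B n) \<and> B n \<subseteq> S) \<longrightarrow> (\<exists>A \<in> \<A>. \<forall>n. \<not> A \<subseteq> B n))"

definition b_wit :: "(nat \<Rightarrow> nat) set \<Rightarrow> bool" where
  "b_wit F \<longleftrightarrow> \<not> (\<exists>g. \<forall>f \<in> F. eventually (\<lambda>n. f n \<le> g n) sequentially)"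

definition addN_wit :: "real set set \<Rightarrow> bool" where
  "addN_wit \<N> \<longleftrightarrow> \<N> \<subseteq> null_sets (lebesgue :: real measure) \<and>
     \<Union>\<N> \<notin> null_sets (lebesgue :: real measure)"

definition sect :: "(nat \<times> nat) set \<Rightarrow> nat \<Rightarrow> nat set" where
  "sect A x = {y. (x, y) \<in> A}"

definition FinI :: "nat set \<Rightarrow> bool" where
  "FinI A \<longleftrightarrow> finite A"

definition Fin_x_empty :: "(nat \<times> nat) set \<Rightarrow> bool" where
  "Fin_x_empty A \<longleftrightarrow> finite {x. sect A x \<noteq> {}}"

definition Fin_x_Fin :: "(nat \<times> nat) set \<Rightarrow> bool" where
  "Fin_x_Fin A \<longleftrightarrow> finite {x. infinite (sect A x)}"

definition empty_x_Fin :: "(nat \<times> nat) set \<Rightarrow> bool" where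
  "empty_x_Fin A \<longleftrightarrow> (\<forall>x. finite (sect A x))"

definition Id_dens :: "nat set \<Rightarrow> bool" where
  "Id_dens A \<longleftrightarrow> (\<lambda>n. real (card (A \<inter> {..<n})) / real (n + 1)) \<longlonglongrightarrow> 0"

definition I_summ :: "nat set \<Rightarrow> bool" where
  "I_summ A \<longleftrightarrow> (\<lambda>n. 1 / real (n + 1)) summable_on A"

definition cantor_top :: "(nat \<Rightarrow> bool) topology" where
  "cantor_top = product_topology (\<lambda>_. discrete_topology (UNIV :: bool set)) UNIV"

definition cantor_measure :: "(nat \<Rightarrow> bool) measure" where
  "cantor_measure = PiM (UNIV :: nat set) (\<lambda>_. measure_pmf (bernoulli_pmf (1/2)))"

definition Omega :: "(nat \<Rightarrow> bool) set set" where
  "Omega = {A. openin cantor_top A \<and> closedin cantor_top A \<and>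
               A \<in> sets cantor_measure \<and> measure cantor_measure A = 1/2}"

definition Gset :: "(nat \<Rightarrow> bool) \<Rightarrow> (nat \<Rightarrow> bool) set set" where
  "Gset x = {A \<in> Omega. x \<in> A}"

definition Solecki :: "(nat \<Rightarrow> bool) set set \<Rightarrow> bool" where
  "Solecki B \<longleftrightarrow> B \<subseteq> Omega \<and> (\<exists>F. finite F \<and> B \<subseteq> (\<Union>x\<in>F. Gset x))"

end

theory Submission
  imports Defs
begin

text \<open>
  For every ideal covered by countably many of its elements, \<open>b\<^sub>\<sigma>\<close> is below both \<open>b\<^sub>s\<close> and \<open>add\<^sub>\<omega>\<close>. The bound
  \<open>b\<^sub>s \<le> b\<close> comes from interval partitions read off an unbounded family, and \<open>b \<le> b\<^sub>\<sigma>\<close> holds whenever the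
  ideal has a cofinal family indexed monotonically by functions \<open>\<nat> \<Rightarrow> \<nat>\<close>. In (1) and (2) a countable
  cofinal family makes \<open>add\<^sub>\<omega>\<close> infinite; in (5) and (6) subgraphs of functions give \<open>add\<^sub>\<omega> \<le> b\<close>.

  The density ideal and the summable ideal have the form \<open>{A. \<phi> (A - n) \<longlonglongrightarrow> 0}\<close> for a countably subadditive
  submeasure \<open>\<phi>\<close>, which yields \<open>b \<le> b\<^sub>s\<close>. Their \<open>add\<^sub>\<omega>\<close> is compared with \<open>add(N)\<close> through the least size \<open>loc\<close>
  of a family of functions not captured by a single slalom. Coding the pieces of a set between the terms of a
  dominating sequence gives \<open>loc \<le> add\<^sub>\<omega>\<close>. Bartoszynski's argument (null sets \<open>limsup\<^sub>n G\<^sub>n\<^sub>,\<^sub>f\<^sub>(\<^sub>n\<^sub>)\<close> built from sets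
  \<open>G\<^sub>n\<^sub>,\<^sub>i\<close> that are independent in \<open>i\<close>, and the Baire category theorem in a closed set all of whose portions have
  positive measure) gives \<open>add(N) \<le> loc\<close>. Covering null sets by dyadic intervals gives \<open>add\<^sub>\<omega> \<le> add(N)\<close> for the
  summable ideal, and finite copies of the independent sets, placed in rapidly growing blocks, give
  \<open>add\<^sub>\<omega> \<le> loc\<close> for the density ideal.

  For Solecki's ideal, a clopen set of measure 1/2 can contain a given point and avoid finitely many others,
  so any uncountable set of points yields witnesses.
\<close>

section \<open>Comparison of minimal cardinalities\<close>

text \<open>An inequality min(P) <= min(Q) is proved by turning each element of a witness for
  \<open>Q\<close> into an element of a witness for \<open>P\<close>, so cardinal arithmetic enters
  only with omega_1. The main obstacle is that several translations need one function dominating the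
  moduli of convergence of a whole family. If there is none, the moduli are an unbounded family, and
  a bound of the left side by b saves the inequality. This fixes the logical order:
  \<open>loc_le_addw\<close> can rely on the easy \<open>loc_le_b\<close>, whereas
  \<open>addw_le_bsigma\<close> must wait for the bound of add_omega by b, which is proved directly
  for the density ideal but reached for the summable ideal only through add(N) and loc. Both
  \<open>addN_le_loc\<close> and \<open>addw_Id_dens_le_loc\<close> rest on one estimate: a set of
  probability c can avoid at most D log(1/c) independent events of probability 1/D. Slaloms are
  identified with families of such avoided (or captured) indices.\<close>

lemma mincard_le_trans:
  assumes "mincard_le P Q" "mincard_le Q R"
  shows "mincard_le P R"
  using assms unfolding mincard_le_def by (meson ordLeq_transitive)

text \<open>An image has no more elements than \<open>Y\<close>. The map is chosen after
  \<open>Y\<close>, so it may depend on the whole witness, for instance through a function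
  dominating a family computed from \<open>Y\<close>.\<close>

lemma mincard_le_image:
  assumes "\<And>Y. Q Y \<Longrightarrow> \<exists>f. P (f ` Y)"
  shows "mincard_le P Q"
  unfolding mincard_le_def using assms card_of_image by blast

text \<open>Pattern for domination arguments: \<open>R\<close> will be \<open>b_wit\<close>, and the
  second alternative is the case where the family read off \<open>Y\<close> is unbounded. Then
  \<open>PR\<close> supplies a \<open>P\<close> witness that is no larger.\<close>

lemma mincard_le_image_cases:
  assumes PR: "mincard_le P R"
    and "\<And>Y. Q Y \<Longrightarrow> (\<exists>f. P (f ` Y)) \<or> (\<exists>f. R (f ` Y))"
  shows "mincard_le P Q"
  unfolding mincard_le_def
proof (intro allI impI)
  fix Y assume "Q Y"
  then consider f where "P (f ` Y)" | f where "R (f ` Y)"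
    using assms(2) by blast
  then show "\<exists>X. P X \<and> (card_of X, card_of Y) \<in> ordLeq"
  proof cases
    case 1
    then show ?thesis using card_of_image by blast
  next
    case 2
    then obtain X where "P X" "(card_of X, card_of (f ` Y)) \<in> ordLeq"
      using PR unfolding mincard_le_def by blast
    then show ?thesis using card_of_image ordLeq_transitive by blast
  qed
qed

definition set_ideal :: "('a set \<Rightarrow> bool) \<Rightarrow> bool" where
  "set_ideal I \<longleftrightarrow> I {} \<and> (\<forall>A B. I B \<longrightarrow> A \<subseteq> B \<longrightarrow> I A) \<and> (\<forall>A B. I A \<longrightarrow> I B \<longrightarrow> I (A \<union> B))"

lemma set_idealD:
  assumes "set_ideal I"
  shows set_ideal_empty: "I {}"
    and set_ideal_subset: "I B \<Longrightarrow> A \<subseteq> B \<Longrightarrow> I A"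
    and set_ideal_Un: "I A \<Longrightarrow> I B \<Longrightarrow> I (A \<union> B)"
  using assms unfolding set_ideal_def by blast+

lemma set_ideal_UN:
  assumes "set_ideal I" "finite F" "\<And>i. i \<in> F \<Longrightarrow> I (A i)"
  shows "I (\<Union>i\<in>F. A i)"
  using assms(2,3) by (induction F) (simp_all add: set_idealD[OF assms(1)])

lemma not_b_wit_strict_mono:
  assumes "\<not> b_wit F"
  obtains g where "strict_mono g" "\<And>f. f \<in> F \<Longrightarrow> eventually (\<lambda>n. f n \<le> g n) sequentially"
proof -
  obtain h where h: "\<And>f. f \<in> F \<Longrightarrow> eventually (\<lambda>n. f n \<le> h n) sequentially"
    using assms unfolding b_wit_def by blast
  define g where "g n = n + (\<Sum>k\<le>n. h k)" for n
  have "strict_mono g"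
    by (simp add: strict_mono_Suc_iff g_def)
  moreover have hg: "h n \<le> g n" for n
    unfolding g_def by (simp add: member_le_sum trans_le_add2)
  have "eventually (\<lambda>n. f n \<le> g n) sequentially" if "f \<in> F" for f
    using h[OF that] by eventually_elim (use hg le_trans in blast)
  ultimately show ?thesis using that by blast
qed

lemma countable_dominated:
  fixes h :: "nat \<Rightarrow> nat \<Rightarrow> nat"
  obtains g where "\<And>m. eventually (\<lambda>n. h m n \<le> g n) sequentially"
proof
  show "eventually (\<lambda>n. h m n \<le> (\<Sum>k\<le>n. h k n)) sequentially" for m
    using eventually_ge_at_top[of m]
  proof eventually_elim
    case (elim n)
    then show ?case by (intro member_le_sum) auto
  qed
qed

lemma b_wit_UNIV: "b_wit UNIV"
  unfolding b_wit_def
proof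
  assume "\<exists>g::nat \<Rightarrow> nat. \<forall>f\<in>UNIV. eventually (\<lambda>n. f n \<le> g n) sequentially"
  then obtain g :: "nat \<Rightarrow> nat" where "\<And>f. eventually (\<lambda>n. f n \<le> g n) sequentially"
    by blast
  from this[of "\<lambda>n. Suc (g n)"] show False
    by (simp add: eventually_sequentially)
qed

text \<open>A set becomes a constant sequence; escaping every \<open>B n\<close> is more than
  escaping infinitely many of them.\<close>

lemma bsigma_le_addw: "mincard_le (bsigma_wit S I) (addw_wit S I)"
proof (rule mincard_le_image, intro exI)
  fix \<A> assume \<A>: "addw_wit S I \<A>"
  show "bsigma_wit S I ((\<lambda>A n. A) ` \<A>)"
    unfolding bsigma_wit_def
  proof (intro conjI ballI)
    show "(\<lambda>A n. A) ` \<A> \<subseteq> Mseq S I"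
      using \<A> by (auto simp: addw_wit_def Mseq_def)
    fix B assume "B \<in> Mseq S I"
    then have "\<forall>n. I (B n) \<and> B n \<subseteq> S" by (simp add: Mseq_def)
    then obtain A where "A \<in> \<A>" "\<forall>n. \<not> A \<subseteq> B n"
      using \<A> unfolding addw_wit_def by blast
    then show "\<exists>E\<in>(\<lambda>A n. A) ` \<A>. infinite {n. \<not> E n \<subseteq> B n}"
      by (intro bexI[of _ "\<lambda>n. A"]) auto
  qed
qed

text \<open>Partial unions turn a disjoint sequence into an increasing one. The cover
  \<open>T\<close> lets an increasing \<open>A\<close> be enlarged until its differences form a
  partition of \<open>S\<close>. A point of difference number \<open>Suc n\<close> lies outside
  \<open>A n\<close>, so if only finitely many partial unions escaped \<open>A\<close>, those few
  would cover the set tested by \<open>bs_wit\<close>.\<close>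

lemma bsigma_le_bs:
  assumes I: "set_ideal I" and T: "\<And>n. I (T n)" "(\<Union>n::nat. T n) = S"
  shows "mincard_le (bsigma_wit S I) (bs_wit S I)"
proof (rule mincard_le_image, intro exI)
  fix \<E> assume \<E>: "bs_wit S I \<E>"
  let ?U = "\<lambda>E n. \<Union>i\<le>n. E i"
  have EI: "I (?U E n)" "?U E n \<subseteq> S" if "E \<in> \<E>" for E :: "nat \<Rightarrow> 'a set" and n
    using \<E> that by (auto simp: bs_wit_def Phat_def intro!: set_ideal_UN[OF I])
  show "bsigma_wit S I (?U ` \<E>)"
    unfolding bsigma_wit_def
  proof (intro conjI ballI)
    show "?U ` \<E> \<subseteq> Mseq S I"
    proof (rule image_subsetI)
      fix E assume E: "E \<in> \<E>"
      have "?U E n \<subseteq> ?U E (Suc n)" for n by (simp add: atMost_Suc Un_upper2)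
      then show "?U E \<in> Mseq S I" unfolding Mseq_def using EI[OF E] by simp
    qed
    fix A assume A: "A \<in> Mseq S I"
    define A' where "A' n = A n \<union> (\<Union>i\<le>n. T i)" for n
    have A'I: "I (A' n)" for n
      unfolding A'_def using A T by (auto simp: Mseq_def intro!: set_ideal_Un[OF I] set_ideal_UN[OF I])
    have A'U: "(\<Union>n. A' n) = S"
      unfolding A'_def using A T(2) by (auto simp: Mseq_def)
    have "disjointed A' \<in> Ppart S I"
    proof -
      have "I (disjointed A' n)" "disjointed A' n \<subseteq> S" for n
        using disjointed_subset[of A' n] A'U set_ideal_subset[OF I A'I] by blast+
      then show ?thesis
        unfolding Ppart_def Phat_def using A'U
        by (simp add: disjoint_family_disjointed UN_disjointed_eq)
    qed
    then obtain E where E: "E \<in> \<E>" and nI: "\<not> I (\<Union>n. disjointed A' (Suc n) \<inter> ?U E n)"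
      using \<E> unfolding bs_wit_def by blast
    have "infinite {n. \<not> ?U E n \<subseteq> A n}"
    proof
      assume fin: "finite {n. \<not> ?U E n \<subseteq> A n}"
      have "I (\<Union>n\<in>{n. \<not> ?U E n \<subseteq> A n}. ?U E n)"
        by (rule set_ideal_UN[OF I fin]) (rule EI[OF E])
      moreover have "(\<Union>n. disjointed A' (Suc n) \<inter> ?U E n) \<subseteq> (\<Union>n\<in>{n. \<not> ?U E n \<subseteq> A n}. ?U E n)"
      proof
        fix x assume "x \<in> (\<Union>n. disjointed A' (Suc n) \<inter> ?U E n)"
        then obtain n where n: "x \<in> disjointed A' (Suc n)" "x \<in> ?U E n" by blast
        then have "x \<notin> A' n" by (simp add: disjointed_def)
        then have "x \<notin> A n" by (simp add: A'_def)
        with n show "x \<in> (\<Union>n\<in>{n. \<not> ?U E n \<subseteq> A n}. ?U E n)" by blast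
      qed
      ultimately show False using nI set_ideal_subset[OF I] by blast
    qed
    then show "\<exists>E\<in>?U ` \<E>. infinite {n. \<not> E n \<subseteq> A n}"
      by (intro bexI[OF _ imageI[OF E]])
  qed
qed

text \<open>\<open>pos i X\<close> says that \<open>X\<close> has a large piece beyond stage \<open>i\<close>, and a set with large pieces arbitrarily
  far out is not in the ideal. The sets \<open>E\<^sub>n\<close> attached to \<open>f\<close> are chosen such that \<open>\<Union>i\<le>n. E\<^sub>i\<close> is
  \<open>K (f 0 + \<dots> + f n)\<close>.\<close>

lemma bs_le_b:
  fixes K :: "nat \<Rightarrow> 'a set" and pos :: "nat \<Rightarrow> 'a set \<Rightarrow> bool"
  assumes I: "set_ideal I"
    and K: "mono K" "\<And>m. I (K m)" "\<And>m. K m \<subseteq> S"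
    and pos_reach: "\<And>B i. I B \<Longrightarrow> B \<subseteq> S \<Longrightarrow> \<exists>m. pos i (K m - B)"
    and pos_up: "\<And>i A B. pos i A \<Longrightarrow> A \<subseteq> B \<Longrightarrow> pos i B"
    and pos_not: "\<And>X. I X \<Longrightarrow> finite {i. pos i X}"
  shows "mincard_le (bs_wit S I) b_wit"
proof (rule mincard_le_image, intro exI)
  fix F assume F: "b_wit F"
  let ?K = "\<lambda>f n. K (\<Sum>k\<le>n. f k)"
  have monoK: "?K f i \<subseteq> ?K f j" if "i \<le> j" for f :: "nat \<Rightarrow> nat" and i j
    using that by (intro monoD[OF K(1)] sum_mono2) auto
  have UE: "(\<Union>i\<le>n. disjointed (?K f) i) = ?K f n" for f n
  proof -
    have "(\<Union>i\<le>n. disjointed (?K f) i) = (\<Union>i\<le>n. ?K f i)"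
      using finite_UN_disjointed_eq[of "?K f" "Suc n"]
      by (simp add: atLeast0LessThan lessThan_Suc_atMost)
    also have "\<dots> = ?K f n"
      by (intro equalityI UN_least monoK UN_upper) auto
    finally show ?thesis .
  qed
  show "bs_wit S I ((\<lambda>f. disjointed (?K f)) ` F)"
    unfolding bs_wit_def
  proof (intro conjI ballI)
    show "(\<lambda>f. disjointed (?K f)) ` F \<subseteq> Phat S I"
    proof (rule image_subsetI)
      fix f
      have "I (disjointed (?K f) n)" "disjointed (?K f) n \<subseteq> S" for n
        using disjointed_subset[of "?K f" n] K(3) set_ideal_subset[OF I K(2)] by blast+
      then show "disjointed (?K f) \<in> Phat S I"
        unfolding Phat_def by (simp add: disjoint_family_disjointed)
    qed
    fix A assume A: "A \<in> Ppart S I"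
    define B where "B n = (\<Union>i\<le>n. A i)" for n
    have AI: "\<And>n. I (A n)" and AS: "(\<Union>n. A n) = S"
      using A by (auto simp: Ppart_def Phat_def)
    have "I (B n)" "B n \<subseteq> S" for n
      unfolding B_def by (rule set_ideal_UN[OF I]) (use AI AS in auto)
    then have "\<forall>i. \<exists>m. pos i (K m - B i)" by (intro allI pos_reach)
    \<comment> \<open>\<open>K (g i)\<close> has a large piece outside the parts \<open>A 0\<close>,
      ..., \<open>A i\<close>. If \<open>g i < f i\<close>, this piece is already contained in the
      \<open>i\<close>-th partial union, while its points lie in parts of index above
      \<open>i\<close>; hence all of it falls into \<open>?X\<close>.\<close>
    from choice[OF this] obtain g where g: "pos i (K (g i) - B i)" for i by auto
    obtain f where f: "f \<in> F" "\<not> eventually (\<lambda>n. f n \<le> g n) sequentially"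
      using F unfolding b_wit_def by blast
    let ?X = "\<Union>n. A (Suc n) \<inter> (\<Union>i\<le>n. disjointed (?K f) i)"
    have "pos i ?X" if "g i < f i" for i
    proof (rule pos_up[of i "K (g i) - B i", OF g])
      show "K (g i) - B i \<subseteq> ?X"
      proof
        fix y assume y: "y \<in> K (g i) - B i"
        have "f i \<le> (\<Sum>k\<le>i. f k)" by (simp add: member_le_sum)
        then have "K (g i) \<subseteq> ?K f i" using that by (intro monoD[OF K(1)]) simp
        then have yi: "y \<in> ?K f i" using y by blast
        have "y \<in> (\<Union>n. A n)" using y K(3)[of "g i"] unfolding AS by blast
        then obtain n where n: "y \<in> A n" by blast
        have "\<not> n \<le> i" using y n unfolding B_def by blast
        then obtain n' where n': "n = Suc n'" "i \<le> n'" by (cases n) auto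
        then have "y \<in> ?K f n'" using yi monoK[OF n'(2), of f] by blast
        then have "y \<in> (\<Union>i\<le>n'. disjointed (?K f) i)" unfolding UE .
        then show "y \<in> ?X" using n n' by blast
      qed
    qed
    then have sub: "{i. g i < f i} \<subseteq> {i. pos i ?X}" by (rule Collect_mono[OF impI])
    have "\<exists>\<^sub>F i in cofinite. g i < f i"
      using f(2) unfolding cofinite_eq_sequentially by (simp add: not_eventually not_le)
    then have "infinite {i. g i < f i}" by (simp add: frequently_cofinite)
    then have "infinite {i. pos i ?X}" using sub infinite_super by metis
    then have "\<not> I ?X" using pos_not[of ?X] by metis
    then show "\<exists>E\<in>(\<lambda>f. disjointed (?K f)) ` F. \<not> I (\<Union>n. A (Suc n) \<inter> (\<Union>i\<le>n. E i))"
      by (intro bexI[OF _ imageI[OF f(1)]])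
  qed
qed

text \<open>Each term of a sequence in the ideal has a code through the cofinal map
  \<open>U\<close>. \<open>prod_encode\<close> packs the codes of all terms into one function, and a
  bound for that function bounds all of them.\<close>

lemma b_le_bsigma:
  fixes U :: "(nat \<Rightarrow> nat) \<Rightarrow> 'a set"
  assumes U: "\<And>g. I (U g)" "\<And>g. U g \<subseteq> S"
    and mono: "\<And>g h. (\<And>n. g n \<le> h n) \<Longrightarrow> U g \<subseteq> U h"
    and cofinal: "\<And>E. I E \<Longrightarrow> E \<subseteq> S \<Longrightarrow> \<exists>g. E \<subseteq> U g"
  shows "mincard_le b_wit (bsigma_wit S I)"
proof (rule mincard_le_image, intro exI)
  fix \<E> assume \<E>: "bsigma_wit S I \<E>"
  define c where "c E n = (SOME g. E n \<subseteq> U g)" for E :: "nat \<Rightarrow> 'a set" and n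
  have c: "E n \<subseteq> U (c E n)" if "E \<in> \<E>" for E n
  proof -
    have "I (E n)" "E n \<subseteq> S" using \<E> that by (auto simp: bsigma_wit_def Mseq_def)
    then show ?thesis unfolding c_def using cofinal by (metis someI_ex)
  qed
  let ?F = "\<lambda>E k. c E (fst (prod_decode k)) (snd (prod_decode k))"
  show "b_wit (?F ` \<E>)"
    unfolding b_wit_def
  proof
    assume "\<exists>g. \<forall>f\<in>?F ` \<E>. eventually (\<lambda>n. f n \<le> g n) sequentially"
    then obtain g where g: "\<And>E. E \<in> \<E> \<Longrightarrow> eventually (\<lambda>n. ?F E n \<le> g n) sequentially"
      by auto
    define A where "A n = U (\<lambda>j. \<Sum>m\<le>n. g (prod_encode (m, j)))" for n
    have "A n \<subseteq> A (Suc n)" for n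
      unfolding A_def by (rule mono) simp
    then have "A \<in> Mseq S I"
      unfolding Mseq_def using U by (simp add: A_def)
    then obtain E where E: "E \<in> \<E>" "infinite {n. \<not> E n \<subseteq> A n}"
      using \<E> unfolding bsigma_wit_def by blast
    obtain N where N: "\<And>k. k \<ge> N \<Longrightarrow> ?F E k \<le> g k"
      using g[OF E(1)] unfolding eventually_sequentially by blast
    have "E n \<subseteq> A n" if "n \<ge> N" for n
    proof -
      have "U (c E n) \<subseteq> A n" unfolding A_def
      proof (rule mono)
        fix j
        \<comment> \<open>Every entry of row \<open>n\<close> sits at a position at least
          \<open>n\<close>, so from \<open>N\<close> on the bound holds for entire rows, uniformly
          in \<open>j\<close>.\<close>
        have "prod_encode (n, j) \<ge> N" using that le_prod_encode_1[of n j] by linarith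
        from N[OF this] have "c E n j \<le> g (prod_encode (n, j))" by simp
        also have "\<dots> \<le> (\<Sum>m\<le>n. g (prod_encode (m, j)))"
          by (rule member_le_sum) auto
        finally show "c E n j \<le> (\<Sum>m\<le>n. g (prod_encode (m, j)))" .
      qed
      then show ?thesis using c[OF E(1)] by blast
    qed
    then have "{n. \<not> E n \<subseteq> A n} \<subseteq> {..<N}" using not_le by auto
    then show False using E(2) finite_subset by blast
  qed
qed

text \<open>If countably many \<open>B m\<close> captured all subgraphs, a function eventually above
  the column maxima of each \<open>B m\<close> would dominate \<open>F\<close>.\<close>

lemma addw_le_b_of_subgraphs:
  assumes I: "\<And>A. I A \<Longrightarrow> Fin_x_Fin A" and graph: "\<And>f. I {(x, y). y \<le> f x}"
  shows "mincard_le (addw_wit UNIV I) b_wit"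
proof (rule mincard_le_image, intro exI)
  fix F assume F: "b_wit F"
  let ?G = "\<lambda>f. {(x, y). y \<le> f x} :: (nat \<times> nat) set"
  show "addw_wit UNIV I (?G ` F)"
    unfolding addw_wit_def
  proof (intro conjI allI impI)
    show "\<forall>A\<in>?G ` F. I A \<and> A \<subseteq> UNIV" using graph by auto
    fix B :: "nat \<Rightarrow> (nat \<times> nat) set"
    assume B: "\<forall>n. I (B n) \<and> B n \<subseteq> UNIV"
    show "\<exists>A\<in>?G ` F. \<forall>n. \<not> A \<subseteq> B n"
    proof (rule ccontr)
      assume "\<not> ?thesis"
      then have cover: "\<exists>m. ?G f \<subseteq> B m" if "f \<in> F" for f using that by blast
      \<comment> \<open>\<open>Max\<close> says nothing about an infinite column, but each
        \<open>B m\<close> has only finitely many of these, and domination is only eventual.\<close>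
      obtain g where g: "\<And>m. eventually (\<lambda>x. Max (sect (B m) x) \<le> g x) sequentially"
        using countable_dominated[of "\<lambda>m x. Max (sect (B m) x)"] by blast
      have "eventually (\<lambda>x. f x \<le> g x) sequentially" if f: "f \<in> F" for f
      proof -
        obtain m where m: "?G f \<subseteq> B m" using cover[OF f] by blast
        have "finite {x. infinite (sect (B m) x)}" using B I unfolding Fin_x_Fin_def by blast
        then have "eventually (\<lambda>x. finite (sect (B m) x)) sequentially"
          by (simp add: eventually_cofinite flip: cofinite_eq_sequentially)
        then show ?thesis using g[of m]
        proof eventually_elim
          case (elim x)
          have "f x \<in> sect (B m) x" using m by (auto simp: sect_def)
          then show ?case using elim Max_ge le_trans by blast
        qed
      qed
      then show False using F unfolding b_wit_def by blast
    qed
  qed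
qed

section \<open>Fin and the three ideals on pairs of natural numbers\<close>

lemma set_ideal_FinI: "set_ideal FinI"
  unfolding set_ideal_def FinI_def by (auto intro: finite_subset)

lemma set_ideal_Fin_x_empty: "set_ideal Fin_x_empty"
  unfolding set_ideal_def Fin_x_empty_def
proof (intro conjI allI impI)
  fix A B :: "(nat \<times> nat) set"
  assume *: "finite {x. sect B x \<noteq> {}}"
  show "finite {x. sect A x \<noteq> {}}" if "A \<subseteq> B"
    by (rule finite_subset[OF _ *]) (use that in \<open>auto simp: sect_def\<close>)
  have "{x. sect (A \<union> B) x \<noteq> {}} = {x. sect A x \<noteq> {}} \<union> {x. sect B x \<noteq> {}}"
    by (auto simp: sect_def)
  then show "finite {x. sect (A \<union> B) x \<noteq> {}}" if "finite {x. sect A x \<noteq> {}}"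
    using * that by simp
qed (simp add: sect_def)

lemma sect_Un: "sect (A \<union> B) x = sect A x \<union> sect B x"
  by (auto simp: sect_def)

lemma sect_mono: "A \<subseteq> B \<Longrightarrow> sect A x \<subseteq> sect B x"
  by (auto simp: sect_def)

lemma sect_empty [simp]: "sect {} x = {}"
  by (simp add: sect_def)

lemma set_ideal_Fin_x_Fin: "set_ideal Fin_x_Fin"
  unfolding set_ideal_def Fin_x_Fin_def
proof (intro conjI allI impI)
  fix A B :: "(nat \<times> nat) set"
  assume *: "finite {x. infinite (sect B x)}"
  show "finite {x. infinite (sect A x)}" if "A \<subseteq> B"
    by (rule finite_subset[OF _ *]) (use sect_mono[OF that] infinite_super in blast)
  have "{x. infinite (sect (A \<union> B) x)} = {x. infinite (sect A x)} \<union> {x. infinite (sect B x)}"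
    by (auto simp: sect_Un)
  then show "finite {x. infinite (sect (A \<union> B) x)}" if "finite {x. infinite (sect A x)}"
    using * that by simp
qed simp

lemma set_ideal_empty_x_Fin: "set_ideal empty_x_Fin"
  unfolding set_ideal_def empty_x_Fin_def
  by (auto simp: sect_Un intro: finite_subset[OF sect_mono])

lemma mincard_FinI:
  "mincard_le (bsigma_wit UNIV FinI) (bs_wit UNIV FinI)"
  "mincard_le (bs_wit UNIV FinI) b_wit"
  "mincard_le b_wit (bsigma_wit UNIV FinI)"
proof -
  show "mincard_le (bsigma_wit UNIV FinI) (bs_wit UNIV FinI)"
    by (rule bsigma_le_bs[OF set_ideal_FinI, of lessThan]) (auto simp: FinI_def)
  show "mincard_le (bs_wit UNIV FinI) b_wit"
  proof (rule bs_le_b[OF set_ideal_FinI, where K = lessThan and pos = "\<lambda>i X. \<exists>y\<ge>i. y \<in> X"])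
    show "\<exists>m. \<exists>y\<ge>i. y \<in> {..<m} - B" if "FinI B" for B :: "nat set" and i
    proof -
      have "infinite ({i..} - B)" using that by (simp add: FinI_def infinite_Ici)
      then obtain y where "y \<in> {i..} - B" by (metis ex_in_conv finite.emptyI)
      then have "y \<ge> i \<and> y \<in> {..<Suc y} - B" by simp
      then show ?thesis by blast
    qed
    show "finite {i. \<exists>y\<ge>i. y \<in> X}" if "FinI X" for X
    proof -
      have "{i. \<exists>y\<ge>i. y \<in> X} \<subseteq> (\<Union>y\<in>X. {..y})" by auto
      then show ?thesis by (rule finite_subset) (use that in \<open>auto simp: FinI_def\<close>)
    qed
  qed (auto simp: mono_def FinI_def)
  show "mincard_le b_wit (bsigma_wit UNIV FinI)"
  proof (rule b_le_bsigma[where U = "\<lambda>g. {..g 0}"])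
    show "\<exists>g. E \<subseteq> {..g 0}" if E: "FinI E" for E :: "nat set"
    proof -
      obtain k where "E \<subseteq> {..k}" using E unfolding FinI_def finite_nat_iff_bounded_le by blast
      then show ?thesis by (intro exI[of _ "\<lambda>_. k"])
    qed
    show "{..g 0} \<subseteq> {..h 0}" if "\<And>n. g n \<le> h n" for g h :: "nat \<Rightarrow> nat"
      using that[of 0] by auto
  qed (auto simp: FinI_def)
qed

lemma mincard_Fin_x_empty:
  "mincard_le (bsigma_wit UNIV Fin_x_empty) (bs_wit UNIV Fin_x_empty)"
  "mincard_le (bs_wit UNIV Fin_x_empty) b_wit"
  "mincard_le b_wit (bsigma_wit UNIV Fin_x_empty)"
proof -
  have col: "Fin_x_empty ({..m} \<times> UNIV)" for m
    unfolding Fin_x_empty_def by (rule finite_subset[of _ "{..m}"]) (auto simp: sect_def)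
  have bdd: "\<exists>k. E \<subseteq> {..k} \<times> UNIV" if E: "Fin_x_empty E" for E
  proof -
    obtain k where k: "{x. sect E x \<noteq> {}} \<subseteq> {..k}"
      using E unfolding Fin_x_empty_def finite_nat_iff_bounded_le by blast
    then have "E \<subseteq> {..k} \<times> UNIV" by (force simp: sect_def)
    then show ?thesis ..
  qed
  show "mincard_le (bsigma_wit UNIV Fin_x_empty) (bs_wit UNIV Fin_x_empty)"
    by (rule bsigma_le_bs[OF set_ideal_Fin_x_empty, where T = "\<lambda>n. {..n} \<times> UNIV"]) (use col in auto)
  show "mincard_le (bs_wit UNIV Fin_x_empty) b_wit"
  proof (rule bs_le_b[OF set_ideal_Fin_x_empty,
        where K = "\<lambda>m. {..m} \<times> UNIV" and pos = "\<lambda>i X. \<exists>x\<ge>i. sect X x \<noteq> {}"])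
    show "\<exists>m. \<exists>x\<ge>i. sect ({..m} \<times> UNIV - B) x \<noteq> {}" if B: "Fin_x_empty B" for B i
    proof -
      obtain k where k: "B \<subseteq> {..k} \<times> UNIV" using bdd[OF B] by blast
      then have "(Suc (i + k), 0) \<in> {..Suc (i + k)} \<times> UNIV - B" by auto
      then have "sect ({..Suc (i + k)} \<times> UNIV - B) (Suc (i + k)) \<noteq> {}" by (auto simp: sect_def)
      then show ?thesis by (intro exI[of _ "Suc (i + k)"] conjI) auto
    qed
    show "finite {i. \<exists>x\<ge>i. sect X x \<noteq> {}}" if X: "Fin_x_empty X" for X
    proof -
      obtain k where k: "X \<subseteq> {..k} \<times> UNIV" using bdd[OF X] by blast
      have "{i. \<exists>x\<ge>i. sect X x \<noteq> {}} \<subseteq> {..k}" using k by (force simp: sect_def)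
      then show ?thesis using finite_subset by blast
    qed
    show "\<exists>x\<ge>i. sect B x \<noteq> {}" if "\<exists>x\<ge>i. sect A x \<noteq> {}" "A \<subseteq> B" for i A B
      using that sect_mono by blast
  qed (use col in \<open>auto simp: mono_def\<close>)
  show "mincard_le b_wit (bsigma_wit UNIV Fin_x_empty)"
  proof (rule b_le_bsigma[where U = "\<lambda>g. {..g 0} \<times> UNIV"])
    show "\<exists>g. E \<subseteq> {..g 0} \<times> UNIV" if E: "Fin_x_empty E" for E
    proof -
      obtain k where "E \<subseteq> {..k} \<times> UNIV" using bdd[OF E] by blast
      then show ?thesis by (intro exI[of _ "\<lambda>_. k"])
    qed
    show "{..g 0} \<times> UNIV \<subseteq> {..h 0} \<times> UNIV" if "\<And>n. g n \<le> h n" for g h :: "nat \<Rightarrow> nat"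
      using that[of 0] by auto
  qed (use col in auto)
qed

lemma mincard_Fin_x_Fin:
  "mincard_le (bsigma_wit UNIV Fin_x_Fin) (bs_wit UNIV Fin_x_Fin)"
  "mincard_le (bs_wit UNIV Fin_x_Fin) b_wit"
  "mincard_le b_wit (bsigma_wit UNIV Fin_x_Fin)"
  "mincard_le (addw_wit UNIV Fin_x_Fin) b_wit"
proof -
  have col: "Fin_x_Fin ({..m} \<times> UNIV)" for m
    unfolding Fin_x_Fin_def by (rule finite_subset[of _ "{..m}"]) (auto simp: sect_def)
  show "mincard_le (bsigma_wit UNIV Fin_x_Fin) (bs_wit UNIV Fin_x_Fin)"
    by (rule bsigma_le_bs[OF set_ideal_Fin_x_Fin, where T = "\<lambda>n. {..n} \<times> UNIV"]) (use col in auto)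
  have bdd: "\<exists>k. \<forall>x>k. finite (sect E x)" if E: "Fin_x_Fin E" for E
  proof -
    obtain k where "{x. infinite (sect E x)} \<subseteq> {..k}"
      using E unfolding Fin_x_Fin_def finite_nat_iff_bounded_le by blast
    then have "\<forall>x>k. finite (sect E x)" by (force simp: not_le)
    then show ?thesis ..
  qed
  show "mincard_le (bs_wit UNIV Fin_x_Fin) b_wit"
  proof (rule bs_le_b[OF set_ideal_Fin_x_Fin,
        where K = "\<lambda>m. {..m} \<times> UNIV" and pos = "\<lambda>i X. \<exists>x\<ge>i. infinite (sect X x)"])
    show "\<exists>m. \<exists>x\<ge>i. infinite (sect ({..m} \<times> UNIV - B) x)" if B: "Fin_x_Fin B" for B i
    proof -
      obtain k where k: "\<forall>x>k. finite (sect B x)" using bdd[OF B] by blast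
      let ?n = "Suc (i + k)"
      have "sect ({..?n} \<times> UNIV - B) ?n = UNIV - sect B ?n" by (auto simp: sect_def)
      moreover have "finite (sect B ?n)" using k by simp
      ultimately have "infinite (sect ({..?n} \<times> UNIV - B) ?n)" by simp
      then show ?thesis by (intro exI[of _ ?n] conjI) auto
    qed
    show "finite {i. \<exists>x\<ge>i. infinite (sect X x)}" if X: "Fin_x_Fin X" for X
    proof -
      obtain k where k: "\<forall>x>k. finite (sect X x)" using bdd[OF X] by blast
      have "{i. \<exists>x\<ge>i. infinite (sect X x)} \<subseteq> {..k}"
      proof
        fix i assume "i \<in> {i. \<exists>x\<ge>i. infinite (sect X x)}"
        then obtain x where x: "i \<le> x" "infinite (sect X x)" by blast
        then have "\<not> x > k" using k by blast
        then show "i \<in> {..k}" using x by simp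
      qed
      then show ?thesis using finite_subset by blast
    qed
    show "\<exists>x\<ge>i. infinite (sect B x)" if "\<exists>x\<ge>i. infinite (sect A x)" "A \<subseteq> B" for i A B
      using that sect_mono finite_subset by metis
  qed (use col in \<open>auto simp: mono_def\<close>)
  show "mincard_le b_wit (bsigma_wit UNIV Fin_x_Fin)"
  \<comment> \<open>\<open>g 0\<close> bounds the columns that may be infinite; the shift by
    \<open>Suc\<close> leaves \<open>g (Suc x)\<close> free to bound column
    \<open>x\<close>.\<close>
  proof (rule b_le_bsigma[where U = "\<lambda>g. {(x, y). x \<le> g 0 \<or> y \<le> g (Suc x)}"])
    show "Fin_x_Fin {(x, y). x \<le> g 0 \<or> y \<le> g (Suc x)}" for g
      unfolding Fin_x_Fin_def
      by (rule finite_subset[of _ "{..g 0}"]) (auto simp: sect_def)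
    show "{(x, y). x \<le> g 0 \<or> y \<le> g (Suc x)} \<subseteq> {(x, y). x \<le> h 0 \<or> y \<le> h (Suc x)}"
      if "\<And>n. g n \<le> h n" for g h :: "nat \<Rightarrow> nat"
      using that le_trans by blast
    show "\<exists>g. E \<subseteq> {(x, y). x \<le> g 0 \<or> y \<le> g (Suc x)}" if E: "Fin_x_Fin E" for E
    proof -
      obtain k where k: "\<forall>x>k. finite (sect E x)" using bdd[OF E] by blast
      let ?g = "\<lambda>n. case n of 0 \<Rightarrow> k | Suc x \<Rightarrow> Max (sect E x)"
      have "y \<le> Max (sect E x)" if "(x, y) \<in> E" "\<not> x \<le> k" for x y
        using k that by (intro Max_ge) (auto simp: sect_def)
      then show ?thesis by (intro exI[of _ ?g]) auto
    qed
  qed auto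
  have "Fin_x_Fin {(x, y). y \<le> f x}" for f :: "nat \<Rightarrow> nat"
  proof -
    have "finite (sect {(x, y). y \<le> f x} x)" for x by (simp add: sect_def)
    then show ?thesis by (simp add: Fin_x_Fin_def)
  qed
  then show "mincard_le (addw_wit UNIV Fin_x_Fin) b_wit"
    by (intro addw_le_b_of_subgraphs) auto
qed

lemma mincard_empty_x_Fin:
  "mincard_le (bsigma_wit UNIV empty_x_Fin) (bs_wit UNIV empty_x_Fin)"
  "mincard_le (bs_wit UNIV empty_x_Fin) b_wit"
  "mincard_le b_wit (bsigma_wit UNIV empty_x_Fin)"
  "mincard_le (addw_wit UNIV empty_x_Fin) b_wit"
proof -
  have graph: "empty_x_Fin {(x, y). y \<le> f x}" for f :: "nat \<Rightarrow> nat"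
    by (simp add: empty_x_Fin_def sect_def)
  show "mincard_le (bsigma_wit UNIV empty_x_Fin) (bs_wit UNIV empty_x_Fin)"
    by (rule bsigma_le_bs[OF set_ideal_empty_x_Fin, where T = "\<lambda>n. {(x, y). y \<le> n}"])
      (use graph in auto)
  show "mincard_le (bs_wit UNIV empty_x_Fin) b_wit"
  \<comment> \<open>Column 0 alone carries a copy of Fin, so the argument for Fin is repeated inside
    it.\<close>
  proof (rule bs_le_b[OF set_ideal_empty_x_Fin,
        where K = "\<lambda>m. {0} \<times> {..m}" and pos = "\<lambda>i X. \<exists>y\<ge>i. (0, y) \<in> X"])
    show "\<exists>m. \<exists>y\<ge>i. (0, y) \<in> {0} \<times> {..m} - B" if B: "empty_x_Fin B" for B i
    proof -
      have "infinite ({i..} - sect B 0)" using B by (simp add: empty_x_Fin_def infinite_Ici)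
      then obtain y where "y \<in> {i..} - sect B 0" by (metis ex_in_conv finite.emptyI)
      then show ?thesis by (intro exI[of _ y]) (auto simp: sect_def)
    qed
    show "finite {i. \<exists>y\<ge>i. (0, y) \<in> X}" if X: "empty_x_Fin X" for X
    proof -
      have "{i. \<exists>y\<ge>i. (0, y) \<in> X} \<subseteq> (\<Union>y\<in>sect X 0. {..y})" by (auto simp: sect_def)
      then show ?thesis by (rule finite_subset) (use X in \<open>auto simp: empty_x_Fin_def\<close>)
    qed
    show "empty_x_Fin ({0} \<times> {..m})" for m
      unfolding empty_x_Fin_def by (auto simp: sect_def intro: finite_subset[of _ "{..m}"])
  qed (auto simp: mono_def)
  show "mincard_le b_wit (bsigma_wit UNIV empty_x_Fin)"
  proof (rule b_le_bsigma[where U = "\<lambda>g. {(x, y). y \<le> g x}"])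
    show "{(x, y). y \<le> g x} \<subseteq> {(x, y). y \<le> h x}" if "\<And>n. g n \<le> h n" for g h :: "nat \<Rightarrow> nat"
      using that le_trans by blast
    show "\<exists>g. E \<subseteq> {(x, y). y \<le> g x}" if E: "empty_x_Fin E" for E
    proof -
      have "y \<le> Max (sect E x)" if "(x, y) \<in> E" for x y
        using E that by (intro Max_ge) (auto simp: sect_def empty_x_Fin_def)
      then show ?thesis by (intro exI[of _ "\<lambda>x. Max (sect E x)"]) auto
    qed
  qed (use graph in auto)
  show "mincard_le (addw_wit UNIV empty_x_Fin) b_wit"
    by (rule addw_le_b_of_subgraphs) (use graph in \<open>auto simp: empty_x_Fin_def Fin_x_Fin_def\<close>)
qed

text \<open>An enumeration of \<open>C\<close> is a single sequence capturing every member of the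
  ideal. So no family at all is a witness, which is the meaning of the value infinity.\<close>

lemma no_addw_wit:
  assumes I: "I {}" and C: "countable C" "\<And>B. B \<in> C \<Longrightarrow> I B \<and> B \<subseteq> S"
    and cofinal: "\<And>A. I A \<Longrightarrow> A \<subseteq> S \<Longrightarrow> \<exists>B\<in>C. A \<subseteq> B"
  shows "\<not> mincard_finite (addw_wit S I)"
proof
  assume "mincard_finite (addw_wit S I)"
  then obtain \<A> where \<A>: "addw_wit S I \<A>" unfolding mincard_finite_def by blast
  have ne: "C \<noteq> {}" using cofinal[OF I] by blast
  have "\<forall>n. I (from_nat_into C n) \<and> from_nat_into C n \<subseteq> S"
    using C(2) from_nat_into[OF ne] by blast
  then obtain A where A: "A \<in> \<A>" "\<forall>n. \<not> A \<subseteq> from_nat_into C n"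
    using \<A> unfolding addw_wit_def by blast
  have "I A" "A \<subseteq> S" using A(1) \<A> unfolding addw_wit_def by blast+
  from cofinal[OF this] obtain B where B: "B \<in> C" "A \<subseteq> B" by blast
  obtain n where "from_nat_into C n = B" using from_nat_into_surj[OF C(1) B(1)] by blast
  then show False using A(2) B(2) by blast
qed

lemma no_addw_wit_FinI: "\<not> mincard_finite (addw_wit UNIV FinI)"
proof (rule no_addw_wit)
  show "countable {B :: nat set. finite B}" by (rule countable_Collect_finite)
qed (auto simp: FinI_def)

lemma no_addw_wit_Fin_x_empty: "\<not> mincard_finite (addw_wit UNIV Fin_x_empty)"
proof (rule no_addw_wit[of _ "range (\<lambda>m. {..m} \<times> UNIV)"])
  show "Fin_x_empty {}" by (rule set_ideal_empty[OF set_ideal_Fin_x_empty])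
  show "Fin_x_empty B \<and> B \<subseteq> UNIV" if "B \<in> range (\<lambda>m. {..m} \<times> UNIV)" for B
    using that unfolding Fin_x_empty_def
    by (auto simp: sect_def intro: finite_subset[of _ "{.._}"])
  show "\<exists>B\<in>range (\<lambda>m. {..m} \<times> UNIV). A \<subseteq> B" if A: "Fin_x_empty A" for A
  proof -
    obtain k where k: "{x. sect A x \<noteq> {}} \<subseteq> {..k}"
      using A unfolding Fin_x_empty_def finite_nat_iff_bounded_le by blast
    then have "A \<subseteq> {..k} \<times> UNIV" by (force simp: sect_def)
    then show ?thesis by blast
  qed
qed simp

section \<open>Localization and exhaustive ideals\<close>

text \<open>The unlocalized families of Bartoszynski's theorem. The width \<open>8\<^sup>n\<close> is only a convenient choice, as
  slaloms of width \<open>4\<^sup>n\<close>, countably many at a time, can be merged into one of width \<open>8\<^sup>n\<close>.\<close>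

definition loc_wit :: "(nat \<Rightarrow> nat) set \<Rightarrow> bool" where
  "loc_wit F \<longleftrightarrow> \<not> (\<exists>S. (\<forall>n. finite (S n) \<and> card (S n) \<le> 8 ^ n) \<and>
     (\<forall>f\<in>F. eventually (\<lambda>n. f n \<in> S n) sequentially))"

text \<open>\<open>Max (S n)\<close> turns a slalom into a bound, so no slalom captures an unbounded
  family.\<close>

lemma loc_le_b: "mincard_le loc_wit b_wit"
proof (rule mincard_le_image, intro exI)
  fix F assume F: "b_wit F"
  have "loc_wit F"
    unfolding loc_wit_def
  proof (rule notI, elim exE conjE)
    fix S :: "nat \<Rightarrow> nat set"
    assume S: "\<forall>n. finite (S n) \<and> card (S n) \<le> 8 ^ n"
      and F': "\<forall>f\<in>F. eventually (\<lambda>n. f n \<in> S n) sequentially"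
    have "eventually (\<lambda>n. f n \<le> Max (S n)) sequentially" if f: "f \<in> F" for f
      using bspec[OF F' f] by eventually_elim (use S in \<open>auto intro: Max_ge\<close>)
    then have "\<exists>g. \<forall>f\<in>F. eventually (\<lambda>n. f n \<le> g n) sequentially"
      by (intro exI[of _ "\<lambda>n. Max (S n)"] ballI)
    then show False using F unfolding b_wit_def by contradiction
  qed
  then show "loc_wit (id ` F)" by simp
qed

lemma not_loc_wit_of_countable:
  fixes S :: "nat \<Rightarrow> nat \<Rightarrow> nat set"
  assumes S: "\<And>j. eventually (\<lambda>n. finite (S j n) \<and> card (S j n) \<le> 4 ^ n) sequentially"
    and F: "\<And>f. f \<in> F \<Longrightarrow> \<exists>j. eventually (\<lambda>n. f n \<in> S j n) sequentially"
  shows "\<not> loc_wit F"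
proof -
  \<comment> \<open>Slalom number \<open>j\<close> joins \<open>T n\<close> only if
    \<open>j \<le> n\<close> and its width is already correct at \<open>n\<close>. So
    \<open>T n\<close> obeys the width bound at every \<open>n\<close>, although the given bounds
    hold only eventually, and each slalom still joins for all large \<open>n\<close>.\<close>
  let ?J = "\<lambda>n. {j. j \<le> n \<and> finite (S j n) \<and> card (S j n) \<le> 4 ^ n}"
  define T where "T n = (\<Union>j\<in>?J n. S j n)" for n
  have "finite (T n) \<and> card (T n) \<le> 8 ^ n" for n
  proof
    show "finite (T n)" unfolding T_def by auto
    have "card (T n) \<le> (\<Sum>j\<in>?J n. card (S j n))"
      unfolding T_def by (rule card_UN_le) simp
    also have "\<dots> \<le> of_nat (card (?J n)) * 4 ^ n"
      by (rule sum_bounded_above) simp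
    also have "\<dots> \<le> Suc n * 4 ^ n"
    proof -
      have "card (?J n) \<le> card {..n}" by (rule card_mono) auto
      then have "card (?J n) \<le> Suc n" by simp
      then show ?thesis unfolding of_nat_id by (rule mult_right_mono) simp
    qed
    also have "Suc n \<le> 2 ^ n" by (simp add: Suc_le_eq)
    then have "Suc n * 4 ^ n \<le> 2 ^ n * (4 :: nat) ^ n" by (rule mult_right_mono) simp
    also have "\<dots> = 8 ^ n" by (simp flip: power_mult_distrib)
    finally show "card (T n) \<le> 8 ^ n" .
  qed
  moreover have "eventually (\<lambda>n. f n \<in> T n) sequentially" if f: "f \<in> F" for f
  proof -
    obtain j where "eventually (\<lambda>n. f n \<in> S j n) sequentially" using F[OF f] by blast
    then show ?thesis using S[of j] eventually_ge_at_top[of j]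
      by eventually_elim (auto simp: T_def)
  qed
  ultimately show ?thesis unfolding loc_wit_def by blast
qed

lemma strict_mono_locate:
  fixes g :: "nat \<Rightarrow> nat"
  assumes g: "strict_mono g" and x: "g N \<le> x"
  obtains k where "N \<le> k" "g k \<le> x" "x < g (Suc k)"
proof -
  define k where "k = (LEAST k. x < g (Suc k))"
  have "x < g (Suc x)" using strict_mono_imp_increasing[OF g, of "Suc x"] by simp
  then have k1: "x < g (Suc k)" unfolding k_def by (rule LeastI)
  have "N \<le> k"
  proof (rule ccontr)
    assume "\<not> N \<le> k"
    then have "g (Suc k) \<le> g N" using g by (simp add: strict_mono_less_eq)
    then show False using x k1 by simp
  qed
  moreover have "g k \<le> x"
  proof (cases k)
    case 0
    then show ?thesis using x \<open>N \<le> k\<close> by simp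
  next
    case (Suc j)
    then have "\<not> x < g (Suc j)" unfolding k_def using not_less_Least by (metis lessI)
    then show ?thesis using Suc by simp
  qed
  ultimately show ?thesis using that k1 by blast
qed

text \<open>Modelled on Solecki's representation Exh of analytic P-ideals. By
  \<open>phi_mono\<close>, one \<open>m\<close> for each \<open>e\<close> expresses convergence to 0
  along tails. Countable subadditivity is the consequence of lower semicontinuity that sums the
  errors of infinitely many pieces.\<close>

locale exhaustive_ideal =
  fixes \<phi> :: "nat set \<Rightarrow> ennreal" and I :: "nat set \<Rightarrow> bool"
  assumes phi_mono: "A \<subseteq> B \<Longrightarrow> \<phi> A \<le> \<phi> B"
    and phi_empty: "\<phi> {} = 0"
    and phi_UN: "\<And>C :: nat \<Rightarrow> nat set. \<phi> (\<Union>n. C n) \<le> (\<Sum>n. \<phi> (C n))"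
    and I_iff: "I A \<longleftrightarrow> (\<forall>e>0. \<exists>m. \<phi> (A \<inter> {m..}) < ennreal e)"
begin

lemma phi_Un: "\<phi> (A \<union> B) \<le> \<phi> A + \<phi> B"
  using phi_UN[of "binaryset A B"] suminf_binaryset_eq[of \<phi> A B] phi_empty
  by (simp add: UN_binaryset_eq)

lemma phi_UN_finite: "finite F \<Longrightarrow> \<phi> (\<Union>i\<in>F. A i) \<le> (\<Sum>i\<in>F. \<phi> (A i))"
proof (induction F rule: finite_induct)
  case (insert i F)
  have "\<phi> (\<Union>i\<in>insert i F. A i) \<le> \<phi> (A i) + \<phi> (\<Union>i\<in>F. A i)" using phi_Un by simp
  also have "\<dots> \<le> \<phi> (A i) + (\<Sum>i\<in>F. \<phi> (A i))" using insert.IH by (rule add_left_mono)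
  finally show ?case using insert.hyps by simp
qed (simp add: phi_empty)

lemma ideal: "set_ideal I"
  unfolding set_ideal_def
proof (intro conjI allI impI)
  show "I {}" by (simp add: I_iff phi_empty)
  show "I A" if "I B" "A \<subseteq> B" for A B
    unfolding I_iff
  proof (intro allI impI)
    fix e :: real assume "e > 0"
    then obtain m where m: "\<phi> (B \<inter> {m..}) < ennreal e" using \<open>I B\<close> unfolding I_iff by blast
    have "\<phi> (A \<inter> {m..}) \<le> \<phi> (B \<inter> {m..})" using \<open>A \<subseteq> B\<close> by (intro phi_mono) auto
    then show "\<exists>m. \<phi> (A \<inter> {m..}) < ennreal e" using m order_le_less_trans by blast
  qed
  show "I (A \<union> B)" if IA: "I A" and IB: "I B" for A B
    unfolding I_iff
  proof (intro allI impI)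
    fix e :: real assume e: "e > 0"
    then have "e / 2 > 0" by simp
    then obtain m n where m: "\<phi> (A \<inter> {m..}) < ennreal (e / 2)" and n: "\<phi> (B \<inter> {n..}) < ennreal (e / 2)"
      using IA IB unfolding I_iff by meson
    let ?k = "max m n"
    have "\<phi> ((A \<union> B) \<inter> {?k..}) \<le> \<phi> ((A \<inter> {m..}) \<union> (B \<inter> {n..}))"
      by (intro phi_mono) auto
    also have "\<dots> \<le> \<phi> (A \<inter> {m..}) + \<phi> (B \<inter> {n..})" by (rule phi_Un)
    also have "\<dots> < ennreal (e / 2) + ennreal (e / 2)" using m n by (rule add_strict_mono)
    also have "\<dots> = ennreal e" using e by (simp flip: ennreal_plus)
    finally show "\<exists>k. \<phi> ((A \<union> B) \<inter> {k..}) < ennreal e" by blast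
  qed
qed

lemma I_finite: "finite A \<Longrightarrow> I A"
proof -
  assume "finite A"
  then obtain m where "A \<subseteq> {..<m}" using finite_nat_bounded by blast
  then have "A \<inter> {m..} = {}" by auto
  then show "I A" unfolding I_iff by (metis phi_empty ennreal_less_zero_iff)
qed

lemma I_UN:
  assumes C: "\<And>i. I (C i)" and small: "\<And>i. N \<le> i \<Longrightarrow> \<phi> (C i) \<le> ennreal ((1/2) ^ i)"
  shows "I (\<Union>i. C i)"
  unfolding I_iff
proof (intro allI impI)
  fix e :: real assume e: "e > 0"
  \<comment> \<open>\<open>e / 4\<close>, because the geometric tail from \<open>K\<close> on sums
    to \<open>2 * (1/2) ^ K\<close>, which must stay below \<open>e / 2\<close>.\<close>
  then obtain K0 :: nat where K0: "(1/2) ^ K0 < e / 4"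
    using real_arch_pow_inv[of "e / 4" "1/2"] by auto
  define K where "K = max N K0"
  have "(1/2) ^ K \<le> ((1/2) ^ K0 :: real)" unfolding K_def by (rule power_decreasing) auto
  from this K0 have K: "(1/2) ^ K < e / 4" "K \<ge> N"
    by (rule le_less_trans) (simp add: K_def)
  have "I (\<Union>i<K. C i)" by (rule set_ideal_UN[OF ideal]) (auto intro: C)
  then obtain m where m: "\<phi> ((\<Union>i<K. C i) \<inter> {m..}) < ennreal (e / 2)"
    using e unfolding I_iff by (meson half_gt_zero)
  have "\<phi> ((\<Union>i. C i) \<inter> {m..}) \<le> \<phi> (((\<Union>i<K. C i) \<inter> {m..}) \<union> (\<Union>i. C (i + K)))"
  proof (rule phi_mono, rule subsetI)
    fix x assume "x \<in> (\<Union>i. C i) \<inter> {m..}"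
    then obtain i where i: "x \<in> C i" "x \<ge> m" by auto
    show "x \<in> ((\<Union>i<K. C i) \<inter> {m..}) \<union> (\<Union>i. C (i + K))"
    proof (cases "i < K")
      case False
      then have "x \<in> C ((i - K) + K)" using i by simp
      then show ?thesis by blast
    qed (use i in auto)
  qed
  also have "\<dots> \<le> \<phi> ((\<Union>i<K. C i) \<inter> {m..}) + \<phi> (\<Union>i. C (i + K))" by (rule phi_Un)
  also have "\<phi> (\<Union>i. C (i + K)) < ennreal (e / 2)"
  proof -
    have "\<phi> (\<Union>i. C (i + K)) \<le> (\<Sum>i. \<phi> (C (i + K)))" by (rule phi_UN)
    also have "\<dots> \<le> (\<Sum>i. ennreal ((1/2) ^ (i + K)))"
      by (rule suminf_le) (use small K(2) in auto)
    also have "\<dots> = ennreal (2 * (1/2) ^ K)"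
    proof (rule suminf_ennreal_eq)
      have "(\<lambda>i. (1/2) ^ i * (1/2) ^ K) sums (1 / (1 - 1/2) * ((1/2) ^ K :: real))"
        by (intro sums_mult2 geometric_sums) simp
      then show "(\<lambda>i. (1/2) ^ (i + K)) sums (2 * ((1/2) ^ K :: real))"
        by (simp add: power_add)
    qed simp
    also have "\<dots> < ennreal (e / 2)" using K(1) e by (intro ennreal_lessI) simp_all
    finally show ?thesis .
  qed
  with m have "\<phi> ((\<Union>i<K. C i) \<inter> {m..}) + \<phi> (\<Union>i. C (i + K)) < ennreal (e / 2) + ennreal (e / 2)"
    by (rule add_strict_mono)
  also have "\<dots> = ennreal e" using e by (simp flip: ennreal_plus)
  finally show "\<exists>m. \<phi> ((\<Union>i. C i) \<inter> {m..}) < ennreal e" by blast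
qed

text \<open>Modulus of convergence of \<open>A\<close>, meaningful when \<open>I A\<close> and
  \<open>e > 0\<close>. Applied with \<open>e\<close> running through a geometric sequence, it turns
  members of the ideal into functions that b can compare.\<close>

definition tail :: "nat set \<Rightarrow> real \<Rightarrow> nat" where
  "tail A e = (LEAST m. \<phi> (A \<inter> {m..}) < ennreal e)"

lemma phi_tail:
  assumes "I A" "e > 0" "tail A e \<le> m"
  shows "\<phi> (A \<inter> {m..}) < ennreal e"
proof -
  have "\<exists>m. \<phi> (A \<inter> {m..}) < ennreal e" using assms(1,2) unfolding I_iff by blast
  then have "\<phi> (A \<inter> {tail A e..}) < ennreal e" unfolding tail_def by (rule LeastI_ex)
  moreover have "\<phi> (A \<inter> {m..}) \<le> \<phi> (A \<inter> {tail A e..})" using assms(3) by (intro phi_mono) auto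
  ultimately show ?thesis by (rule le_less_trans[rotated])
qed

text \<open>Beyond its modulus \<open>E n\<close> has submeasure below \<open>(1/2) ^ n\<close>, so
  \<open>I_UN\<close> applies. This is the P-ideal property with explicit cut points
  \<open>g\<close>, which many sequences can share.\<close>

lemma I_UN_tails:
  assumes E: "\<And>n. I (E n)" and g: "eventually (\<lambda>n. tail (E n) ((1/2) ^ n) \<le> g n) sequentially"
  shows "I (\<Union>n. E n \<inter> {g n..})"
proof -
  obtain N where N: "\<And>n. N \<le> n \<Longrightarrow> tail (E n) ((1/2) ^ n) \<le> g n"
    using g unfolding eventually_sequentially by blast
  show ?thesis
  proof (rule I_UN)
    show "I (E n \<inter> {g n..})" for n using set_ideal_subset[OF ideal E] by (metis inf_le1)
    show "\<phi> (E n \<inter> {g n..}) \<le> ennreal ((1/2) ^ n)" if "N \<le> n" for n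
      using phi_tail[OF E _ N[OF that]] by (simp add: less_imp_le)
  qed
qed

text \<open>For a dominating \<open>g\<close>, the consecutive intervals with endpoints
  \<open>g n\<close> defeat the family: part \<open>Suc n\<close> starts at \<open>g n\<close>, so
  its intersection with \<open>E i\<close>, for \<open>i \<le> n\<close>, lies in the tail of
  \<open>E i\<close> beyond \<open>g i\<close>.\<close>

lemma b_le_bs: "mincard_le b_wit (bs_wit UNIV I)"
proof (rule mincard_le_image, intro exI)
  fix \<E> assume \<E>: "bs_wit UNIV I \<E>"
  show "b_wit ((\<lambda>E n. tail (E n) ((1/2) ^ n)) ` \<E>)" (is "b_wit ?F")
  proof (rule ccontr)
    assume "\<not> b_wit ?F"
    then obtain g where g: "strict_mono g" "\<And>f. f \<in> ?F \<Longrightarrow> eventually (\<lambda>n. f n \<le> g n) sequentially"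
      using not_b_wit_strict_mono by blast
    have "(\<Union>n. {..<g n}) = UNIV"
    proof -
      have "x < g (Suc x)" for x using strict_mono_imp_increasing[OF g(1), of "Suc x"] by simp
      then have "x \<in> (\<Union>n. {..<g n})" for x by (intro UN_I[of "Suc x"]) auto
      then show ?thesis by (intro equalityI subsetI) simp_all
    qed
    moreover have "finite (disjointed (\<lambda>n. {..<g n}) n)" for n
      by (rule finite_subset[OF disjointed_subset]) simp
    ultimately have "disjointed (\<lambda>n. {..<g n}) \<in> Ppart UNIV I"
      unfolding Ppart_def Phat_def
      by (simp add: disjoint_family_disjointed UN_disjointed_eq I_finite)
    then obtain E where E: "E \<in> \<E>" "\<not> I (\<Union>n. disjointed (\<lambda>n. {..<g n}) (Suc n) \<inter> (\<Union>i\<le>n. E i))"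
      using \<E> unfolding bs_wit_def by blast
    have "I (E n)" for n using \<E> E(1) unfolding bs_wit_def Phat_def by blast
    then have "I (\<Union>n. E n \<inter> {g n..})"
      using g(2)[OF imageI[OF E(1)]] by (rule I_UN_tails)
    moreover have "(\<Union>n. disjointed (\<lambda>n. {..<g n}) (Suc n) \<inter> (\<Union>i\<le>n. E i)) \<subseteq> (\<Union>n. E n \<inter> {g n..})"
    proof
      fix x assume "x \<in> (\<Union>n. disjointed (\<lambda>n. {..<g n}) (Suc n) \<inter> (\<Union>i\<le>n. E i))"
      then obtain n i where x: "x \<in> disjointed (\<lambda>n. {..<g n}) (Suc n)" "i \<le> n" "x \<in> E i" by blast
      then have "x \<ge> g i" by (auto simp: disjointed_def not_less)
      then show "x \<in> (\<Union>n. E n \<inter> {g n..})" using x by blast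
    qed
    ultimately show False using E(2) set_ideal_subset[OF ideal] by blast
  qed
qed

lemma bs_le_b_of_large:
  assumes c: "c > 0"
    and large: "\<And>B i. I B \<Longrightarrow> \<exists>m. ennreal c \<le> \<phi> (({..<m} - B) \<inter> {i..})"
  shows "mincard_le (bs_wit UNIV I) b_wit"
proof (rule bs_le_b[OF ideal, where K = lessThan and pos = "\<lambda>i X. ennreal c \<le> \<phi> (X \<inter> {i..})"])
  show "ennreal c \<le> \<phi> (B \<inter> {i..})" if "ennreal c \<le> \<phi> (A \<inter> {i..})" "A \<subseteq> B" for i A B
  proof -
    have "\<phi> (A \<inter> {i..}) \<le> \<phi> (B \<inter> {i..})" using that(2) by (intro phi_mono) auto
    then show ?thesis using that(1) by (rule order_trans[rotated])
  qed
  show "finite {i. ennreal c \<le> \<phi> (X \<inter> {i..})}" if "I X" for X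
  proof (rule finite_subset)
    show "{i. ennreal c \<le> \<phi> (X \<inter> {i..})} \<subseteq> {..tail X c}"
    proof clarsimp
      fix i assume "ennreal c \<le> \<phi> (X \<inter> {i..})"
      then have "\<not> tail X c \<le> i" using phi_tail[OF that c, of i] leD by blast
      then show "i \<le> tail X c" by linarith
    qed
  qed simp
qed (auto simp: mono_def I_finite large)

text \<open>In the bounded case a sequence \<open>E\<close> is replaced by the union
  \<open>?C E\<close> of its tails beyond \<open>g n\<close>, and the sets \<open>B k\<close> are
  made increasing and receive the initial segments \<open>{..<g n}\<close>. If \<open>B k\<close>
  contained \<open>?C E\<close>, then \<open>E n\<close> would be inside \<open>A n\<close> from
  \<open>k\<close> on.\<close>

lemma addw_le_bsigma:
  assumes ab: "mincard_le (addw_wit UNIV I) b_wit"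
  shows "mincard_le (addw_wit UNIV I) (bsigma_wit UNIV I)"
proof (rule mincard_le_image_cases[OF ab])
  fix \<E> assume \<E>: "bsigma_wit UNIV I \<E>"
  let ?F = "(\<lambda>E n. tail (E n) ((1/2) ^ n)) ` \<E>"
  show "(\<exists>f. addw_wit UNIV I (f ` \<E>)) \<or> (\<exists>f. b_wit (f ` \<E>))"
  proof (cases "b_wit ?F")
    case False
    then obtain g where g: "strict_mono g" "\<And>f. f \<in> ?F \<Longrightarrow> eventually (\<lambda>n. f n \<le> g n) sequentially"
      using not_b_wit_strict_mono by blast
    have EI: "I (E n)" if "E \<in> \<E>" for E n
      using \<E> that unfolding bsigma_wit_def Mseq_def by blast
    let ?C = "\<lambda>E. \<Union>n. E n \<inter> {g n..}"
    have C: "I (?C E)" if "E \<in> \<E>" for E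
      using EI[OF that] g(2)[OF imageI[OF that]] by (rule I_UN_tails)
    have "addw_wit UNIV I (?C ` \<E>)"
      unfolding addw_wit_def
    proof (intro conjI allI impI)
      show "\<forall>A\<in>?C ` \<E>. I A \<and> A \<subseteq> UNIV" using C by auto
      fix B :: "nat \<Rightarrow> nat set" assume B: "\<forall>n. I (B n) \<and> B n \<subseteq> UNIV"
      define A where "A n = (\<Union>k\<le>n. B k) \<union> {..<g n}" for n
      have "I (A n)" for n
        unfolding A_def using B
        by (intro set_ideal_Un[OF ideal] set_ideal_UN[OF ideal]) (auto intro: I_finite)
      moreover have "A n \<subseteq> A (Suc n)" for n
      proof -
        have "g n \<le> g (Suc n)" using g(1) by (simp add: strict_mono_Suc_iff less_imp_le)
        then show ?thesis unfolding A_def by (intro Un_mono UN_mono) auto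
      qed
      ultimately have "A \<in> Mseq UNIV I" unfolding Mseq_def by simp
      then obtain E where E: "E \<in> \<E>" "infinite {n. \<not> E n \<subseteq> A n}"
        using \<E> unfolding bsigma_wit_def by blast
      have "\<not> ?C E \<subseteq> B k" for k
      proof
        assume sub: "?C E \<subseteq> B k"
        have "E n \<subseteq> A n" if "k \<le> n" for n
        proof
          fix x assume x: "x \<in> E n"
          show "x \<in> A n"
          proof (cases "x < g n")
            case False
            then have "x \<in> ?C E" using x by auto
            then show ?thesis using sub that unfolding A_def by blast
          qed (simp add: A_def)
        qed
        then have "{n. \<not> E n \<subseteq> A n} \<subseteq> {..<k}" using not_le by auto
        then show False using E(2) finite_subset by blast
      qed
      then show "\<exists>A\<in>?C ` \<E>. \<forall>n. \<not> A \<subseteq> B n" using E(1) by blast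
    qed
    then show ?thesis by (intro disjI1 exI)
  qed blast
qed

lemma loc_le_addw: "mincard_le loc_wit (addw_wit UNIV I)"
proof (rule mincard_le_image_cases[OF loc_le_b])
  fix \<A> assume \<A>: "addw_wit UNIV I \<A>"
  \<comment> \<open>The base 1/16 is matched to the width: at most \<open>8 ^ k\<close> candidates
    for block \<open>k\<close>, each of submeasure at most \<open>(1/16) ^ k\<close>, cost
    \<open>(1/2) ^ k\<close> together, as \<open>I_UN\<close> requires.\<close>
  let ?F = "(\<lambda>A k. tail A ((1/16) ^ k)) ` \<A>"
  show "(\<exists>f. loc_wit (f ` \<A>)) \<or> (\<exists>f. b_wit (f ` \<A>))"
  proof (cases "b_wit ?F")
    case False
    then obtain g where g: "strict_mono g" "\<And>f. f \<in> ?F \<Longrightarrow> eventually (\<lambda>n. f n \<le> g n) sequentially"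
      using not_b_wit_strict_mono by blast
    let ?code = "\<lambda>A k. set_encode (A \<inter> {g k..<g (Suc k)})"
    have "loc_wit (?code ` \<A>)"
      unfolding loc_wit_def
    proof (rule notI, elim exE conjE)
      fix S :: "nat \<Rightarrow> nat set"
      assume S: "\<forall>n. finite (S n) \<and> card (S n) \<le> 8 ^ n"
        and cap: "\<forall>f\<in>?code ` \<A>. eventually (\<lambda>n. f n \<in> S n) sequentially"
      \<comment> \<open>Candidates of large submeasure are discarded. The true block of a set in the
        family passes the test once \<open>g k\<close> exceeds its modulus.\<close>
      define C where "C k = (\<Union>s\<in>{s\<in>S k. \<phi> (set_decode s) \<le> ennreal ((1/16) ^ k)}. set_decode s)" for k
      have "I (\<Union>k. C k)"
      proof (rule I_UN)
        show "I (C k)" for k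
          unfolding C_def using S by (intro I_finite) auto
        fix k :: nat
        let ?S = "{s\<in>S k. \<phi> (set_decode s) \<le> ennreal ((1/16) ^ k)}"
        have "\<phi> (C k) \<le> (\<Sum>s\<in>?S. \<phi> (set_decode s))"
          unfolding C_def using S by (intro phi_UN_finite) auto
        also have "\<dots> \<le> of_nat (card ?S) * ennreal ((1/16) ^ k)"
          by (rule sum_bounded_above) simp
        also have "\<dots> \<le> of_nat (8 ^ k) * ennreal ((1/16) ^ k)"
        proof (intro mult_right_mono of_nat_mono)
          have "card ?S \<le> card (S k)" using S by (intro card_mono) auto
          then show "card ?S \<le> 8 ^ k" using S order_trans by blast
        qed simp
        also have "\<dots> = ennreal (8 ^ k * (1/16) ^ k)"
          by (simp add: ennreal_mult ennreal_of_nat_eq_real_of_nat)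
        also have "(8 :: real) ^ k * (1/16) ^ k = (1/2) ^ k"
          by (simp flip: power_mult_distrib)
        finally show "\<phi> (C k) \<le> ennreal ((1/2) ^ k)" .
      qed
      \<comment> \<open>The initial segments absorb the finitely many blocks before the capture
        begins.\<close>
      moreover define B where "B m = (\<Union>k. C k) \<union> {..<m}" for m
      ultimately have "\<forall>m. I (B m) \<and> B m \<subseteq> UNIV"
        by (simp add: set_ideal_Un[OF ideal] I_finite)
      then obtain A where A: "A \<in> \<A>" "\<And>m. \<not> A \<subseteq> B m"
        using \<A> unfolding addw_wit_def by blast
      have IA: "I A" using A(1) \<A> unfolding addw_wit_def by blast
      have "eventually (\<lambda>k. tail A ((1/16) ^ k) \<le> g k \<and> ?code A k \<in> S k) sequentially"
        using g(2)[OF imageI[OF A(1)]] bspec[OF cap imageI[OF A(1)]] by (rule eventually_conj)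
      then obtain N where N: "\<And>k. N \<le> k \<Longrightarrow> tail A ((1/16) ^ k) \<le> g k"
        "\<And>k. N \<le> k \<Longrightarrow> ?code A k \<in> S k"
        unfolding eventually_sequentially by blast
      have "A \<subseteq> B (g N)"
      proof
        fix x assume x: "x \<in> A"
        show "x \<in> B (g N)"
        proof (cases "x < g N")
          case False
          then have "g N \<le> x" by simp
          then obtain k where k: "N \<le> k" "g k \<le> x" "x < g (Suc k)"
            using strict_mono_locate[OF g(1)] by blast
          have dec: "set_decode (?code A k) = A \<inter> {g k..<g (Suc k)}" by simp
          have "\<phi> (A \<inter> {g k..<g (Suc k)}) \<le> \<phi> (A \<inter> {g k..})" by (intro phi_mono) auto
          also have "\<dots> \<le> ennreal ((1/16) ^ k)"
            using phi_tail[OF IA _ N(1)[OF k(1)]] by (simp add: less_imp_le)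
          finally have "x \<in> C k"
            unfolding C_def using N(2)[OF k(1)] x k dec by (intro UN_I[of "?code A k"]) auto
          then show ?thesis unfolding B_def by blast
        qed (simp add: B_def)
      qed
      then show False using A(2) by blast
    qed
    then show ?thesis by (intro disjI1 exI)
  qed blast
qed

end

section \<open>The summable ideal and the density ideal\<close>

definition harmonic_measure :: "nat measure" where
  "harmonic_measure = density (count_space UNIV) (\<lambda>n. ennreal (1 / real (n + 1)))"

lemma sets_harmonic_measure [simp]: "sets harmonic_measure = UNIV"
  by (simp add: harmonic_measure_def)

lemma emeasure_harmonic_measure:
  "emeasure harmonic_measure A = (\<integral>\<^sup>+n. ennreal (1 / real (n + 1)) \<partial>count_space A)"
  by (simp add: harmonic_measure_def emeasure_density nn_integral_count_space_indicator)

text \<open>Absolute summability is integrability for the counting measure; the submeasure of the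
  summable ideal is thus a genuine measure, and continuity along monotone sequences of sets becomes
  available.\<close>

lemma I_summ_iff: "I_summ A \<longleftrightarrow> emeasure harmonic_measure A < \<infinity>"
proof -
  let ?f = "\<lambda>n. 1 / real (n + 1)"
  have "I_summ A \<longleftrightarrow> (\<lambda>n. norm (?f n)) summable_on A" by (simp add: I_summ_def)
  also have "\<dots> \<longleftrightarrow> Infinite_Set_Sum.abs_summable_on ?f A" by (simp only: abs_summable_equivalent)
  also have "\<dots> \<longleftrightarrow> (\<integral>\<^sup>+n. norm (?f n) \<partial>count_space A) < \<infinity>"
    by (simp add: Infinite_Set_Sum.abs_summable_on_def integrable_iff_bounded)
  finally show ?thesis by (simp add: emeasure_harmonic_measure)
qed

lemma emeasure_harmonic_finite: "finite A \<Longrightarrow> emeasure harmonic_measure A < \<infinity>"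
  using I_summ_iff[of A] by (simp add: I_summ_def)

lemma exhaustive_I_summ: "exhaustive_ideal (emeasure harmonic_measure) I_summ"
proof
  show "emeasure harmonic_measure A \<le> emeasure harmonic_measure B" if "A \<subseteq> B" for A B
    using that by (intro emeasure_mono) auto
  show "emeasure harmonic_measure (\<Union>n. C n) \<le> (\<Sum>n. emeasure harmonic_measure (C n))"
    for C :: "nat \<Rightarrow> nat set"
    by (intro emeasure_subadditive_countably) auto
  show "I_summ A \<longleftrightarrow> (\<forall>e>0. \<exists>m. emeasure harmonic_measure (A \<inter> {m..}) < ennreal e)" for A
  proof
    assume "I_summ A"
    then have fin: "emeasure harmonic_measure A < \<infinity>" by (simp add: I_summ_iff)
    have "(\<lambda>m. emeasure harmonic_measure (A \<inter> {m..})) \<longlonglongrightarrow> emeasure harmonic_measure (\<Inter>m. A \<inter> {m..})"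
    proof (rule Lim_emeasure_decseq)
      show "decseq (\<lambda>m. A \<inter> {m..})" by (auto simp: decseq_def)
      show "emeasure harmonic_measure (A \<inter> {i..}) \<noteq> \<infinity>" for i
        using fin emeasure_mono[of "A \<inter> {i..}" A harmonic_measure] by (auto simp: top_unique)
    qed auto
    also have "(\<Inter>m. A \<inter> {m..}) = {}"
    proof -
      have "x \<notin> A \<inter> {Suc x..}" for x by simp
      then show ?thesis by blast
    qed
    finally have lim: "(\<lambda>m. emeasure harmonic_measure (A \<inter> {m..})) \<longlonglongrightarrow> 0" by simp
    show "\<forall>e>0. \<exists>m. emeasure harmonic_measure (A \<inter> {m..}) < ennreal e"
    proof (intro allI impI)
      fix e :: real assume "e > 0"
      then have "eventually (\<lambda>m. emeasure harmonic_measure (A \<inter> {m..}) < ennreal e) sequentially"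
        using order_tendstoD(2)[OF lim] by simp
      then show "\<exists>m. emeasure harmonic_measure (A \<inter> {m..}) < ennreal e"
        unfolding eventually_sequentially by blast
    qed
  next
    assume "\<forall>e>0. \<exists>m. emeasure harmonic_measure (A \<inter> {m..}) < ennreal e"
    then obtain m where m: "emeasure harmonic_measure (A \<inter> {m..}) < ennreal 1"
      using zero_less_one by blast
    have "emeasure harmonic_measure A \<le> emeasure harmonic_measure ({..<m} \<union> (A \<inter> {m..}))"
      by (intro emeasure_mono) auto
    also have "\<dots> \<le> emeasure harmonic_measure {..<m} + emeasure harmonic_measure (A \<inter> {m..})"
      by (intro emeasure_subadditive) auto
    also have "\<dots> < \<infinity>"
      using m emeasure_harmonic_finite[of "{..<m}"] by (auto simp: less_top[symmetric])
    finally show "I_summ A" by (simp add: I_summ_iff)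
  qed
qed simp

lemma emeasure_harmonic_UNIV: "emeasure harmonic_measure UNIV = \<infinity>"
proof (rule ccontr)
  assume "emeasure harmonic_measure UNIV \<noteq> \<infinity>"
  then have "I_summ UNIV" by (simp add: I_summ_iff less_top)
  then have "summable (\<lambda>n. 1 / real (n + 1))"
    unfolding I_summ_def by (subst (asm) summable_on_UNIV_nonneg_real_iff) auto
  then have "summable (\<lambda>n. inverse (real (Suc n)))" by (simp add: inverse_eq_divide)
  then show False using not_summable_harmonic[where 'a = real] by (subst (asm) summable_Suc_iff) simp
qed

lemma I_summ_large:
  assumes B: "I_summ B"
  shows "\<exists>m. ennreal 1 \<le> emeasure harmonic_measure (({..<m} - B) \<inter> {i..})"
proof -
  let ?X = "\<lambda>m. ({..<m} - B) \<inter> {i..}"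
  have "emeasure harmonic_measure (\<Union>m. ?X m) = \<infinity>"
  proof (rule ccontr)
    assume "emeasure harmonic_measure (\<Union>m. ?X m) \<noteq> \<infinity>"
    then have X: "I_summ (\<Union>m. ?X m)" by (simp add: I_summ_iff less_top)
    have "x \<in> (\<Union>m. ?X m) \<union> (B \<union> {..<i})" for x
    proof -
      have "x \<in> ?X (Suc x) \<or> x \<in> B \<union> {..<i}" by auto
      then show ?thesis by blast
    qed
    then have eq: "(\<Union>m. ?X m) \<union> (B \<union> {..<i}) = UNIV" by blast
    interpret exhaustive_ideal "emeasure harmonic_measure" I_summ by (rule exhaustive_I_summ)
    have "I_summ ((\<Union>m. ?X m) \<union> (B \<union> {..<i}))"
      by (intro set_ideal_Un[OF ideal] X B I_finite) simp
    then show False unfolding eq by (simp add: I_summ_iff emeasure_harmonic_UNIV)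
  qed
  moreover have "(SUP m. emeasure harmonic_measure (?X m)) = emeasure harmonic_measure (\<Union>m. ?X m)"
    by (rule SUP_emeasure_incseq) (auto simp: incseq_def)
  ultimately have top: "(SUP m. emeasure harmonic_measure (?X m)) = \<infinity>" by (simp only:)
  have "1 < (SUP m. emeasure harmonic_measure (?X m))" unfolding top by simp
  then obtain m where "1 < emeasure harmonic_measure (?X m)" by (auto simp: less_SUP_iff)
  then show ?thesis by (intro exI[of _ m]) (simp add: less_imp_le)
qed

text \<open>A supremum instead of a limsup: upper density is not countably subadditive, the supremum
  is. Density zero reappears along tails, because \<open>A \<inter> {m..}\<close> counts nothing for
  \<open>n \<le> m\<close>.\<close>

definition upper_density_bound :: "nat set \<Rightarrow> ennreal" where
  "upper_density_bound A = (SUP n. ennreal (real (card (A \<inter> {..<n})) / real (n + 1)))"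

lemma Id_densD:
  assumes "Id_dens A" "e > 0"
  shows "eventually (\<lambda>n. real (card (A \<inter> {..<n})) / real (n + 1) < e) sequentially"
  using assms(1) unfolding Id_dens_def by (rule order_tendstoD(2)) (rule assms(2))

lemma upper_density_bound_le_iff:
  "0 \<le> c \<Longrightarrow> upper_density_bound A \<le> ennreal c \<longleftrightarrow> (\<forall>n. real (card (A \<inter> {..<n})) / real (n + 1) \<le> c)"
  by (simp add: upper_density_bound_def SUP_le_iff)

lemma exhaustive_Id_dens: "exhaustive_ideal upper_density_bound Id_dens"
proof
  show "upper_density_bound A \<le> upper_density_bound B" if "A \<subseteq> B" for A B
    unfolding upper_density_bound_def
  proof (intro SUP_mono, intro bexI)
    fix n
    have "card (A \<inter> {..<n}) \<le> card (B \<inter> {..<n})" using that by (intro card_mono) auto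
    then show "ennreal (real (card (A \<inter> {..<n})) / real (n + 1)) \<le> ennreal (real (card (B \<inter> {..<n})) / real (n + 1))"
      by (intro ennreal_leI divide_right_mono) auto
  qed simp
  show "upper_density_bound {} = 0" by (simp add: upper_density_bound_def)
  show "upper_density_bound (\<Union>k. C k) \<le> (\<Sum>k. upper_density_bound (C k))"
    for C :: "nat \<Rightarrow> nat set"
    unfolding upper_density_bound_def[of "\<Union>k. C k"]
  proof (rule SUP_least)
    fix n :: nat
    have conv: "ennreal (real (card (A \<inter> {..<n})) / real (n + 1)) =
        emeasure (count_space UNIV) (A \<inter> {..<n}) / of_nat (n + 1)" for A :: "nat set"
      by (simp add: emeasure_count_space_finite ennreal_of_nat_eq_real_of_nat divide_ennreal
          del: of_nat_Suc of_nat_add)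
    have "emeasure (count_space UNIV) ((\<Union>k. C k) \<inter> {..<n}) \<le> (\<Sum>k. emeasure (count_space UNIV) (C k \<inter> {..<n}))"
      using emeasure_subadditive_countably[of "\<lambda>k. C k \<inter> {..<n}" "count_space UNIV"]
      by (simp add: UN_simps)
    then have "ennreal (real (card ((\<Union>k. C k) \<inter> {..<n})) / real (n + 1)) \<le>
        (\<Sum>k. ennreal (real (card (C k \<inter> {..<n})) / real (n + 1)))"
      unfolding conv ennreal_suminf_divide by (rule divide_right_mono_ennreal)
    also have "\<dots> \<le> (\<Sum>k. upper_density_bound (C k))"
      unfolding upper_density_bound_def by (intro suminf_le SUP_upper) auto
    finally show "ennreal (real (card ((\<Union>k. C k) \<inter> {..<n})) / real (n + 1)) \<le>
      (\<Sum>k. upper_density_bound (C k))" .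
  qed
  show "Id_dens A \<longleftrightarrow> (\<forall>e>0. \<exists>m. upper_density_bound (A \<inter> {m..}) < ennreal e)" for A
  proof
    assume A: "Id_dens A"
    show "\<forall>e>0. \<exists>m. upper_density_bound (A \<inter> {m..}) < ennreal e"
    proof (intro allI impI)
      fix e :: real assume e: "e > 0"
      then obtain N where N: "\<And>n. N \<le> n \<Longrightarrow> real (card (A \<inter> {..<n})) / real (n + 1) < e / 2"
        using Id_densD[OF A, of "e / 2"] unfolding eventually_sequentially by auto
      have "real (card (A \<inter> {N..} \<inter> {..<n})) / real (n + 1) \<le> e / 2" for n
      proof (cases "N \<le> n")
        case True
        have "card (A \<inter> {N..} \<inter> {..<n}) \<le> card (A \<inter> {..<n})" by (intro card_mono) auto
        then have "real (card (A \<inter> {N..} \<inter> {..<n})) / real (n + 1) \<le> real (card (A \<inter> {..<n})) / real (n + 1)"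
          by (intro divide_right_mono) auto
        then show ?thesis using N[OF True] by linarith
      next
        case False
        then have "A \<inter> {N..} \<inter> {..<n} = {}" by auto
        then show ?thesis using e by simp
      qed
      then have "upper_density_bound (A \<inter> {N..}) \<le> ennreal (e / 2)"
        using e by (subst upper_density_bound_le_iff) auto
      also have "\<dots> < ennreal e" using e by (intro ennreal_lessI) auto
      finally show "\<exists>m. upper_density_bound (A \<inter> {m..}) < ennreal e" by blast
    qed
  next
    assume *: "\<forall>e>0. \<exists>m. upper_density_bound (A \<inter> {m..}) < ennreal e"
    show "Id_dens A"
      unfolding Id_dens_def
    proof (rule tendstoI)
      fix e :: real assume e: "e > 0"
      then have "e / 2 > 0" by simp
      then obtain m where "upper_density_bound (A \<inter> {m..}) < ennreal (e / 2)"
        using * by blast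
      then have m: "real (card (A \<inter> {m..} \<inter> {..<n})) / real (n + 1) \<le> e / 2" for n
        using upper_density_bound_le_iff[of "e / 2" "A \<inter> {m..}"] e by (simp add: less_imp_le)
      have "(\<lambda>n. real m / real (n + 1)) \<longlonglongrightarrow> 0" by real_asymp
      then have "eventually (\<lambda>n. real m / real (n + 1) < e / 2) sequentially"
        by (rule order_tendstoD(2)) (use e in simp)
      then show "eventually (\<lambda>n. dist (real (card (A \<inter> {..<n})) / real (n + 1)) 0 < e) sequentially"
      proof eventually_elim
        case (elim n)
        have "card (A \<inter> {..<n}) \<le> card ({..<m} \<union> (A \<inter> {m..} \<inter> {..<n}))" by (intro card_mono) auto
        also have "\<dots> \<le> m + card (A \<inter> {m..} \<inter> {..<n})"
          using card_Un_le[of "{..<m}"] by simp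
        finally have "real (card (A \<inter> {..<n})) / real (n + 1) \<le>
            real m / real (n + 1) + real (card (A \<inter> {m..} \<inter> {..<n})) / real (n + 1)"
          unfolding add_divide_distrib[symmetric] by (intro divide_right_mono) linarith+
        then have "real (card (A \<inter> {..<n})) / real (n + 1) < e" using elim m[of n] by linarith
        then show ?case by (simp add: dist_real_def)
      qed
    qed
  qed
qed

lemma Id_dens_large:
  assumes B: "Id_dens B"
  shows "\<exists>m. ennreal (1/4) \<le> upper_density_bound (({..<m} - B) \<inter> {i..})"
proof -
  have "eventually (\<lambda>n. real (card (B \<inter> {..<n})) / real (n + 1) < 1/4) sequentially"
    using B by (rule Id_densD) simp
  \<comment> \<open>\<open>2 * i + 1 \<le> m\<close> leaves at least \<open>(m + 1) / 2\<close>
    numbers in \<open>{i..<m}\<close>, and \<open>B\<close> takes fewer than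
    \<open>(m + 1) / 4\<close> of them.\<close>
  then have "eventually (\<lambda>n. real (card (B \<inter> {..<n})) / real (n + 1) < 1/4 \<and> 2 * i + 1 \<le> n) sequentially"
    by (rule eventually_conj[OF _ eventually_ge_at_top])
  then obtain m where m: "real (card (B \<inter> {..<m})) / real (m + 1) < 1/4" "2 * i + 1 \<le> m"
    unfolding eventually_sequentially by blast
  let ?X = "({..<m} - B) \<inter> {i..}"
  have "card {i..<m} \<le> card (?X \<union> (B \<inter> {..<m}))" by (intro card_mono) auto
  also have "\<dots> \<le> card ?X + card (B \<inter> {..<m})" by (rule card_Un_le)
  finally have "real (m - i) \<le> real (card ?X) + real (card (B \<inter> {..<m}))" by simp
  then have "1/4 * real (m + 1) \<le> real (card ?X)"
    using m by (simp add: field_simps of_nat_diff)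
  then have "1/4 \<le> real (card (?X \<inter> {..<m})) / real (m + 1)"
    by (simp add: field_simps Int_absorb2 subset_iff)
  then have "ennreal (1/4) \<le> ennreal (real (card (?X \<inter> {..<m})) / real (m + 1))"
    by (rule ennreal_leI)
  also have "\<dots> \<le> upper_density_bound ?X" unfolding upper_density_bound_def by (rule SUP_upper) simp
  finally show ?thesis by blast
qed

lemma mincard_I_summ:
  "mincard_le b_wit (bs_wit UNIV I_summ)"
  "mincard_le (bs_wit UNIV I_summ) b_wit"
  "mincard_le loc_wit (addw_wit UNIV I_summ)"
  "mincard_le (addw_wit UNIV I_summ) b_wit \<Longrightarrow>
    mincard_le (addw_wit UNIV I_summ) (bsigma_wit UNIV I_summ)"
proof -
  interpret exhaustive_ideal "emeasure harmonic_measure" I_summ by (rule exhaustive_I_summ)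
  show "mincard_le b_wit (bs_wit UNIV I_summ)" by (rule b_le_bs)
  show "mincard_le (bs_wit UNIV I_summ) b_wit" by (rule bs_le_b_of_large[OF zero_less_one I_summ_large])
  show "mincard_le loc_wit (addw_wit UNIV I_summ)" by (rule loc_le_addw)
  show "mincard_le (addw_wit UNIV I_summ) (bsigma_wit UNIV I_summ)"
    if "mincard_le (addw_wit UNIV I_summ) b_wit" using that by (rule addw_le_bsigma)
qed

lemma mincard_Id_dens:
  "mincard_le b_wit (bs_wit UNIV Id_dens)"
  "mincard_le (bs_wit UNIV Id_dens) b_wit"
  "mincard_le loc_wit (addw_wit UNIV Id_dens)"
  "mincard_le (addw_wit UNIV Id_dens) b_wit \<Longrightarrow>
    mincard_le (addw_wit UNIV Id_dens) (bsigma_wit UNIV Id_dens)"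
proof -
  interpret exhaustive_ideal upper_density_bound Id_dens by (rule exhaustive_Id_dens)
  show "mincard_le b_wit (bs_wit UNIV Id_dens)" by (rule b_le_bs)
  show "mincard_le (bs_wit UNIV Id_dens) b_wit" by (rule bs_le_b_of_large[OF _ Id_dens_large]) simp
  show "mincard_le loc_wit (addw_wit UNIV Id_dens)" by (rule loc_le_addw)
  show "mincard_le (addw_wit UNIV Id_dens) (bsigma_wit UNIV Id_dens)"
    if "mincard_le (addw_wit UNIV Id_dens) b_wit" using that by (rule addw_le_bsigma)
qed

section \<open>Additivity of the density ideal\<close>

lemma digit_mod_power:
  fixes D :: nat
  assumes "0 < D" "i < M"
  shows "(m mod D ^ M) div D ^ i mod D = m div D ^ i mod D"
proof -
  obtain k where M: "M = i + Suc k" using assms(2) less_imp_Suc_add by auto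
  have "m mod D ^ M = D ^ i * (m div D ^ i mod D ^ Suc k) + m mod D ^ i"
    unfolding M power_add by (rule mod_mult2_eq)
  then have "(m mod D ^ M) div D ^ i = m div D ^ i mod D ^ Suc k"
    using assms(1) by simp
  then show ?thesis by (simp add: mod_mod_cancel)
qed

lemma card_nonzero_digits:
  fixes D :: nat
  assumes D: "0 < D"
  shows "card {m. m < D ^ M \<and> (\<forall>i\<in>T. i < M \<longrightarrow> m div D ^ i mod D \<noteq> 0)} =
    (\<Prod>i<M. if i \<in> T then D - 1 else D)"
proof (induction M)
  case (Suc M)
  let ?X = "\<lambda>M. {m. m < D ^ M \<and> (\<forall>i\<in>T. i < M \<longrightarrow> m div D ^ i mod D \<noteq> 0)}"
  let ?R = "if M \<in> T then {0<..<D} else {..<D}"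
  have "bij_betw (\<lambda>m. (m div D ^ M, m mod D ^ M)) (?X (Suc M)) (?R \<times> ?X M)"
  proof (rule bij_betw_byWitness[where f' = "\<lambda>(d, m). d * D ^ M + m"])
    show "\<forall>m\<in>?X (Suc M). (\<lambda>(d, m). d * D ^ M + m) (m div D ^ M, m mod D ^ M) = m"
      by (auto intro: div_mult_mod_eq)
    show "\<forall>p\<in>?R \<times> ?X M. (\<lambda>m. (m div D ^ M, m mod D ^ M)) ((\<lambda>(d, m). d * D ^ M + m) p) = p"
      using D by auto
    show "(\<lambda>m. (m div D ^ M, m mod D ^ M)) ` ?X (Suc M) \<subseteq> ?R \<times> ?X M"
    proof (rule image_subsetI)
      fix m assume m: "m \<in> ?X (Suc M)"
      then have lt: "m div D ^ M < D" by (simp add: less_mult_imp_div_less)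
      have "m div D ^ M \<in> ?R" using m lt by auto
      moreover have "m mod D ^ M \<in> ?X M" using m D by (auto simp: digit_mod_power)
      ultimately show "(m div D ^ M, m mod D ^ M) \<in> ?R \<times> ?X M" by blast
    qed
    show "(\<lambda>(d, m). d * D ^ M + m) ` (?R \<times> ?X M) \<subseteq> ?X (Suc M)"
    proof (rule image_subsetI, elim SigmaE, hypsubst)
      fix d m assume d: "d \<in> ?R" and m: "m \<in> ?X M"
      let ?n = "d * D ^ M + m"
      have dD: "d < D" using d by (auto split: if_splits)
      have "?n < Suc d * D ^ M" using m by simp
      also have "\<dots> \<le> D * D ^ M" using dD by (intro mult_right_mono) auto
      finally have "?n < D ^ Suc M" by simp
      moreover have "?n div D ^ i mod D \<noteq> 0" if "i \<in> T" "i < Suc M" for i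
      proof (cases "i = M")
        case True
        then show ?thesis using d m D that dD by auto
      next
        case False
        then have "i < M" using that by simp
        have "?n div D ^ i mod D = (?n mod D ^ M) div D ^ i mod D"
          using digit_mod_power[OF D \<open>i < M\<close>, of ?n] by simp
        also have "?n mod D ^ M = m" using m by simp
        finally show ?thesis using m that(1) \<open>i < M\<close> by simp
      qed
      ultimately show "(\<lambda>(d, m). d * D ^ M + m) (d, m) \<in> ?X (Suc M)" by simp
    qed
  qed
  then have "card (?X (Suc M)) = card (?R \<times> ?X M)" by (rule bij_betw_same_card)
  also have "\<dots> = (if M \<in> T then D - 1 else D) * card (?X M)" by (simp add: card_cartesian_product)
  finally show ?case using Suc.IH by (simp add: mult.commute)
qed simp

text \<open>Vanishing of a given digit has probability \<open>1 / D\<close>, independently for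
  different digits, so all positions in \<open>T\<close> avoid 0 with probability
  \<open>(1 - 1 / D) ^ card T\<close>. The exponential bound serves the density ideal directly and
  Lebesgue measure later.\<close>

lemma card_nonzero_digits_le:
  fixes D :: nat
  assumes D: "0 < D" and T: "T \<subseteq> {..<M}"
  shows "real (card {m. m < D ^ M \<and> (\<forall>i\<in>T. m div D ^ i mod D \<noteq> 0)})
    \<le> real D ^ M * exp (- real (card T) / real D)"
proof -
  have fT: "finite T" using T finite_subset by blast
  have eq: "{m. m < D ^ M \<and> (\<forall>i\<in>T. m div D ^ i mod D \<noteq> 0)} =
      {m. m < D ^ M \<and> (\<forall>i\<in>T. i < M \<longrightarrow> m div D ^ i mod D \<noteq> 0)}"
    using T by blast
  have "real (card {m. m < D ^ M \<and> (\<forall>i\<in>T. m div D ^ i mod D \<noteq> 0)})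
      = (\<Prod>i<M. real D * (if i \<in> T then 1 - 1 / real D else 1))"
    unfolding eq card_nonzero_digits[OF D] of_nat_prod
    by (rule prod.cong) (use D in \<open>auto simp: of_nat_diff right_diff_distrib\<close>)
  also have "\<dots> = real D ^ M * (\<Prod>i<M. if i \<in> T then 1 - 1 / real D else 1)"
    by (simp add: prod.distrib)
  also have "(\<Prod>i<M. if i \<in> T then 1 - 1 / real D else 1) = (1 - 1 / real D) ^ card T"
    using T by (simp add: prod.If_cases Int_absorb1 Int_def[symmetric])
  also have "(1 - 1 / real D) ^ card T \<le> exp (- 1 / real D) ^ card T"
    using exp_ge_add_one_self[of "- 1 / real D"] D by (intro power_mono) (auto simp: field_simps)
  also have "exp (- 1 / real D) ^ card T = exp (- real (card T) / real D)"
    by (simp flip: exp_of_nat_mult)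
  finally show ?thesis by (simp add: mult_left_mono)
qed

lemma card_zero_digit:
  fixes D :: nat
  assumes D: "0 < D" and i: "i < M"
  shows "card {m. m < D ^ M \<and> m div D ^ i mod D = 0} * D = D ^ M"
proof -
  obtain k where M: "M = Suc k" using i by (cases M) auto
  let ?Z = "{m. m < D ^ M \<and> m div D ^ i mod D = 0}"
  let ?N = "{m. m < D ^ M \<and> (\<forall>j\<in>{i}. j < M \<longrightarrow> m div D ^ j mod D \<noteq> 0)}"
  have "(\<Prod>j<M. if j \<in> {i} then D - 1 else D) = (D - 1) * (\<Prod>j\<in>{..<M} - {i}. if j \<in> {i} then D - 1 else D)"
    using i by (subst prod.remove[of _ i]) auto
  also have "(\<Prod>j\<in>{..<M} - {i}. if j \<in> {i} then D - 1 else D) = (\<Prod>j\<in>{..<M} - {i}. D)"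
    by (rule prod.cong) auto
  also have "\<dots> = D ^ k" using i M by simp
  finally have N: "card ?N = (D - 1) * D ^ k" using card_nonzero_digits[OF D, of M "{i}"] by simp
  have "?Z \<union> ?N = {..<D ^ M}" "?Z \<inter> ?N = {}" using i by auto
  then have "card ?Z + card ?N = D ^ M"
    by (metis (no_types, lifting) card_Un_disjoint card_lessThan finite_Un finite_lessThan)
  moreover have "D ^ M = D ^ k + (D - 1) * D ^ k" unfolding M using D by (cases D) auto
  ultimately have "card ?Z = D ^ k" using N by simp
  then show ?thesis using M by simp
qed

text \<open>The growth of \<open>R\<close> makes everything before block \<open>n + 1\<close> negligible at \<open>R (n + 1)\<close>.\<close>

lemma Id_dens_blocks:
  assumes R0: "0 < R 0" and R: "\<And>n. 2 ^ (n + 2) * R n \<le> R (Suc n)"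
    and C: "\<And>n. C n \<subseteq> {R n..<2 * R n}" and cardC: "\<And>n. card (C n) * 2 ^ n \<le> R n"
  shows "Id_dens (\<Union>n. C n)"
proof -
  have Rpos: "0 < R n" for n
  proof (induction n)
    case (Suc n)
    then have "0 < 2 ^ (n + 2) * R n" by simp
    then show ?case using R[of n] by linarith
  qed (rule R0)
  have R2: "2 * R n \<le> R (Suc n)" for n
  proof -
    have "2 * R n \<le> 2 ^ (n + 2) * R n" by (intro mult_right_mono) auto
    then show ?thesis using R[of n] by linarith
  qed
  have "R n < R (Suc n)" for n using R2[of n] Rpos[of n] by linarith
  then have Rmono: "strict_mono R" by (simp add: strict_mono_Suc_iff)
  let ?A = "\<Union>n. C n"
  have finC: "finite (C n)" for n using C finite_subset by blast
  \<comment> \<open>Up to \<open>r\<close> only the numbers below \<open>2 * R n\<close> and the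
    block \<open>C (Suc n)\<close> can occur. After multiplication by \<open>2 ^ Suc n\<close> each
    contributes at most \<open>R (Suc n)\<close>, the former by the growth of \<open>R\<close>, the
    latter by \<open>cardC\<close>.\<close>
  have bound: "card (?A \<inter> {..<r}) * 2 ^ Suc n \<le> 2 * r" if r: "R (Suc n) \<le> r" "r < R (Suc (Suc n))" for n r
  proof -
    have "?A \<inter> {..<r} \<subseteq> {..<2 * R n} \<union> C (Suc n)"
    proof
      fix x assume x: "x \<in> ?A \<inter> {..<r}"
      then obtain k where k: "x \<in> C k" by blast
      then have kx: "R k \<le> x" "x < 2 * R k" using C[of k] by auto
      have "R k < R (Suc (Suc n))" using kx x r by auto
      then have "k < Suc (Suc n)" using Rmono by (simp add: strict_mono_less)
      show "x \<in> {..<2 * R n} \<union> C (Suc n)"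
      proof (cases "k = Suc n")
        case False
        then have "k \<le> n" using \<open>k < Suc (Suc n)\<close> by simp
        then have "R k \<le> R n" using Rmono by (simp add: strict_mono_less_eq)
        then show ?thesis using kx by auto
      qed (use k in auto)
    qed
    then have "card (?A \<inter> {..<r}) \<le> card ({..<2 * R n} \<union> C (Suc n))"
      using finC by (intro card_mono) auto
    also have "\<dots> \<le> 2 * R n + card (C (Suc n))" using card_Un_le[of "{..<2 * R n}" "C (Suc n)"] by simp
    finally have "card (?A \<inter> {..<r}) * 2 ^ Suc n \<le> (2 * R n + card (C (Suc n))) * 2 ^ Suc n"
      by (rule mult_right_mono) simp
    also have "\<dots> = 2 ^ (n + 2) * R n + card (C (Suc n)) * 2 ^ Suc n" by (simp add: algebra_simps)
    also have "\<dots> \<le> R (Suc n) + R (Suc n)" using R[of n] cardC[of "Suc n"] by (rule add_mono)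
    finally show ?thesis using r(1) by simp
  qed
  show ?thesis
    unfolding Id_dens_def
  proof (rule tendstoI)
    fix e :: real assume "e > 0"
    then obtain N where N: "(1/2) ^ N < e" using real_arch_pow_inv[of e "1/2"] by auto
    show "eventually (\<lambda>r. dist (real (card (?A \<inter> {..<r})) / real (r + 1)) 0 < e) sequentially"
      using eventually_ge_at_top[of "R (Suc N)"]
    proof eventually_elim
      case (elim r)
      obtain k where k: "Suc N \<le> k" "R k \<le> r" "r < R (Suc k)"
        using strict_mono_locate[OF Rmono elim] by blast
      obtain n where n: "k = Suc n" "N \<le> n" using k(1) by (cases k) auto
      have "real (card (?A \<inter> {..<r}) * 2 ^ Suc n) \<le> real (2 * r)"
        using bound[of n r] k n by (intro of_nat_mono) simp
      then have "real (card (?A \<inter> {..<r})) * 2 ^ n \<le> real (r + 1)" by simp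
      then have "real (card (?A \<inter> {..<r})) / real (r + 1) \<le> (1/2) ^ n"
        by (simp add: field_simps)
      also have "\<dots> \<le> (1/2) ^ N" using n(2) by (intro power_decreasing) auto
      finally show ?case using N by (simp add: dist_real_def)
    qed
  qed
qed

text \<open>The block of \<open>f\<close> at stage \<open>n\<close> starts at
  \<open>2 ^ h f n\<close> and has \<open>2 ^ h f n / 2 ^ n\<close> elements. A set containing it
  still has density of order \<open>(1/2) ^ n\<close> at \<open>2 * 2 ^ h f n\<close>, so this
  position precedes the point after which the density stays small. That point therefore bounds
  \<open>f n\<close>.\<close>

lemma addw_Id_dens_le_b: "mincard_le (addw_wit UNIV Id_dens) b_wit"
proof (rule mincard_le_image, intro exI)
  fix F assume F: "b_wit F"
  \<comment> \<open>The summand \<open>k + 2\<close> yields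
    \<open>h f n + n + 2 \<le> h f (Suc n)\<close>, the growth that \<open>Id_dens_blocks\<close>
    demands of \<open>R n = 2 ^ h f n\<close>.\<close>
  define h where "h f n = (\<Sum>k\<le>n. f k + k + 2)" for f :: "nat \<Rightarrow> nat" and n
  define C where "C f n = {2 ^ h f n..<2 ^ h f n + 2 ^ (h f n - n) :: nat}" for f n
  have h: "f n \<le> h f n" "n \<le> h f n" "h f n + n + 2 \<le> h f (Suc n)" for f n
  proof -
    have "f n + n + 2 \<le> h f n" unfolding h_def by (rule member_le_sum) auto
    then show "f n \<le> h f n" "n \<le> h f n" by auto
  qed (simp add: h_def)
  have C: "C f n \<subseteq> {2 ^ h f n..<2 * 2 ^ h f n}" for f n
  proof -
    have "2 ^ (h f n - n) \<le> (2 :: nat) ^ h f n" by (rule power_increasing) auto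
    then show ?thesis by (auto simp: C_def)
  qed
  have cardC: "card (C f n) * 2 ^ n = 2 ^ h f n" for f n
    using h(2) by (simp add: C_def flip: power_add)
  have dens: "Id_dens (\<Union>n. C f n)" for f
  proof (rule Id_dens_blocks[where R = "\<lambda>n. 2 ^ h f n"])
    show "2 ^ (n + 2) * 2 ^ h f n \<le> (2 :: nat) ^ h f (Suc n)" for n
      unfolding power_add[symmetric] using h(3)[of f n] by (intro power_increasing) auto
  qed (use C cardC in auto)
  show "addw_wit UNIV Id_dens ((\<lambda>f. \<Union>n. C f n) ` F)"
    unfolding addw_wit_def
  proof (intro conjI allI impI)
    show "\<forall>A\<in>(\<lambda>f. \<Union>n. C f n) ` F. Id_dens A \<and> A \<subseteq> UNIV" using dens by auto
    fix B :: "nat \<Rightarrow> nat set" assume B: "\<forall>m. Id_dens (B m) \<and> B m \<subseteq> UNIV"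
    show "\<exists>A\<in>(\<lambda>f. \<Union>n. C f n) ` F. \<forall>m. \<not> A \<subseteq> B m"
    proof (rule ccontr)
      assume "\<not> ?thesis"
      then have cover: "\<exists>m. (\<Union>n. C f n) \<subseteq> B m" if "f \<in> F" for f using that by blast
      \<comment> \<open>With \<open>q = 2 ^ h f n\<close>, the block alone forces the quotient
        \<open>(1/2) ^ n * q / (2 * q + 1)\<close>, at least \<open>(1/2) ^ n / 3\<close>, at
        position \<open>2 * q\<close>. A quarter is safely below a third.\<close>
      have "\<exists>N. \<forall>r\<ge>N. real (card (B m \<inter> {..<r})) / real (r + 1) < (1/2) ^ n / 4" for m n
      proof -
        have "Id_dens (B m)" using B by blast
        then show ?thesis
          using Id_densD[of "B m" "(1/2) ^ n / 4"] unfolding eventually_sequentially by simp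
      qed
      then obtain G where G: "real (card (B m \<inter> {..<r})) / real (r + 1) < (1/2) ^ n / 4"
        if "G m n \<le> r" for m n r by metis
      obtain g where g: "\<And>m. eventually (\<lambda>n. G m n \<le> g n) sequentially"
        using countable_dominated[of G] by blast
      have "eventually (\<lambda>n. f n \<le> g n) sequentially" if f: "f \<in> F" for f
      proof -
        obtain m where m: "(\<Union>n. C f n) \<subseteq> B m" using cover[OF f] by blast
        show ?thesis using g[of m]
        proof eventually_elim
          case (elim n)
          let ?R = "2 ^ h f n :: nat"
          have "2 * ?R < G m n"
          proof (rule ccontr)
            assume "\<not> 2 * ?R < G m n"
            then have "real (card (B m \<inter> {..<2 * ?R})) / real (2 * ?R + 1) < (1/2) ^ n / 4"
              by (intro G) simp
            moreover have "0 < real (2 * ?R + 1)" by (simp only: of_nat_0_less_iff)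
            ultimately have "real (card (B m \<inter> {..<2 * ?R})) < (1/2) ^ n / 4 * real (2 * ?R + 1)"
              by (simp only: pos_divide_less_eq)
            then have "real (card (B m \<inter> {..<2 * ?R})) * (2 ^ n * 4) < (1/2) ^ n / 4 * real (2 * ?R + 1) * (2 ^ n * 4)"
              by (rule mult_strict_right_mono) simp
            also have "\<dots> = (1/2 * 2) ^ n * real (2 * ?R + 1)"
            proof -
              have "p / 4 * s * (q * 4) = p * q * s" for p q s :: real by simp
              then show ?thesis unfolding power_mult_distrib .
            qed
            finally have lt: "real (card (B m \<inter> {..<2 * ?R})) * 2 ^ n * 4 < real (2 * ?R + 1)"
              by simp
            have "C f n \<subseteq> B m \<inter> {..<2 * ?R}" using m C[of f n] by fastforce
            then have "card (C f n) \<le> card (B m \<inter> {..<2 * ?R})" by (intro card_mono) auto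
            then have "card (C f n) * 2 ^ n \<le> card (B m \<inter> {..<2 * ?R}) * 2 ^ n" by (rule mult_right_mono) simp
            then have "real ?R \<le> real (card (B m \<inter> {..<2 * ?R}) * 2 ^ n)"
              unfolding cardC by (rule of_nat_mono)
            moreover have "1 \<le> real ?R" by simp
            moreover have False if "r \<le> c" "c * 4 < 2 * r + 1" "1 \<le> r" for r c :: real
              using that by linarith
            ultimately show False using lt by fastforce
          qed
          moreover have "h f n < 2 ^ h f n" by simp
          ultimately show ?case using elim h(1)[of f n] by linarith
        qed
      qed
      then show False using F unfolding b_wit_def by blast
    qed
  qed
qed

text \<open>For bounded \<open>F\<close> only indices \<open>i < M n\<close> matter from some
  \<open>n\<close> on, so block \<open>n\<close> can be the finite set of words of
  \<open>M n\<close> digits in base \<open>2 ^ n\<close>, and \<open>i\<close> selects the words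
  whose digit \<open>i\<close> is 0. Many selections together nearly fill the block, whereas a set
  of density zero eventually contains only a small part of it.\<close>

lemma addw_Id_dens_le_loc: "mincard_le (addw_wit UNIV Id_dens) loc_wit"
proof (rule mincard_le_image_cases[OF addw_Id_dens_le_b])
  fix F assume F: "loc_wit F"
  show "(\<exists>a. addw_wit UNIV Id_dens (a ` F)) \<or> (\<exists>a. b_wit (a ` F))"
  proof (cases "b_wit F")
    case True
    then have "b_wit (id ` F)" by simp
    then show ?thesis by blast
  next
    case False
    then obtain g where g: "strict_mono g" "\<And>f. f \<in> F \<Longrightarrow> eventually (\<lambda>n. f n \<le> g n) sequentially"
      using not_b_wit_strict_mono by blast
    \<comment> \<open>\<open>Suc\<close> turns \<open>f n \<le> g n\<close> into
      \<open>f n < M n\<close>; the term \<open>2 * n\<close> makes \<open>M\<close> grow by at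
      least 3 at each step, enough for the growth of \<open>R\<close>.\<close>
    define M where "M n = Suc (g n + 2 * n)" for n
    define D :: "nat \<Rightarrow> nat" where "D n = 2 ^ n" for n
    define R where "R n = D n ^ M n" for n
    define Z where "Z n i = {m. m < R n \<and> m div D n ^ i mod D n = 0}" for n i
    define C where "C f n = (if f n < M n then (+) (R n) ` Z n (f n) else {})" for f n
    have D: "0 < D n" for n by (simp add: D_def)
    have R: "0 < R n" for n using D by (simp add: R_def)
    have cardC: "card (C f n) * 2 ^ n \<le> R n" for f n
    proof (cases "f n < M n")
      case True
      then have "card (C f n) = card (Z n (f n))" by (simp add: C_def card_image)
      then show ?thesis
        using card_zero_digit[OF D True] by (simp add: Z_def R_def D_def)
    qed (simp add: C_def)
    have dens: "Id_dens (\<Union>n. C f n)" for f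
    proof (rule Id_dens_blocks[where R = R])
      show "2 ^ (n + 2) * R n \<le> R (Suc n)" for n
      proof -
        have "g n < g (Suc n)" using g(1) by (simp add: strict_mono_Suc_iff)
        then have "M n + 3 \<le> M (Suc n)" by (simp add: M_def)
        then have "Suc n * (M n + 3) \<le> Suc n * M (Suc n)" by (rule mult_left_mono) simp
        then have "n + 2 + n * M n \<le> Suc n * M (Suc n)"
          by (simp add: distrib_left)
        then have "(2 :: nat) ^ (n + 2 + n * M n) \<le> 2 ^ (Suc n * M (Suc n))" by (rule power_increasing) simp
        then show ?thesis by (simp only: R_def D_def power_add power_mult)
      qed
      show "C f n \<subseteq> {R n..<2 * R n}" for n by (auto simp: C_def Z_def)
    qed (use R cardC in auto)
    have "addw_wit UNIV Id_dens ((\<lambda>f. \<Union>n. C f n) ` F)"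
      unfolding addw_wit_def
    proof (intro conjI allI impI)
      show "\<forall>A\<in>(\<lambda>f. \<Union>n. C f n) ` F. Id_dens A \<and> A \<subseteq> UNIV" using dens by auto
      fix B :: "nat \<Rightarrow> nat set" assume B: "\<forall>m. Id_dens (B m) \<and> B m \<subseteq> UNIV"
      show "\<exists>A\<in>(\<lambda>f. \<Union>n. C f n) ` F. \<forall>m. \<not> A \<subseteq> B m"
      proof (rule ccontr)
        assume "\<not> ?thesis"
        then have cover: "\<exists>m. (\<Union>n. C f n) \<subseteq> B m" if "f \<in> F" for f using that by blast
        define S where "S m n = {i. i < M n \<and> (+) (R n) ` Z n i \<subseteq> B m}" for m n
        have "\<not> loc_wit F"
        proof (rule not_loc_wit_of_countable)
          show "\<exists>m. eventually (\<lambda>n. f n \<in> S m n) sequentially" if f: "f \<in> F" for f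
          proof -
            obtain m where m: "(\<Union>n. C f n) \<subseteq> B m" using cover[OF f] by blast
            have "eventually (\<lambda>n. f n \<in> S m n) sequentially" using g(2)[OF f]
            proof eventually_elim
              case (elim n)
              then have lt: "f n < M n" by (simp add: M_def)
              have "C f n \<subseteq> B m" using m by blast
              then show ?case using lt by (simp add: S_def C_def)
            qed
            then show ?thesis ..
          qed
          show "eventually (\<lambda>n. finite (S m n) \<and> card (S m n) \<le> 4 ^ n) sequentially" for m
          proof -
            have "Id_dens (B m)" using B by blast
            \<comment> \<open>A quotient below 1/8 at \<open>2 * R n\<close> leaves at least 5/8 of
              the block outside \<open>B m\<close>. With \<open>2 ^ n\<close> or more captured
              indices at most \<open>exp (- 1) \<le> 1/2\<close> of it could remain.\<close>
            then obtain N where N: "\<And>r. N \<le> r \<Longrightarrow> real (card (B m \<inter> {..<r})) / real (r + 1) < 1/8"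
              using Id_densD[of "B m" "1/8"] unfolding eventually_sequentially by auto
            show ?thesis using eventually_ge_at_top[of N]
            proof eventually_elim
              case (elim n)
              let ?T = "S m n"
              let ?X = "{k. k < R n \<and> (\<forall>i\<in>?T. k div D n ^ i mod D n \<noteq> 0)}"
              have T: "?T \<subseteq> {..<M n}" by (auto simp: S_def)
              have N2: "N \<le> 2 * R n"
              proof (cases n)
                case (Suc k)
                have "n \<le> n * M n" by (simp add: M_def)
                also have "\<dots> < 2 ^ (n * M n)" by simp
                also have "\<dots> = R n" by (simp add: R_def D_def power_mult)
                finally show ?thesis using elim by linarith
              qed (use elim in auto)
              have "{..<R n} - ?X = (\<Union>i\<in>?T. Z n i)" by (auto simp: Z_def)
              then have "(+) (R n) ` ({..<R n} - ?X) \<subseteq> B m \<inter> {..<2 * R n}"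
                by (auto simp: S_def)
              then have "card ((+) (R n) ` ({..<R n} - ?X)) \<le> card (B m \<inter> {..<2 * R n})"
                by (intro card_mono) auto
              moreover have "card ((+) (R n) ` ({..<R n} - ?X)) = R n - card ?X"
              proof -
                have "card ({..<R n} - ?X) = card {..<R n} - card ?X"
                  by (intro card_Diff_subset) auto
                then show ?thesis by (simp add: card_image)
              qed
              ultimately have "R n \<le> card ?X + card (B m \<inter> {..<2 * R n})" by linarith
              then have "real (R n) \<le> real (card ?X) + real (card (B m \<inter> {..<2 * R n}))"
                by (simp only: of_nat_mono flip: of_nat_add)
              moreover have "real (card (B m \<inter> {..<2 * R n})) < 1/8 * (2 * real (R n) + 1)"
                using N[OF N2] by (simp add: field_simps)
              moreover have "1 \<le> real (R n)" using R[of n] by simp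
              moreover have "5/8 * r \<le> x" if "r \<le> x + b" "b < 1/8 * (2 * r + 1)" "1 \<le> r" for r x b :: real
                using that by (simp add: field_simps)
              ultimately have "5/8 * real (R n) \<le> real (card ?X)" by blast
              also have "real (card ?X) \<le> real (R n) * exp (- real (card ?T) / real (D n))"
                using card_nonzero_digits_le[OF D T] by (simp add: R_def)
              finally have "5/8 \<le> exp (- real (card ?T) / real (D n))" using R[of n] by simp
              moreover have "exp (- 1) \<le> (1/2 :: real)"
                using exp_ge_add_one_self[of "1 :: real"] by (simp add: exp_minus field_simps)
              ultimately have "exp (- 1) < exp (- real (card ?T) / real (D n))" by linarith
              then have "real (card ?T) < real (D n)" using D[of n] by (simp add: field_simps)
              then have "card ?T \<le> 2 ^ n" by (simp add: D_def)
              also have "\<dots> \<le> 4 ^ n" by (rule power_mono) auto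
              finally show ?case using T finite_subset by blast
            qed
          qed
        qed
        then show False using F by contradiction
      qed
    qed
    then show ?thesis by (intro disjI1 exI)
  qed
qed

section \<open>Null sets and dyadic intervals\<close>

text \<open>The dyadic interval \<open>[m/2\<^sup>n, (m+1)/2\<^sup>n)\<close> gets the code \<open>2\<^sup>n + m\<close>, so that the parent interval has code
  \<open>k div 2\<close> and the weight \<open>1/(k+1)\<close> is the length up to a factor of 2.\<close>

definition dyadic_code :: "nat \<Rightarrow> real \<Rightarrow> nat" where
  "dyadic_code n x = 2 ^ n + nat \<lfloor>x * 2 ^ n\<rfloor>"

definition dyadic_cell :: "nat \<Rightarrow> real set" where
  "dyadic_cell k = {x \<in> {0..<1}. \<exists>n. dyadic_code n x = k}"

lemma dyadic_code_bounds:
  assumes "x \<in> {0..<1}"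
  shows "2 ^ n \<le> dyadic_code n x" "dyadic_code n x < 2 ^ Suc n"
proof -
  have "x * 2 ^ n < 1 * 2 ^ n" using assms by (intro mult_strict_right_mono) auto
  then have "\<lfloor>x * 2 ^ n\<rfloor> < 2 ^ n" by (simp add: floor_less_iff)
  then have "nat \<lfloor>x * 2 ^ n\<rfloor> < 2 ^ n" by (simp add: nat_less_iff)
  then show "2 ^ n \<le> dyadic_code n x" "dyadic_code n x < 2 ^ Suc n" by (auto simp: dyadic_code_def)
qed

lemma dyadic_code_div2:
  assumes "x \<in> {0..<1}"
  shows "dyadic_code (Suc n) x div 2 = dyadic_code n x"
proof -
  have "\<lfloor>x * 2 ^ n\<rfloor> = \<lfloor>(x * 2 ^ Suc n) / real_of_int 2\<rfloor>" by simp
  also have "\<dots> = \<lfloor>x * 2 ^ Suc n\<rfloor> div 2" by (rule floor_divide_real_eq_div) simp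
  finally have "nat \<lfloor>x * 2 ^ n\<rfloor> = nat \<lfloor>x * 2 ^ Suc n\<rfloor> div 2" by (simp add: nat_div_distrib)
  then show ?thesis by (simp add: dyadic_code_def)
qed

lemma dyadic_cell_0: "dyadic_cell 0 = {}"
  by (simp add: dyadic_cell_def dyadic_code_def)

lemma power2_interval_unique:
  fixes k :: nat
  assumes "2 ^ n \<le> k" "k < 2 ^ Suc n" "2 ^ m \<le> k" "k < 2 ^ Suc m"
  shows "m = n"
proof -
  have "(2 :: nat) ^ n < 2 ^ Suc m" "(2 :: nat) ^ m < 2 ^ Suc n" using assms by linarith+
  then have "n < Suc m" "m < Suc n" by (simp_all only: power_strict_increasing_iff)
  then show ?thesis by simp
qed

lemma dyadic_cell_eq:
  assumes k: "2 ^ n \<le> k" "k < 2 ^ Suc n"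
  shows "dyadic_cell k = {real (k - 2 ^ n) / 2 ^ n..<real (k - 2 ^ n) / 2 ^ n + 1 / 2 ^ n}"
proof -
  define j where "j = k - 2 ^ n"
  have j: "k = 2 ^ n + j" "j < 2 ^ n" using k by (auto simp: j_def)
  have "x \<in> dyadic_cell k \<longleftrightarrow> real j \<le> x * 2 ^ n \<and> x * 2 ^ n < real j + 1" for x
  proof
    assume "x \<in> dyadic_cell k"
    then obtain m where x: "x \<in> {0..<1}" "dyadic_code m x = k" by (auto simp: dyadic_cell_def)
    then have "m = n" using dyadic_code_bounds[OF x(1), of m] k by (intro power2_interval_unique) auto
    then have "nat \<lfloor>x * 2 ^ n\<rfloor> = j" using x j by (simp add: dyadic_code_def)
    moreover have "int (nat \<lfloor>x * 2 ^ n\<rfloor>) = \<lfloor>x * 2 ^ n\<rfloor>" using x by (intro nat_0_le) simp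
    ultimately have "\<lfloor>x * 2 ^ n\<rfloor> = int j" by (simp only:)
    then show "real j \<le> x * 2 ^ n \<and> x * 2 ^ n < real j + 1" by (simp add: floor_eq_iff)
  next
    assume x: "real j \<le> x * 2 ^ n \<and> x * 2 ^ n < real j + 1"
    then have "\<lfloor>x * 2 ^ n\<rfloor> = int j" by (simp add: floor_eq_iff)
    then have code: "dyadic_code n x = k" using j by (simp add: dyadic_code_def)
    have "0 \<le> x * 2 ^ n" using x of_nat_0_le_iff order_trans by blast
    then have "0 \<le> x" by (metis less_le_not_le mult_neg_pos not_le zero_less_numeral zero_less_power)
    moreover have "real j + 1 \<le> 2 ^ n"
    proof -
      have "real (Suc j) \<le> real (2 ^ n)" using j(2) by (intro of_nat_mono) simp
      then show ?thesis by simp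
    qed
    then have "x * 2 ^ n < 1 * 2 ^ n" using x by linarith
    then have "x < 1" by (rule mult_right_less_imp_less) simp
    ultimately show "x \<in> dyadic_cell k" using code by (auto simp: dyadic_cell_def)
  qed
  then show ?thesis
    unfolding j_def[symmetric]
    by (simp add: set_eq_iff pos_divide_le_eq pos_less_divide_eq flip: add_divide_distrib)
qed

lemma dyadic_cell_level:
  assumes "0 < k"
  obtains n where "2 ^ n \<le> k" "k < 2 ^ Suc n"
    "emeasure lborel (dyadic_cell k) = ennreal (1 / 2 ^ n)"
proof -
  obtain n where n: "2 ^ n \<le> k" "k < 2 ^ Suc n"
    using ex_power_ivl1[of 2 k] assms by auto
  have "emeasure lborel (dyadic_cell k) = ennreal (1 / 2 ^ n)"
    unfolding dyadic_cell_eq[OF n] by (simp add: emeasure_lborel_Ico)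
  with n show ?thesis using that by blast
qed

lemma dyadic_cell_borel [measurable, simp]: "dyadic_cell k \<in> sets borel"
proof (cases "k = 0")
  case False
  then obtain n where n: "2 ^ n \<le> k" "k < 2 ^ Suc n" using dyadic_cell_level[of k] by auto
  show ?thesis unfolding dyadic_cell_eq[OF n] by simp
qed (simp add: dyadic_cell_0)

lemma emeasure_dyadic_cell_bounds:
  assumes "0 < k"
  shows "ennreal (1 / real (k + 1)) \<le> emeasure lborel (dyadic_cell k)"
    and "emeasure lborel (dyadic_cell k) \<le> 2 * ennreal (1 / real (k + 1))"
proof -
  obtain n where n: "2 ^ n \<le> k" "k < 2 ^ Suc n"
    and e: "emeasure lborel (dyadic_cell k) = ennreal (1 / 2 ^ n)"
    using dyadic_cell_level[OF assms] by blast
  have n': "(2 :: real) ^ n \<le> real k" "real k + 1 \<le> 2 * 2 ^ n"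
  proof -
    have "real (2 ^ n) \<le> real k" using n(1) by (rule of_nat_mono)
    then show "(2 :: real) ^ n \<le> real k" by simp
    have "real (Suc k) \<le> real (2 ^ Suc n)" using n(2) by (intro of_nat_mono) simp
    then show "real k + 1 \<le> 2 * 2 ^ n" by simp
  qed
  show "ennreal (1 / real (k + 1)) \<le> emeasure lborel (dyadic_cell k)"
    unfolding e
  proof (intro ennreal_leI divide_left_mono)
    show "2 ^ n \<le> real (k + 1)" unfolding of_nat_add using n'(1) by linarith
  qed auto
  have "1 / 2 ^ n \<le> 2 * (1 / real (k + 1))" using n'(2) by (simp add: field_simps)
  then have "ennreal (1 / 2 ^ n) \<le> ennreal (2 * (1 / real (k + 1)))" by (rule ennreal_leI)
  then show "emeasure lborel (dyadic_cell k) \<le> 2 * ennreal (1 / real (k + 1))"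
    unfolding e by (simp only: ennreal_mult' ennreal_numeral)
qed

lemma emeasure_UN_dyadic_cell_le:
  "emeasure lborel (\<Union>k\<in>X. dyadic_cell k) \<le> 2 * emeasure harmonic_measure X"
proof -
  have "(\<Union>k\<in>X. dyadic_cell k) = (\<Union>k. if k \<in> X then dyadic_cell k else {})" by (auto split: if_splits)
  then have "emeasure lborel (\<Union>k\<in>X. dyadic_cell k) \<le> (\<Sum>k. emeasure lborel (if k \<in> X then dyadic_cell k else {}))"
    by (simp only:) (rule emeasure_subadditive_countably, auto)
  also have "\<dots> \<le> (\<Sum>k. 2 * (ennreal (1 / real (k + 1)) * indicator X k))"
  proof (rule suminf_le)
    show "emeasure lborel (if k \<in> X then dyadic_cell k else {}) \<le> 2 * (ennreal (1 / real (k + 1)) * indicator X k)" for k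
    proof (cases "k = 0")
      case False
      then show ?thesis using emeasure_dyadic_cell_bounds(2)[of k] by simp
    qed (simp add: dyadic_cell_0)
  qed auto
  also have "\<dots> = 2 * (\<Sum>k. ennreal (1 / real (k + 1)) * indicator X k)" by (rule ennreal_suminf_cmult)
  also have "(\<Sum>k. ennreal (1 / real (k + 1)) * indicator X k) = emeasure harmonic_measure X"
    by (simp add: harmonic_measure_def emeasure_density nn_integral_count_space_nat)
  finally show ?thesis .
qed

text \<open>The limsup of the cells coded by \<open>X\<close>. It is monotone in \<open>X\<close>,
  which carries captures of index sets over to inclusions of null sets.\<close>

definition dyadic_limsup :: "nat set \<Rightarrow> real set" where
  "dyadic_limsup X = (\<Inter>m. \<Union>k\<in>X \<inter> {m..}. dyadic_cell k)"

lemma dyadic_limsup_null: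
  assumes X: "I_summ X"
  shows "dyadic_limsup X \<in> null_sets lborel"
proof (rule null_setsI)
  show "dyadic_limsup X \<in> sets lborel" by (simp add: dyadic_limsup_def)
  show "emeasure lborel (dyadic_limsup X) = 0"
  proof (rule ccontr)
    assume "emeasure lborel (dyadic_limsup X) \<noteq> 0"
    then obtain e where e: "0 < e" "ennreal e < emeasure lborel (dyadic_limsup X)"
    proof -
      have "0 < emeasure lborel (dyadic_limsup X)"
        using \<open>emeasure lborel (dyadic_limsup X) \<noteq> 0\<close> by (simp add: zero_less_iff_neq_zero)
      from dense[OF this] obtain z where z: "0 < z" "z < emeasure lborel (dyadic_limsup X)" by blast
      obtain e where e: "z = ennreal e" using z(2) by (cases z) auto
      show ?thesis by (rule that[of e]) (use z e in simp_all)
    qed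
    interpret exhaustive_ideal "emeasure harmonic_measure" I_summ by (rule exhaustive_I_summ)
    have "e / 2 > 0" using e by simp
    then obtain m where m: "emeasure harmonic_measure (X \<inter> {m..}) < ennreal (e / 2)"
      using X unfolding I_iff by blast
    have "emeasure lborel (dyadic_limsup X) \<le> emeasure lborel (\<Union>k\<in>X \<inter> {m..}. dyadic_cell k)"
      unfolding dyadic_limsup_def by (intro emeasure_mono INT_lower) auto
    also have "\<dots> \<le> 2 * emeasure harmonic_measure (X \<inter> {m..})" by (rule emeasure_UN_dyadic_cell_le)
    also have "\<dots> \<le> 2 * ennreal (e / 2)" using m by (intro mult_left_mono) auto
    also have "2 * ennreal (e / 2) = ennreal (2 * (e / 2))"
      by (rule ennreal_mult'[of 2, unfolded ennreal_numeral, symmetric]) simp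
    finally show False using e(2) by simp
  qed
qed

lemma null_set_open_cover:
  assumes N: "N \<in> null_sets lebesgue" and e: "0 < e"
  obtains U where "open U" "N \<subseteq> U" "emeasure lborel U < ennreal e"
proof -
  obtain U where U: "open U" "N \<subseteq> U" "emeasure lebesgue (U - N) < ennreal e"
    using sets_lebesgue_outer_open[OF null_setsD2[OF N] e] by metis
  have "emeasure lborel U = emeasure lebesgue U" using U(1) by simp
  also have "\<dots> = emeasure lebesgue (U - N)"
    using U(1) N by (intro emeasure_Diff_null_set[symmetric]) auto
  finally have "emeasure lborel U < ennreal e" using U(3) by (simp only:)
  with U(1,2) show ?thesis by (rule that)
qed

text \<open>\<open>X\<close> consists of the maximal dyadic cells inside \<open>U\<close>. They are
  disjoint, so their weights add up to at most the measure of \<open>U\<close>; each is shorter than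
  \<open>(1/2) ^ Suc j\<close>, which pushes its code above \<open>j\<close>.\<close>

lemma dyadic_cover_of_open:
  assumes U: "open U" "emeasure lborel U < ennreal ((1/2) ^ Suc j)"
  obtains X where "emeasure harmonic_measure X \<le> ennreal ((1/2) ^ Suc j)"
    and "\<And>x. x \<in> U \<Longrightarrow> x \<in> {0..<1} \<Longrightarrow> \<exists>k\<in>X. j \<le> k \<and> x \<in> dyadic_cell k"
proof
  \<comment> \<open>For \<open>k = 1\<close> the parent code is 0, whose cell is empty, so the root
    cell never enters \<open>X\<close>. It does not fit into \<open>U\<close> anyway, whose measure
    is below 1/2.\<close>
  define X where "X = {k. 0 < k \<and> dyadic_cell k \<subseteq> U \<and> \<not> dyadic_cell (k div 2) \<subseteq> U}"
  have code_in: "x \<in> dyadic_cell (dyadic_code n x)" if "x \<in> {0..<1}" for n x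
    using that by (auto simp: dyadic_cell_def)
  have mono: "dyadic_cell (dyadic_code (n + d) x) \<subseteq> dyadic_cell (dyadic_code n x)" if "x \<in> {0..<1}" for n d x
  proof (induction d)
    case (Suc d)
    have "dyadic_cell (dyadic_code (Suc (n + d)) x) \<subseteq> dyadic_cell (dyadic_code (n + d) x)"
    proof
      fix y assume "y \<in> dyadic_cell (dyadic_code (Suc (n + d)) x)"
      then obtain m where y: "y \<in> {0..<1}" "dyadic_code m y = dyadic_code (Suc (n + d)) x"
        by (auto simp: dyadic_cell_def)
      have "m = Suc (n + d)"
        using dyadic_code_bounds[OF y(1), of m] dyadic_code_bounds[OF that, of "Suc (n + d)"] y(2)
        by (intro power2_interval_unique) auto
      then have "dyadic_code (n + d) y = dyadic_code (n + d) x"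
        using y dyadic_code_div2[OF y(1), of "n + d"] dyadic_code_div2[OF that, of "n + d"] by simp
      then show "y \<in> dyadic_cell (dyadic_code (n + d) x)" using code_in[OF y(1), of "n + d"] by simp
    qed
    then show ?case using Suc.IH by simp
  qed simp
  have disj: "disjoint_family_on dyadic_cell X"
    unfolding disjoint_family_on_def
  proof (intro ballI impI)
    fix k l assume kl: "k \<in> X" "l \<in> X" "k \<noteq> l"
    have False if x: "x \<in> dyadic_cell k" "x \<in> dyadic_cell l" for x
    proof -
      obtain n m where nm: "x \<in> {0..<1}" "dyadic_code n x = k" "dyadic_code m x = l"
        using x by (auto simp: dyadic_cell_def)
      have *: False if "a < b" "dyadic_code a x \<in> X" "dyadic_code b x \<in> X" for a b
      proof -
        obtain d where b: "b = Suc (a + d)" using \<open>a < b\<close> less_imp_Suc_add by blast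
        have "dyadic_cell (dyadic_code b x div 2) \<subseteq> dyadic_cell (dyadic_code a x)"
          unfolding b dyadic_code_div2[OF nm(1)] by (rule mono[OF nm(1)])
        then show False using that unfolding X_def by blast
      qed
      have "n \<noteq> m" using nm kl(3) by auto
      then show False using *[of n m] *[of m n] nm kl by (cases "n < m") auto
    qed
    then show "dyadic_cell k \<inter> dyadic_cell l = {}" by blast
  qed
  have "emeasure harmonic_measure X \<le> (\<integral>\<^sup>+k. emeasure lborel (dyadic_cell k) \<partial>count_space X)"
    unfolding emeasure_harmonic_measure
    by (rule nn_integral_mono) (auto simp: X_def intro: emeasure_dyadic_cell_bounds(1)[simplified])
  also have "\<dots> = emeasure lborel (\<Union>k\<in>X. dyadic_cell k)"
    by (rule emeasure_UN_countable[symmetric]) (auto simp: disj)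
  also have "\<dots> \<le> emeasure lborel U" using U(1) by (intro emeasure_mono) (auto simp: X_def)
  also have "\<dots> \<le> ennreal ((1/2) ^ Suc j)" using U(2) by simp
  finally show "emeasure harmonic_measure X \<le> ennreal ((1/2) ^ Suc j)" .
  fix x assume x: "x \<in> U" "x \<in> {0..<1}"
  obtain e where e: "e > 0" "ball x e \<subseteq> U" using U(1) x(1) openE by blast
  obtain n0 where n0: "(1/2) ^ n0 < e" using real_arch_pow_inv[of e "1/2"] e(1) by auto
  have "dyadic_cell (dyadic_code n0 x) \<subseteq> U"
  proof
    fix y assume "y \<in> dyadic_cell (dyadic_code n0 x)"
    then have "\<bar>x - y\<bar> < 1 / 2 ^ n0"
      using code_in[OF x(2), of n0]
      unfolding dyadic_cell_eq[OF dyadic_code_bounds[OF x(2)]] by auto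
    then have "y \<in> ball x e" using n0 by (simp add: dist_real_def power_one_over)
    then show "y \<in> U" using e(2) by blast
  qed
  then have ex: "\<exists>n. dyadic_cell (dyadic_code n x) \<subseteq> U" by blast
  define n where "n = (LEAST n. dyadic_cell (dyadic_code n x) \<subseteq> U)"
  have n: "dyadic_cell (dyadic_code n x) \<subseteq> U" unfolding n_def using ex by (rule LeastI_ex)
  have pos: "0 < dyadic_code n x" by (simp add: dyadic_code_def)
  have "ennreal (1 / 2 ^ n) = emeasure lborel (dyadic_cell (dyadic_code n x))"
    unfolding dyadic_cell_eq[OF dyadic_code_bounds[OF x(2)]] by (simp add: emeasure_lborel_Ico)
  also have "\<dots> \<le> emeasure lborel U" using n U(1) by (intro emeasure_mono) auto
  also have "\<dots> < ennreal ((1/2) ^ Suc j)" by (rule U(2))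
  finally have "(1/2) ^ n < ((1/2) ^ Suc j :: real)" by (simp add: ennreal_less_iff power_one_over)
  then have jn: "Suc j < n" by (subst (asm) power_strict_decreasing_iff) auto
  then obtain n' where n': "n = Suc n'" by (cases n) auto
  have "\<not> dyadic_cell (dyadic_code n' x) \<subseteq> U" using not_less_Least[of n' "\<lambda>n. dyadic_cell (dyadic_code n x) \<subseteq> U"] n'
    unfolding n_def[symmetric] by simp
  then have "dyadic_code n x \<in> X"
    unfolding X_def using n pos dyadic_code_div2[OF x(2), of n'] n' by simp
  moreover have "j \<le> dyadic_code n x"
  proof -
    have "n < 2 ^ n" by simp
    then show ?thesis using jn dyadic_code_bounds(1)[OF x(2), of n] by linarith
  qed
  ultimately show "\<exists>k\<in>X. j \<le> k \<and> x \<in> dyadic_cell k" using code_in[OF x(2)] by blast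
qed

text \<open>Covers of measure below \<open>(1/2) ^ Suc j\<close> have summable total weight. The
  clause \<open>j \<le> k\<close> makes each point of \<open>N\<close> lie in cells of arbitrarily
  large code rather than in one cell reused for every \<open>j\<close>.\<close>

lemma null_set_subset_dyadic_limsup:
  assumes N: "N \<in> null_sets lebesgue" "N \<subseteq> {0..<1}"
  shows "\<exists>A. I_summ A \<and> N \<subseteq> dyadic_limsup A"
proof -
  have "\<exists>X. emeasure harmonic_measure X \<le> ennreal ((1/2) ^ Suc j) \<and>
      (\<forall>x\<in>N. \<exists>k\<in>X. j \<le> k \<and> x \<in> dyadic_cell k)" for j
  proof -
    obtain U where U: "open U" "N \<subseteq> U" "emeasure lborel U < ennreal ((1/2) ^ Suc j)"
      using null_set_open_cover[OF N(1), of "(1/2) ^ Suc j"] by auto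
    obtain X where "emeasure harmonic_measure X \<le> ennreal ((1/2) ^ Suc j)"
      "\<And>x. x \<in> U \<Longrightarrow> x \<in> {0..<1} \<Longrightarrow> \<exists>k\<in>X. j \<le> k \<and> x \<in> dyadic_cell k"
      using dyadic_cover_of_open[OF U(1,3)] by blast
    then show ?thesis using U(2) N(2) by (intro exI[of _ X]) blast
  qed
  then obtain X where X: "\<And>j. emeasure harmonic_measure (X j) \<le> ennreal ((1/2) ^ Suc j)"
    "\<And>j x. x \<in> N \<Longrightarrow> \<exists>k\<in>X j. j \<le> k \<and> x \<in> dyadic_cell k" by metis
  have "emeasure harmonic_measure (\<Union>j. X j) \<le> (\<Sum>j. emeasure harmonic_measure (X j))"
    by (rule emeasure_subadditive_countably) auto
  also have "\<dots> \<le> (\<Sum>j. ennreal ((1/2) ^ Suc j))" by (rule suminf_le) (use X(1) in auto)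
  also have "\<dots> = ennreal 1" by (rule suminf_ennreal_eq[OF _ power_half_series]) simp
  finally have "I_summ (\<Union>j. X j)" by (simp add: I_summ_iff order_le_less_trans)
  moreover have "N \<subseteq> dyadic_limsup (\<Union>j. X j)"
    unfolding dyadic_limsup_def using X(2) by fastforce
  ultimately show ?thesis by blast
qed

text \<open>Countably many integer translates of the unit interval cover the line, so the union of
  the family has a part that is not null in one of them.\<close>

lemma addN_wit_unit_interval:
  assumes \<N>: "addN_wit \<N>"
  obtains c :: real where "addN_wit ((\<lambda>N. (+) c ` N \<inter> {0..<1}) ` \<N>)"
proof -
  have null: "(+) c ` N \<inter> {0..<1} \<in> null_sets lebesgue" if N: "N \<in> null_sets lebesgue" for c :: real and N
  proof -
    have "negligible ((+) c ` N)" using N by (intro negligible_translation) (simp add: negligible_iff_null_sets)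
    then have "negligible ((+) c ` N \<inter> {0..<1})" by (rule negligible_subset) blast
    then show ?thesis by (simp add: negligible_iff_null_sets)
  qed
  let ?T = "\<lambda>c N. (+) c ` N \<inter> {0..<1 :: real}"
  have "\<exists>z :: int. \<Union> (?T (- real_of_int z) ` \<N>) \<notin> null_sets lebesgue"
  proof (rule ccontr)
    assume "\<not> ?thesis"
    then have "\<Union> (?T (- real_of_int z) ` \<N>) \<in> null_sets lebesgue" for z by blast
    then have "negligible ((+) (real_of_int z) ` \<Union> (?T (- real_of_int z) ` \<N>))" for z
      by (intro negligible_translation) (simp add: negligible_iff_null_sets)
    then have "(\<Union>z. (+) (real_of_int z) ` \<Union> (?T (- real_of_int z) ` \<N>)) \<in> null_sets lebesgue"
      by (intro null_sets_UN) (simp add: negligible_iff_null_sets)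
    then have neg: "negligible (\<Union>z. (+) (real_of_int z) ` \<Union> (?T (- real_of_int z) ` \<N>))"
      by (simp add: negligible_iff_null_sets)
    have "\<Union>\<N> \<subseteq> (\<Union>z. (+) (real_of_int z) ` \<Union> (?T (- real_of_int z) ` \<N>))"
    proof
      fix x assume "x \<in> \<Union>\<N>"
      then obtain N where N: "N \<in> \<N>" "x \<in> N" by blast
      have "- real_of_int \<lfloor>x\<rfloor> + x \<in> ?T (- real_of_int \<lfloor>x\<rfloor>) N"
        using N(2) by (intro IntI imageI) (auto simp: algebra_simps, linarith+)
      then have "- real_of_int \<lfloor>x\<rfloor> + x \<in> \<Union> (?T (- real_of_int \<lfloor>x\<rfloor>) ` \<N>)" using N(1) by blast
      then have "real_of_int \<lfloor>x\<rfloor> + (- real_of_int \<lfloor>x\<rfloor> + x) \<in> (+) (real_of_int \<lfloor>x\<rfloor>) ` \<Union> (?T (- real_of_int \<lfloor>x\<rfloor>) ` \<N>)"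
        by (rule imageI)
      then show "x \<in> (\<Union>z. (+) (real_of_int z) ` \<Union> (?T (- real_of_int z) ` \<N>))" by auto
    qed
    then have "negligible (\<Union>\<N>)" using neg negligible_subset by blast
    then show False using \<N> by (simp add: addN_wit_def negligible_iff_null_sets)
  qed
  then obtain z :: int where "\<Union> (?T (- real_of_int z) ` \<N>) \<notin> null_sets lebesgue" by blast
  moreover have "?T (- real_of_int z) ` \<N> \<subseteq> null_sets lebesgue"
    using \<N> null unfolding addN_wit_def by blast
  ultimately have "addN_wit (?T (- real_of_int z) ` \<N>)" unfolding addN_wit_def by blast
  then show ?thesis using that by blast
qed

text \<open>If countably many \<open>B n\<close> captured all \<open>A N\<close>, the null sets
  \<open>dyadic_limsup (B n)\<close> would cover the union of the \<open>T N\<close>.\<close>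

lemma addw_I_summ_le_addN: "mincard_le (addw_wit UNIV I_summ) addN_wit"
proof (rule mincard_le_image)
  fix \<N> assume "addN_wit \<N>"
  then obtain c where c: "addN_wit ((\<lambda>N. (+) c ` N \<inter> {0..<1}) ` \<N>)"
    using addN_wit_unit_interval by blast
  define T where "T N = (+) c ` N \<inter> {0..<1}" for N
  have T: "T ` \<N> \<subseteq> null_sets lebesgue" "\<Union> (T ` \<N>) \<notin> null_sets lebesgue"
    using c unfolding addN_wit_def T_def[abs_def] by auto
  define A where "A N = (SOME A. I_summ A \<and> T N \<subseteq> dyadic_limsup A)" for N
  have A: "I_summ (A N)" "T N \<subseteq> dyadic_limsup (A N)" if "N \<in> \<N>" for N
  proof -
    have "\<exists>A. I_summ A \<and> T N \<subseteq> dyadic_limsup A"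
      using T(1) that by (intro null_set_subset_dyadic_limsup) (auto simp: T_def)
    then have "I_summ (A N) \<and> T N \<subseteq> dyadic_limsup (A N)" unfolding A_def by (rule someI_ex)
    then show "I_summ (A N)" "T N \<subseteq> dyadic_limsup (A N)" by blast+
  qed
  have "addw_wit UNIV I_summ (A ` \<N>)"
    unfolding addw_wit_def
  proof (intro conjI allI impI)
    show "\<forall>X\<in>A ` \<N>. I_summ X \<and> X \<subseteq> UNIV" using A by auto
    fix B :: "nat \<Rightarrow> nat set" assume B: "\<forall>n. I_summ (B n) \<and> B n \<subseteq> UNIV"
    show "\<exists>X\<in>A ` \<N>. \<forall>n. \<not> X \<subseteq> B n"
    proof (rule ccontr)
      assume "\<not> ?thesis"
      then have cover: "\<exists>n. A N \<subseteq> B n" if "N \<in> \<N>" for N using that by blast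
      have "\<Union> (T ` \<N>) \<subseteq> (\<Union>n. dyadic_limsup (B n))"
      proof
        fix x assume "x \<in> \<Union> (T ` \<N>)"
        then obtain N where N: "N \<in> \<N>" "x \<in> T N" by blast
        obtain n where "A N \<subseteq> B n" using cover[OF N(1)] by blast
        then have "dyadic_limsup (A N) \<subseteq> dyadic_limsup (B n)" unfolding dyadic_limsup_def by blast
        then show "x \<in> (\<Union>n. dyadic_limsup (B n))" using A(2)[OF N(1)] N(2) by blast
      qed
      moreover have "(\<Union>n. dyadic_limsup (B n)) \<in> null_sets lebesgue"
        using B by (intro null_sets_completionI null_sets_UN dyadic_limsup_null) blast
      ultimately have "\<Union> (T ` \<N>) \<in> null_sets lebesgue" by (rule null_sets_completion_subset)
      then show False using T(2) by contradiction
    qed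
  qed
  then show "\<exists>A. addw_wit UNIV I_summ (A ` \<N>)" by (rule exI[of _ A])
qed

section \<open>Bartoszynski's slaloms for null sets\<close>

text \<open>On the unit interval: the \<open>i\<close>-th digit after the point in base \<open>D\<close> vanishes.\<close>

definition zero_digit_set :: "nat \<Rightarrow> nat \<Rightarrow> real set" where
  "zero_digit_set D i = {x. \<lfloor>x * real D ^ Suc i\<rfloor> mod int D = 0}"

text \<open>Digits after the point count from the left, digits of an integer from the right; hence
  position \<open>M - Suc i\<close>. This reduces Lebesgue measure to counting integers below
  \<open>D ^ M\<close>.\<close>

lemma floor_digit:
  assumes "0 < D" "i < M" "0 \<le> x"
  shows "x \<in> zero_digit_set D i \<longleftrightarrow> nat \<lfloor>x * real D ^ M\<rfloor> div D ^ (M - Suc i) mod D = 0"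
proof -
  have "M = Suc i + (M - Suc i)" using assms(2) by simp
  then have pow: "real D ^ M = real D ^ Suc i * real D ^ (M - Suc i)" by (metis power_add)
  have "x * real D ^ Suc i = x * real D ^ M / real_of_int (int (D ^ (M - Suc i)))"
    unfolding pow using assms(1) by simp
  then have "\<lfloor>x * real D ^ Suc i\<rfloor> = \<lfloor>x * real D ^ M\<rfloor> div int (D ^ (M - Suc i))"
    by (simp only: floor_divide_real_eq_div of_nat_0_le_iff)
  also have "\<lfloor>x * real D ^ M\<rfloor> = int (nat \<lfloor>x * real D ^ M\<rfloor>)" using assms(3) by simp
  finally have "\<lfloor>x * real D ^ Suc i\<rfloor> mod int D = int (nat \<lfloor>x * real D ^ M\<rfloor> div D ^ (M - Suc i) mod D)"
    by (simp only: zdiv_int zmod_int)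
  then show ?thesis unfolding zero_digit_set_def by (simp only: mem_Collect_eq of_nat_eq_0_iff)
qed

lemma emeasure_floor_le:
  assumes Q: "0 < Q" and X: "X \<subseteq> {0..<1}" "\<And>x. x \<in> X \<Longrightarrow> nat \<lfloor>x * real Q\<rfloor> \<in> J" and J: "finite J"
  shows "emeasure lborel X \<le> ennreal (real (card J) / real Q)"
proof -
  let ?I = "\<lambda>j. {real j / real Q..<real j / real Q + 1 / real Q}"
  have "X \<subseteq> (\<Union>j\<in>J. ?I j)"
  proof
    fix x assume x: "x \<in> X"
    define j where "j = nat \<lfloor>x * real Q\<rfloor>"
    have "0 \<le> x" using x X(1) by auto
    then have "0 \<le> \<lfloor>x * real Q\<rfloor>" by simp
    then have "int j = \<lfloor>x * real Q\<rfloor>" unfolding j_def by (rule nat_0_le)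
    then have "real j \<le> x * real Q" "x * real Q < real j + 1" by linarith+
    then have "x \<in> ?I j"
      using Q by (simp add: pos_divide_le_eq pos_less_divide_eq flip: add_divide_distrib)
    then show "x \<in> (\<Union>j\<in>J. ?I j)" using X(2)[OF x] unfolding j_def by blast
  qed
  then have "emeasure lborel X \<le> emeasure lborel (\<Union>j\<in>J. ?I j)"
    using J by (intro emeasure_mono) auto
  also have "\<dots> \<le> (\<Sum>j\<in>J. emeasure lborel (?I j))"
    by (rule emeasure_subadditive_finite) (use J in auto)
  also have "\<dots> = (\<Sum>j\<in>J. ennreal (1 / real Q))" using Q by (intro sum.cong) auto
  also have "\<dots> = ennreal (real (card J) / real Q)"
    by (simp add: ennreal_of_nat_eq_real_of_nat flip: ennreal_mult)
  finally show ?thesis .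
qed

lemma nat_floor_less_power:
  assumes "x \<in> {0..<1}" "0 < D"
  shows "nat \<lfloor>x * real D ^ M\<rfloor> < D ^ M"
proof -
  have "x * real D ^ M < 1 * real D ^ M" using assms by (intro mult_strict_right_mono) auto
  then have "\<lfloor>x * real D ^ M\<rfloor> < int (D ^ M)" by (simp add: floor_less_iff)
  then show ?thesis using assms by (simp add: nat_less_iff)
qed

lemma emeasure_zero_digit_set_le:
  assumes D: "0 < D"
  shows "emeasure lborel (zero_digit_set D i \<inter> {0..<1}) \<le> ennreal (1 / real D)"
proof -
  let ?J = "{m. m < D ^ Suc i \<and> m div D ^ 0 mod D = 0}"
  have "emeasure lborel (zero_digit_set D i \<inter> {0..<1}) \<le> ennreal (real (card ?J) / real (D ^ Suc i))"
  proof (rule emeasure_floor_le)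
    show "nat \<lfloor>x * real (D ^ Suc i)\<rfloor> \<in> ?J" if x: "x \<in> zero_digit_set D i \<inter> {0..<1}" for x
    proof -
      have "0 \<le> x" using x by simp
      then have "nat \<lfloor>x * real D ^ Suc i\<rfloor> div D ^ (Suc i - Suc i) mod D = 0"
        using floor_digit[OF D, of i "Suc i" x] x by simp
      moreover have "nat \<lfloor>x * real D ^ Suc i\<rfloor> < D ^ Suc i"
        using x D by (intro nat_floor_less_power) auto
      ultimately show ?thesis by (simp only: mem_Collect_eq of_nat_power diff_self_eq_0)
    qed
  qed (use D in auto)
  also have "real (card ?J) / real (D ^ Suc i) = 1 / real D"
  proof -
    have "card ?J * D = D ^ Suc i" by (rule card_zero_digit) (use D in auto)
    then have "real (card ?J * D) = real (D ^ Suc i)" by (simp only:)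
    then have "real (card ?J) * real D = real (D ^ Suc i)" by (simp only: of_nat_mult)
    then show ?thesis
      using D nonzero_eq_divide_eq[of "real D" "real (card ?J) / real (D ^ Suc i)" 1] by simp
  qed
  finally show ?thesis .
qed

lemma emeasure_avoid_zero_digits_le:
  assumes D: "0 < D" and T: "finite T"
    and X: "X \<subseteq> {0..<1}" "\<And>i. i \<in> T \<Longrightarrow> X \<inter> zero_digit_set D i = {}"
  shows "emeasure lborel X \<le> ennreal (exp (- real (card T) / real D))"
proof -
  obtain M where M: "T \<subseteq> {..<M}" using T finite_nat_bounded by blast
  let ?r = "\<lambda>i. M - Suc i"
  have inj: "inj_on ?r T"
  proof (rule inj_onI)
    fix i j assume "i \<in> T" "j \<in> T" "?r i = ?r j"
    moreover from this have "i < M" "j < M" using M by auto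
    ultimately show "i = j" by linarith
  qed
  have sub: "?r ` T \<subseteq> {..<M}"
  proof (rule image_subsetI)
    fix i assume "i \<in> T"
    then have "i < M" using M by blast
    then show "?r i \<in> {..<M}" by simp
  qed
  let ?J = "{m. m < D ^ M \<and> (\<forall>i\<in>?r ` T. m div D ^ i mod D \<noteq> 0)}"
  have "emeasure lborel X \<le> ennreal (real (card ?J) / real (D ^ M))"
  proof (rule emeasure_floor_le)
    show "nat \<lfloor>x * real (D ^ M)\<rfloor> \<in> ?J" if x: "x \<in> X" for x
    proof -
      have x01: "x \<in> {0..<1}" using x X(1) by blast
      have "nat \<lfloor>x * real D ^ M\<rfloor> div D ^ ?r i mod D \<noteq> 0" if i: "i \<in> T" for i
      proof -
        have "i < M" using i M by blast
        moreover have "x \<notin> zero_digit_set D i" using x X(2)[OF i] by blast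
        ultimately show ?thesis using floor_digit[OF D, of i M x] x01 by simp
      qed
      moreover have "nat \<lfloor>x * real D ^ M\<rfloor> < D ^ M" using x01 D by (rule nat_floor_less_power)
      ultimately show ?thesis by simp
    qed
  qed (use D X(1) in auto)
  also have "real (card ?J) / real (D ^ M) \<le> exp (- real (card T) / real D)"
    using card_nonzero_digits_le[OF D sub] D by (simp add: card_image[OF inj] pos_divide_le_eq mult.commute)
  then have "ennreal (real (card ?J) / real (D ^ M)) \<le> ennreal (exp (- real (card T) / real D))"
    by (rule ennreal_leI)
  finally show ?thesis .
qed

section \<open>Topology of zero digit sets, and closed sets with no null portion\<close>

lemma zero_digit_set_eq:
  assumes "0 < D"
  shows "zero_digit_set D i = (\<Union>j\<in>{j. j mod int D = 0}.
    {real_of_int j / real D ^ Suc i..<(real_of_int j + 1) / real D ^ Suc i})"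
proof -
  have "x \<in> {real_of_int j / real D ^ Suc i..<(real_of_int j + 1) / real D ^ Suc i} \<longleftrightarrow>
      \<lfloor>x * real D ^ Suc i\<rfloor> = j" for x j
    using assms by (simp add: floor_eq_iff pos_divide_le_eq pos_less_divide_eq del: power_Suc)
  then show ?thesis
    unfolding zero_digit_set_def by (simp only: set_eq_iff UN_iff mem_Collect_eq bex_simps) auto
qed

lemma zero_digit_set_borel: "0 < D \<Longrightarrow> zero_digit_set D i \<in> sets borel"
  unfolding zero_digit_set_eq by (rule sets.countable_UN'') (auto intro: countable_subset[OF subset_UNIV])

text \<open>The half-open intervals have rational left endpoints, so on \<open>K\<close> they agree
  with open ones. This is why \<open>addN_le_loc\<close> adds the rationals to the null set that
  \<open>K\<close> avoids.\<close>

lemma openin_zero_digit_set: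
  assumes D: "0 < D" and K: "K \<inter> \<rat> = {}"
  shows "openin (top_of_set K) (K \<inter> zero_digit_set D i)"
proof -
  let ?O = "\<Union>j\<in>{j. j mod int D = 0}.
    {real_of_int j / real D ^ Suc i<..<(real_of_int j + 1) / real D ^ Suc i}"
  have "x \<in> {a<..<b}" if "x \<in> K" "x \<in> {a..<b}" "a \<in> \<rat>" for x a b :: real
    using that K by (cases "x = a") auto
  moreover have "real_of_int j / real D ^ Suc i \<in> \<rat>" for j
    by (intro Rats_divide Rats_of_int Rats_power Rats_of_nat)
  ultimately have *: "x \<in> {real_of_int j / real D ^ Suc i<..<(real_of_int j + 1) / real D ^ Suc i}"
    if "x \<in> K" "x \<in> {real_of_int j / real D ^ Suc i..<(real_of_int j + 1) / real D ^ Suc i}" for x j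
    using that by metis
  have "K \<inter> zero_digit_set D i \<subseteq> K \<inter> ?O"
  proof
    fix x assume "x \<in> K \<inter> zero_digit_set D i"
    then have xK: "x \<in> K" and "x \<in> (\<Union>j\<in>{j. j mod int D = 0}.
        {real_of_int j / real D ^ Suc i..<(real_of_int j + 1) / real D ^ Suc i})"
      unfolding zero_digit_set_eq[OF D] by simp_all
    from this(2) obtain j where j: "j \<in> {j. j mod int D = 0}"
      "x \<in> {real_of_int j / real D ^ Suc i..<(real_of_int j + 1) / real D ^ Suc i}"
      by (rule UN_E)
    have "x \<in> ?O" using j(1) *[OF xK j(2)] by (rule UN_I)
    then show "x \<in> K \<inter> ?O" using xK by blast
  qed
  moreover have "K \<inter> ?O \<subseteq> K \<inter> zero_digit_set D i"
    unfolding zero_digit_set_eq[OF D] by (intro Int_mono UN_mono) auto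
  ultimately have "K \<inter> zero_digit_set D i = K \<inter> ?O" by (rule equalityI)
  moreover have "open ?O" by (intro open_UN ballI open_greaterThanLessThan)
  ultimately show ?thesis by (simp only: openin_open_Int)
qed

text \<open>From a closed set of positive measure, delete all basic open sets meeting it in a null
  set. The basis is countable, so only a null set is lost, and every remaining nonempty basic
  portion has positive measure.\<close>

lemma closed_full_support:
  assumes Z: "Z \<in> null_sets lebesgue"
  obtains K :: "real set" and U :: "nat \<Rightarrow> real set"
  where "closed K" "K \<subseteq> {0..<1}" "K \<inter> Z = {}" "K \<noteq> {}"
    "\<And>j. K \<inter> U j \<noteq> {} \<Longrightarrow> 0 < emeasure lborel (K \<inter> U j)"
    "\<And>x V. open V \<Longrightarrow> x \<in> V \<Longrightarrow> \<exists>j. x \<in> U j \<and> U j \<subseteq> V"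
proof -
  have "{0..<1} - Z \<in> sets lebesgue" using Z by (intro sets.Diff) auto
  moreover have "(0::real) < 1/2" by simp
  ultimately obtain K0 where K0: "closed K0" "K0 \<subseteq> {0..<1} - Z"
    "emeasure lebesgue ({0..<1} - Z - K0) < ennreal (1/2)"
    by (metis sets_lebesgue_inner_closed)
  have posK0: "0 < emeasure lborel K0"
  proof (rule ccontr)
    assume "\<not> 0 < emeasure lborel K0"
    then have "K0 \<in> null_sets lebesgue" using K0(1) by (intro null_sets_completionI) (auto simp: null_sets_def)
    then have "Z \<union> K0 \<in> null_sets lebesgue" using Z by blast
    then have "emeasure lebesgue ({0..<1} - (Z \<union> K0)) = emeasure lebesgue {0..<1::real}"
      by (intro emeasure_Diff_null_set) auto
    moreover have "{0..<1} - Z - K0 = {0..<1} - (Z \<union> K0)" by blast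
    ultimately have "emeasure lebesgue ({0..<1} - Z - K0) = ennreal 1" by simp
    then have "ennreal 1 < ennreal (1/2)" using K0(3) by (simp only:)
    then have "1 < (1/2 :: real)" by (subst (asm) ennreal_less_iff) simp_all
    then show False by simp
  qed
  obtain \<B> :: "real set set" where \<B>: "countable \<B>" "topological_basis \<B>"
    using ex_countable_basis by blast
  have ne: "\<B> \<noteq> {}" using topological_basisE[OF \<B>(2) open_UNIV UNIV_I] by blast
  define U where "U = from_nat_into \<B>"
  have U: "open (U j)" for j using topological_basis_open[OF \<B>(2)] from_nat_into[OF ne] by (simp add: U_def)
  define J where "J = {j. emeasure lborel (K0 \<inter> U j) = 0}"
  define K where "K = K0 - (\<Union>j\<in>J. U j)"
  have null: "(\<Union>j\<in>J. K0 \<inter> U j) \<in> null_sets lborel"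
    by (rule null_sets_UN') (use K0(1) U in \<open>auto simp: J_def null_sets_def\<close>)
  have meas: "emeasure lborel (K \<inter> X) = emeasure lborel (K0 \<inter> X)" if "X \<in> sets borel" for X
  proof -
    have "K \<inter> X = (K0 \<inter> X) - (\<Union>j\<in>J. K0 \<inter> U j)" unfolding K_def by blast
    then show ?thesis using null K0(1) that by (simp add: emeasure_Diff_null_set)
  qed
  show ?thesis
  proof (rule that[of K U])
    show "closed K" unfolding K_def using K0(1) U by (intro closed_Diff) auto
    show "K \<subseteq> {0..<1}" "K \<inter> Z = {}" using K0(2) unfolding K_def by auto
    show "K \<noteq> {}" using meas[of UNIV] posK0 by auto
    show "0 < emeasure lborel (K \<inter> U j)" if "K \<inter> U j \<noteq> {}" for j
    proof -
      have "j \<notin> J" using that unfolding K_def by blast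
      then show ?thesis using meas[of "U j"] U[of j] by (simp add: J_def zero_less_iff_neq_zero)
    qed
    show "\<exists>j. x \<in> U j \<and> U j \<subseteq> V" if V: "open V" "x \<in> V" for x V
    proof -
      obtain W where W: "W \<in> \<B>" "x \<in> W" "W \<subseteq> V" using topological_basisE[OF \<B>(2) V] by blast
      then obtain j where "U j = W" using from_nat_into_surj[OF \<B>(1) W(1)] by (auto simp: U_def)
      then show ?thesis using W by blast
    qed
  qed
qed

lemma addN_le_loc: "mincard_le addN_wit loc_wit"
proof (rule mincard_le_image)
  fix F assume F: "loc_wit F"
  \<comment> \<open>A power of 2, because the measures \<open>1 / D n\<close> must be summable for
    Borel-Cantelli.\<close>
  define D :: "nat \<Rightarrow> nat" where "D n = 2 ^ Suc n" for n
  define G where "G n i = zero_digit_set (D n) i" for n i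
  define H where "H f = limsup (\<lambda>n. G n (f n) \<inter> {0..<1})" for f
  have D: "0 < D n" for n by (simp add: D_def)
  have H_iff: "x \<in> H f \<longleftrightarrow> (\<forall>m. \<exists>n\<ge>m. x \<in> G n (f n) \<and> x \<in> {0..<1})" for x f
    by (auto simp: H_def mem_limsup_iff frequently_sequentially)
  have Gb: "G n i \<inter> {0..<1} \<in> sets lborel" for n i
    using zero_digit_set_borel[OF D] by (simp add: G_def)
  have Gm: "emeasure lborel (G n i \<inter> {0..<1}) \<le> ennreal ((1/2) ^ Suc n)" for n i
    using emeasure_zero_digit_set_le[OF D, of n i] by (simp add: G_def D_def power_one_over)
  have Hnull: "H f \<in> null_sets lborel" for f
    unfolding H_def
  proof (rule borel_cantelli_limsup1)
    show "G n (f n) \<inter> {0..<1} \<in> sets lborel" for n by (rule Gb)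
    show "emeasure lborel (G n (f n) \<inter> {0..<1}) < \<infinity>" for n
      using Gm[of n "f n"] by (simp add: order_le_less_trans)
    show "summable (\<lambda>n. measure lborel (G n (f n) \<inter> {0..<1}))"
    proof (rule summable_comparison_test')
      show "summable (\<lambda>n. (1/2) ^ Suc n :: real)" using power_half_series by (rule sums_summable)
      show "norm (measure lborel (G n (f n) \<inter> {0..<1})) \<le> (1/2) ^ Suc n" for n
        unfolding measure_def real_norm_def abs_of_nonneg[OF enn2real_nonneg]
        by (rule enn2real_leI[OF _ Gm]) simp
    qed
  qed
  have "addN_wit (H ` F)"
  proof (rule ccontr)
    assume "\<not> addN_wit (H ` F)"
    moreover have "H ` F \<subseteq> null_sets lebesgue" using Hnull null_sets_completionI by blast
    ultimately have "\<Union> (H ` F) \<in> null_sets lebesgue" unfolding addN_wit_def by blast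
    moreover have "\<rat> \<in> null_sets lebesgue"
      by (intro null_sets_completionI countable_imp_null_set_lborel countable_rat)
    ultimately have "\<Union> (H ` F) \<union> \<rat> \<in> null_sets lebesgue" by (rule null_sets.Un)
    then obtain K :: "real set" and U where K: "closed K" "K \<subseteq> {0..<1}" "K \<inter> (\<Union> (H ` F) \<union> \<rat>) = {}" "K \<noteq> {}"
      and Kpos: "\<And>j. K \<inter> U j \<noteq> {} \<Longrightarrow> 0 < emeasure lborel (K \<inter> U j)"
      and Ubasis: "\<And>x V. open V \<Longrightarrow> x \<in> V \<Longrightarrow> \<exists>j::nat. x \<in> U j \<and> U j \<subseteq> V"
      using closed_full_support by metis
    \<comment> \<open>The first condition makes the slalom of an empty portion empty; otherwise
      every index would qualify.\<close>
    define S where "S j n = {i. K \<inter> U j \<noteq> {} \<and> K \<inter> U j \<inter> G n i = {}}" for j n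
    have "\<not> loc_wit F"
    proof (rule not_loc_wit_of_countable)
      show "eventually (\<lambda>n. finite (S j n) \<and> card (S j n) \<le> 4 ^ n) sequentially" for j
      proof (cases "K \<inter> U j = {}")
        case True
        then show ?thesis by (simp add: S_def)
      next
        case False
        have "emeasure lborel (K \<inter> U j) \<le> emeasure lborel {0..<1::real}"
          using K(2) by (intro emeasure_mono) auto
        then have "emeasure lborel (K \<inter> U j) \<noteq> \<top>" by (auto simp: top_unique)
        then obtain c where c: "emeasure lborel (K \<inter> U j) = ennreal c" "0 < c"
          using Kpos[OF False] by (cases "emeasure lborel (K \<inter> U j)") auto
        obtain N where N: "2 * ln (1 / c) \<le> 2 ^ N"
          using real_arch_pow[of 2 "2 * ln (1 / c)"] by (auto intro: less_imp_le)
        show ?thesis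
          using eventually_ge_at_top[of N]
        proof eventually_elim
          case (elim n)
          show ?case
          \<comment> \<open>Bounding the finite subsets of \<open>S j n\<close> gives finiteness and
            width together. The portion has measure \<open>c > 0\<close>, so the avoidance estimate
            leaves at most \<open>ln (1 / c) * 2 ^ Suc n\<close> indices, eventually below
            \<open>4 ^ n\<close>.\<close>
          proof (rule finite_if_finite_subsets_card_bdd)
            fix T assume T: "T \<subseteq> S j n" "finite T"
            have "emeasure lborel (K \<inter> U j) \<le> ennreal (exp (- real (card T) / real (D n)))"
            proof (rule emeasure_avoid_zero_digits_le[OF D T(2)])
              show "K \<inter> U j \<subseteq> {0..<1}" using K(2) by blast
              show "K \<inter> U j \<inter> zero_digit_set (D n) i = {}" if "i \<in> T" for i
                using that T(1) unfolding S_def G_def by blast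
            qed
            then have "c \<le> exp (- real (card T) / real (D n))" using c by simp
            then have "ln c \<le> ln (exp (- real (card T) / real (D n)))"
              using c(2) by (subst ln_le_cancel_iff) auto
            then have "ln c \<le> - real (card T) / real (D n)" by (simp only: ln_exp)
            then have "real (card T) \<le> ln (1 / c) * real (D n)"
              using D[of n] c(2) by (simp add: ln_div field_simps)
            also have "\<dots> = 2 * ln (1 / c) * 2 ^ n" by (simp add: D_def)
            also have "\<dots> \<le> 2 ^ N * 2 ^ n" using N by (rule mult_right_mono) simp
            also have "\<dots> \<le> 2 ^ n * 2 ^ n" using elim by (intro mult_right_mono power_increasing) auto
            also have "\<dots> = 4 ^ n" by (simp flip: power_mult_distrib)
            finally have "real (card T) \<le> real (4 ^ n)" by simp
            then show "card T \<le> 4 ^ n" by (simp only: of_nat_le_iff)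
          qed
        qed
      qed
      show "\<exists>j. eventually (\<lambda>n. f n \<in> S j n) sequentially" if f: "f \<in> F" for f
      proof -
        define T where "T m = (\<Union>n\<in>{m..}. K \<inter> G n (f n))" for m
        have Topen: "openin (top_of_set K) (T m)" for m
          unfolding T_def G_def using K(3) by (intro openin_Union) (auto intro!: openin_zero_digit_set D)
        \<comment> \<open>\<open>K\<close> misses \<open>H f\<close>, so by Baire the relatively
          open sets \<open>T m\<close> cannot all be dense in \<open>K\<close>. A basic portion
          missing some \<open>T m\<close> captures \<open>f\<close> from \<open>m\<close>
          on.\<close>
        have "\<exists>m. \<not> K \<subseteq> closure (T m)"
        proof (rule ccontr)
          assume "\<not> ?thesis"
          then have dense: "K \<subseteq> closure (T m)" for m by blast
          have "K \<subseteq> closure (\<Inter> (range T))"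
            by (rule Baire[OF K(1)]) (use Topen dense in auto)
          then have "\<Inter> (range T) \<noteq> {}" using K(4) by (metis closure_empty subset_empty)
          then obtain x where "x \<in> \<Inter> (range T)" by (meson ex_in_conv)
          then have "\<exists>n\<in>{m..}. x \<in> K \<inter> G n (f n)" for m by (auto simp: T_def)
          then have x: "\<exists>n\<ge>m. x \<in> G n (f n) \<and> x \<in> K" for m by (metis IntE atLeast_iff)
          then have "x \<in> K" by blast
          then have "x \<in> {0..<1}" using K(2) by blast
          then have "x \<in> H f" unfolding H_iff using x by metis
          then show False using K(3) f \<open>x \<in> K\<close> by blast
        qed
        then obtain m x where x: "x \<in> K" "x \<in> - closure (T m)" by blast
        have "open (- closure (T m))" by (rule open_Compl[OF closed_closure])
        from Ubasis[OF this x(2)] obtain j where j: "x \<in> U j" "U j \<subseteq> - closure (T m)" by blast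
        have "f n \<in> S j n" if "m \<le> n" for n
        proof -
          have "U j \<inter> T m = {}" using j(2) closure_subset by blast
          then show ?thesis using j(1) x(1) that unfolding S_def T_def by blast
        qed
        then show ?thesis unfolding eventually_sequentially by blast
      qed
    qed
    then show False using F by contradiction
  qed
  then show "\<exists>f. addN_wit (f ` F)" by (rule exI[of _ H])
qed

section \<open>Solecki's ideal\<close>

lemma bsigma_wit_uncountable:
  assumes I: "set_ideal I" and \<E>: "bsigma_wit S I \<E>"
  shows "\<not> countable \<E>"
proof
  assume c: "countable \<E>"
  have "(\<lambda>n. {}) \<in> Mseq S I" by (simp add: Mseq_def set_ideal_empty[OF I])
  then have ne: "\<E> \<noteq> {}" using \<E> unfolding bsigma_wit_def by blast
  define E where "E = from_nat_into \<E>"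
  have E: "E k \<in> \<E>" for k using from_nat_into[OF ne] by (simp add: E_def)
  have EM: "I (E k n)" "E k n \<subseteq> S" "E k n \<subseteq> E k (Suc n)" for k n
    using E[of k] \<E> by (auto simp: bsigma_wit_def Mseq_def)
  \<comment> \<open>Diagonal sequence: from index \<open>k\<close> on it contains the
    \<open>k\<close>-th sequence of the enumeration.\<close>
  define A where "A n = (\<Union>k\<le>n. E k n)" for n
  have "I (A n)" "A n \<subseteq> S" "A n \<subseteq> A (Suc n)" for n
  proof -
    show "I (A n)" unfolding A_def by (rule set_ideal_UN[OF I]) (simp_all add: EM)
    show "A n \<subseteq> S" unfolding A_def using EM(2) by blast
    show "A n \<subseteq> A (Suc n)" unfolding A_def by (intro UN_mono EM(3)) auto
  qed
  then have "A \<in> Mseq S I" by (simp add: Mseq_def)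
  then obtain X where X: "X \<in> \<E>" "infinite {n. \<not> X n \<subseteq> A n}"
    using \<E> unfolding bsigma_wit_def by blast
  obtain k where k: "E k = X" using from_nat_into_surj[OF c X(1)] by (auto simp: E_def)
  have "X n \<subseteq> A n" if "k \<le> n" for n unfolding A_def using k that by blast
  then have "{n. \<not> X n \<subseteq> A n} \<subseteq> {..<k}" using not_le by auto
  then show False using X(2) finite_subset by blast
qed

text \<open>Uncountability passes from \<open>P\<close> up to \<open>Q\<close>, and the size bound
  from \<open>Q\<close> down to \<open>P\<close>, so one inequality and one witness settle
  both.\<close>

lemma mincard_omega1_cases:
  assumes unc: "\<And>X. P X \<Longrightarrow> \<not> countable X" and PQ: "mincard_le P Q"
    and Q: "Q Y" "(card_of Y, cardSuc (card_of (UNIV :: nat set))) \<in> ordLeq"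
  shows "mincard_omega1 P" "mincard_omega1 Q"
proof -
  have down: "\<exists>X. P X \<and> (card_of X, card_of Z) \<in> ordLeq" if "Q Z" for Z
    using PQ that unfolding mincard_le_def by blast
  obtain X where X: "P X" "(card_of X, card_of Y) \<in> ordLeq" using down[OF Q(1)] by blast
  have "(card_of X, cardSuc (card_of (UNIV :: nat set))) \<in> ordLeq"
    using X(2) Q(2) by (rule ordLeq_transitive)
  then show "mincard_omega1 P" unfolding mincard_omega1_def using unc X(1) by blast
  have "\<not> countable Z" if Z: "Q Z" for Z
  proof
    assume c: "countable Z"
    obtain W where W: "P W" "(card_of W, card_of Z) \<in> ordLeq" using down[OF Z] by blast
    then obtain f where f: "inj_on f W" "f ` W \<subseteq> Z"
      unfolding card_of_ordLeq[symmetric] by blast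
    then have "countable W" using c countable_subset countable_image_inj_on by metis
    then show False using unc[OF W(1)] by contradiction
  qed
  then show "mincard_omega1 Q" unfolding mincard_omega1_def using Q by blast
qed

text \<open>By Cantor's theorem the successor of omega is at most the continuum, so its field embeds
  into the Cantor space, whose points index the generators \<open>Gset\<close>.\<close>

lemma uncountable_set_of_size_omega1:
  obtains W :: "(nat \<Rightarrow> bool) set" where "\<not> countable W"
    "(card_of W, cardSuc (card_of (UNIV :: nat set))) \<in> ordLeq"
proof -
  let ?n = "card_of (UNIV :: nat set)"
  let ?r = "cardSuc ?n"
  have r: "Card_order ?r" by (rule cardSuc_Card_order[OF card_of_Card_order])
  have "inj (\<lambda>(S :: nat set) i. i \<in> S)" by (rule injI) (metis set_eqI)
  then have "(card_of (Pow (UNIV :: nat set)), card_of (UNIV :: (nat \<Rightarrow> bool) set)) \<in> ordLeq"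
    unfolding card_of_ordLeq[symmetric] by auto
  with card_of_Pow have "(?n, card_of (UNIV :: (nat \<Rightarrow> bool) set)) \<in> ordLess"
    by (rule ordLess_ordLeq_trans)
  then have "(?r, card_of (UNIV :: (nat \<Rightarrow> bool) set)) \<in> ordLeq"
    by (rule cardSuc_least[OF card_of_Card_order card_of_Card_order])
  then have "(card_of (Field ?r), card_of (UNIV :: (nat \<Rightarrow> bool) set)) \<in> ordLeq"
    by (rule ordIso_ordLeq_trans[OF card_of_Field_ordIso[OF r]])
  then obtain f :: "nat set \<Rightarrow> nat \<Rightarrow> bool" where f: "inj_on f (Field ?r)"
    unfolding card_of_ordLeq[symmetric] by blast
  show ?thesis
  proof (rule that[of "f ` Field ?r"])
    show "(card_of (f ` Field ?r), ?r) \<in> ordLeq"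
      by (rule ordLeq_ordIso_trans[OF card_of_image card_of_Field_ordIso[OF r]])
    show "\<not> countable (f ` Field ?r)"
    proof
      assume "countable (f ` Field ?r)"
      then have "countable (Field ?r)" using f by (rule countable_image_inj_on)
      then obtain g :: "nat set \<Rightarrow> nat" where "inj_on g (Field ?r)" by (rule countableE)
      then have "(card_of (Field ?r), ?n) \<in> ordLeq" unfolding card_of_ordLeq[symmetric] by blast
      then have "(?r, ?n) \<in> ordLeq"
        by (rule ordIso_ordLeq_trans[OF ordIso_symmetric[OF card_of_Field_ordIso[OF r]]])
      then show False using not_ordLess_ordLeq[OF cardSuc_greater[OF card_of_Card_order]] by contradiction
    qed
  qed
qed

section \<open>Clopen sets of measure one half\<close>

definition cylinder :: "nat \<Rightarrow> (nat \<Rightarrow> bool) \<Rightarrow> (nat \<Rightarrow> bool) set" where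
  "cylinder n s = {z. \<forall>i<n. z i = s i}"

lemma topspace_cantor_top [simp]: "topspace cantor_top = UNIV"
  by (simp add: cantor_top_def PiE_UNIV_domain)

lemma openin_cylinder: "openin cantor_top (cylinder n s)"
proof -
  let ?V = "\<lambda>i. if i < n then {s i} else UNIV"
  have eq: "cylinder n s = Pi\<^sub>E UNIV ?V"
    by (auto simp: cylinder_def PiE_iff split: if_splits)
  have "finite {i \<in> UNIV. ?V i \<noteq> topspace (discrete_topology UNIV)}"
    by (rule finite_subset[of _ "{..<n}"]) auto
  then show ?thesis unfolding eq cantor_top_def by (simp add: openin_PiE_gen)
qed

lemma emeasure_cylinder:
  "cylinder n s \<in> sets cantor_measure" "emeasure cantor_measure (cylinder n s) = ennreal ((1/2) ^ n)"
proof -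
  let ?M = "\<lambda>_ :: nat. measure_pmf (bernoulli_pmf (1/2))"
  have eq: "cylinder n s = prod_emb UNIV ?M {..<n} (Pi\<^sub>E {..<n} (\<lambda>i. {s i}))"
    by (auto simp: cylinder_def prod_emb_def PiE_iff restrict_def extensional_def space_PiM)
  show "cylinder n s \<in> sets cantor_measure"
    unfolding eq cantor_measure_def by (rule sets_PiM_I) auto
  have "emeasure cantor_measure (cylinder n s) = (\<Prod>i<n. emeasure (?M i) {s i})"
    unfolding eq cantor_measure_def
    by (rule emeasure_PiM_emb) (auto intro: prob_space_measure_pmf)
  also have "\<dots> = (\<Prod>i<n. ennreal (1/2))"
  proof (rule prod.cong)
    show "emeasure (?M i) {s i} = ennreal (1/2)" for i
      by (cases "s i") (simp_all add: emeasure_pmf_single)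
  qed simp
  also have "\<dots> = ennreal ((1/2) ^ n)"
    unfolding prod_constant card_lessThan by (rule ennreal_power) simp
  finally show "emeasure cantor_measure (cylinder n s) = ennreal ((1/2) ^ n)" .
qed

text \<open>\<open>W\<close> is half of the words of length \<open>Suc n\<close>. Closedness holds
  because the complement is the union of the cylinders of the other half.\<close>

lemma UN_cylinder_in_Omega:
  assumes W: "W \<subseteq> Pi\<^sub>E {..<Suc n} (\<lambda>_. UNIV)" and card: "card W = 2 ^ n"
  shows "(\<Union>s\<in>W. cylinder (Suc n) s) \<in> Omega"
proof -
  let ?All = "Pi\<^sub>E {..<Suc n} (\<lambda>_. UNIV) :: (nat \<Rightarrow> bool) set"
  have fin: "finite ?All" by (intro finite_PiE) auto
  have finW: "finite W" using W fin by (rule finite_subset)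
  have mem: "z \<in> (\<Union>s\<in>V. cylinder (Suc n) s) \<longleftrightarrow> restrict z {..<Suc n} \<in> V"
    if V: "V \<subseteq> ?All" for z V
  proof
    assume "z \<in> (\<Union>s\<in>V. cylinder (Suc n) s)"
    then obtain s where s: "s \<in> V" "z \<in> cylinder (Suc n) s" by blast
    have "restrict z {..<Suc n} = s"
    proof
      fix i show "restrict z {..<Suc n} i = s i"
        using s V by (cases "i < Suc n") (auto simp: cylinder_def PiE_iff extensional_def restrict_def)
    qed
    then show "restrict z {..<Suc n} \<in> V" using s by simp
  next
    assume "restrict z {..<Suc n} \<in> V"
    moreover have "z \<in> cylinder (Suc n) (restrict z {..<Suc n})" by (auto simp: cylinder_def)
    ultimately show "z \<in> (\<Union>s\<in>V. cylinder (Suc n) s)" by blast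
  qed
  have op: "openin cantor_top (\<Union>s\<in>V. cylinder (Suc n) s)" for V
    by (rule openin_Union) (auto simp: openin_cylinder)
  have "UNIV - (\<Union>s\<in>W. cylinder (Suc n) s) = (\<Union>s\<in>?All - W. cylinder (Suc n) s)"
  proof (rule set_eqI)
    fix z :: "nat \<Rightarrow> bool"
    have "restrict z {..<Suc n} \<in> ?All" by auto
    then show "z \<in> UNIV - (\<Union>s\<in>W. cylinder (Suc n) s) \<longleftrightarrow> z \<in> (\<Union>s\<in>?All - W. cylinder (Suc n) s)"
      using mem[OF W, of z] mem[of "?All - W" z] by simp
  qed
  then have "closedin cantor_top (\<Union>s\<in>W. cylinder (Suc n) s)"
    unfolding closedin_def topspace_cantor_top using op by simp
  moreover have sets: "(\<Union>s\<in>W. cylinder (Suc n) s) \<in> sets cantor_measure"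
    using finW emeasure_cylinder(1) by (intro sets.finite_UN) auto
  moreover have "measure cantor_measure (\<Union>s\<in>W. cylinder (Suc n) s) = 1/2"
  proof -
    have disj: "disjoint_family_on (cylinder (Suc n)) W"
      unfolding disjoint_family_on_def
    proof (intro ballI impI)
      fix s t assume st: "s \<in> W" "t \<in> W" "s \<noteq> t"
      have False if z: "z \<in> cylinder (Suc n) s" "z \<in> cylinder (Suc n) t" for z
      proof -
        have "s \<in> ?All" "t \<in> ?All" using st(1,2) W by blast+
        then have "s i = t i" for i
          using z by (cases "i < Suc n") (auto simp: cylinder_def PiE_iff extensional_def)
        then show False using st(3) by blast
      qed
      then show "cylinder (Suc n) s \<inter> cylinder (Suc n) t = {}" by blast
    qed
    have "emeasure cantor_measure (\<Union>s\<in>W. cylinder (Suc n) s) =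
        (\<Sum>s\<in>W. emeasure cantor_measure (cylinder (Suc n) s))"
      by (rule sum_emeasure[symmetric]) (use emeasure_cylinder(1) disj finW in auto)
    also have "\<dots> = ennreal (2 ^ n * (1/2) ^ Suc n)"
      by (simp add: emeasure_cylinder(2) card ennreal_mult' del: power_Suc flip: ennreal_power ennreal_numeral)
    also have "2 ^ n * (1/2) ^ Suc n = (1/2 :: real)" by (simp flip: power_mult_distrib)
    finally have e: "emeasure cantor_measure (\<Union>s\<in>W. cylinder (Suc n) s) = ennreal (1/2)" .
    show ?thesis unfolding measure_def e by (rule enn2real_ennreal) simp
  qed
  ultimately show ?thesis unfolding Omega_def using op by simp
qed

text \<open>At a suitable length \<open>Suc n\<close> the word of \<open>x\<close> differs from
  those of \<open>K\<close>, and the latter are fewer than \<open>2 ^ n\<close>. So enough words are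
  free to complete the word of \<open>x\<close> to half of all words without using any from
  \<open>K\<close>.\<close>

lemma ex_Omega_separating:
  assumes K: "finite K" and x: "x \<notin> K"
  shows "\<exists>C\<in>Omega. x \<in> C \<and> C \<inter> K = {}"
proof -
  have "\<exists>i. k i \<noteq> x i" if "k \<in> K" for k
  proof -
    have "k \<noteq> x" using that x by blast
    then show ?thesis by (simp add: fun_eq_iff)
  qed
  then obtain d where d: "\<And>k. k \<in> K \<Longrightarrow> k (d k) \<noteq> x (d k)" by metis
  \<comment> \<open>One \<open>n\<close> for two demands: \<open>card K < 2 ^ n\<close>, and every
    position \<open>d k\<close> where \<open>k\<close> differs from \<open>x\<close> is below
    \<open>Suc n\<close>.\<close>
  define n where "n = card K + (\<Sum>k\<in>K. d k)"
  have dn: "d k < Suc n" if "k \<in> K" for k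
    using member_le_sum[OF that, of d] K by (simp add: n_def)
  let ?R = "\<lambda>z :: nat \<Rightarrow> bool. restrict z {..<Suc n}"
  let ?All = "Pi\<^sub>E {..<Suc n} (\<lambda>_. UNIV) :: (nat \<Rightarrow> bool) set"
  have fin: "finite ?All" by (intro finite_PiE) auto
  have cardAll: "card ?All = 2 ^ Suc n" by (subst card_PiE) auto
  have "card (?R ` K) \<le> card K" using K by (rule card_image_le)
  also have "card K < 2 ^ card K" by simp
  also have "(2 :: nat) ^ card K \<le> 2 ^ n" by (rule power_increasing) (auto simp: n_def)
  finally have cK: "card (?R ` K) < 2 ^ n" .
  have "card (?All - ?R ` K - {?R x}) \<ge> card (?All - ?R ` K) - 1"
    by (simp add: card_Diff_singleton_if)
  moreover have "card (?All - ?R ` K) \<ge> card ?All - card (?R ` K)"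
    using K by (intro diff_card_le_card_Diff) auto
  ultimately have "2 ^ n - 1 \<le> card (?All - ?R ` K - {?R x})"
    using cK unfolding cardAll by simp
  then obtain T where T: "T \<subseteq> ?All - ?R ` K - {?R x}" "card T = 2 ^ n - 1" "finite T"
    by (rule obtain_subset_with_card_n)
  let ?W = "insert (?R x) T"
  have RxK: "?R x \<notin> ?R ` K"
  proof
    assume "?R x \<in> ?R ` K"
    then obtain k where k: "k \<in> K" "?R x = ?R k" by blast
    then have "?R x (d k) = ?R k (d k)" by simp
    then show False using d[OF k(1)] dn[OF k(1)] by simp
  qed
  have "card ?W = 2 ^ n"
  proof -
    have "?R x \<notin> T" using T(1) by blast
    then show ?thesis using T(2,3) by simp
  qed
  moreover have "?W \<subseteq> ?All" using T(1) by auto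
  ultimately have Om: "(\<Union>s\<in>?W. cylinder (Suc n) s) \<in> Omega" by (intro UN_cylinder_in_Omega)
  have "x \<in> cylinder (Suc n) (?R x)" by (simp add: cylinder_def)
  moreover have "k \<notin> cylinder (Suc n) s" if k: "k \<in> K" and s: "s \<in> ?W" for k s
  proof
    assume kc: "k \<in> cylinder (Suc n) s"
    have "s \<in> ?All" using s T(1) by auto
    then have "?R k i = s i" for i
      using kc by (cases "i < Suc n") (auto simp: cylinder_def PiE_iff extensional_def restrict_def)
    then have "?R k = s" by (rule ext)
    then have sK: "s \<in> ?R ` K" using imageI[OF k, of ?R] by simp
    show False
    proof (cases "s = ?R x")
      case True
      then show False using sK RxK by simp
    next
      case False
      then have "s \<in> T" using s by simp
      then show False using sK T(1) by blast
    qed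
  qed
  ultimately show ?thesis by (intro bexI[OF _ Om] conjI) (simp, blast)
qed

lemma set_ideal_Solecki: "set_ideal Solecki"
  unfolding set_ideal_def
proof (intro conjI allI impI)
  show "Solecki {}" unfolding Solecki_def by blast
  show "Solecki A" if "Solecki B" "A \<subseteq> B" for A B using that unfolding Solecki_def by blast
  show "Solecki (A \<union> B)" if A: "Solecki A" and B: "Solecki B" for A B
  proof -
    obtain F G where F: "finite F" "A \<subseteq> (\<Union>x\<in>F. Gset x)" and G: "finite G" "B \<subseteq> (\<Union>x\<in>G. Gset x)"
      using A B unfolding Solecki_def by blast
    have "A \<union> B \<subseteq> (\<Union>x\<in>F \<union> G. Gset x)" using F(2) G(2) by blast
    moreover have "finite (F \<union> G)" "A \<union> B \<subseteq> Omega" using F(1) G(1) A B unfolding Solecki_def by auto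
    ultimately show ?thesis unfolding Solecki_def by blast
  qed
qed

lemma Solecki_Gset: "Solecki (Gset x)"
  unfolding Solecki_def Gset_def by (intro conjI exI[of _ "{x}"]) auto

text \<open>Finitely supported points are dense, so every nonempty open set contains one. The result
  supplies the cover \<open>T\<close> for \<open>bsigma_le_bs\<close>.\<close>

lemma Omega_countable_cover:
  obtains q :: "nat \<Rightarrow> nat \<Rightarrow> bool" where "(\<Union>n. Gset (q n)) = Omega"
proof -
  let ?Q = "(\<lambda>S i. i \<in> S) ` {S :: nat set. finite S}"
  have Q: "countable ?Q" "?Q \<noteq> {}" by (auto simp: countable_Collect_finite)
  show ?thesis
  proof (rule that[of "from_nat_into ?Q"], rule equalityI)
    show "(\<Union>n. Gset (from_nat_into ?Q n)) \<subseteq> Omega" by (auto simp: Gset_def)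
    show "Omega \<subseteq> (\<Union>n. Gset (from_nat_into ?Q n))"
    proof
      fix A assume A: "A \<in> Omega"
      then have "A \<noteq> {}" by (auto simp: Omega_def)
      then obtain x where x: "x \<in> A" by blast
      have "openin (product_topology (\<lambda>_. discrete_topology UNIV) UNIV) A"
        using A by (simp add: Omega_def cantor_top_def)
      then obtain U where U: "finite {i \<in> UNIV. U i \<noteq> topspace (discrete_topology UNIV)}"
        "x \<in> Pi\<^sub>E UNIV U" "Pi\<^sub>E UNIV U \<subseteq> A"
        using x unfolding openin_product_topology_alt by meson
      \<comment> \<open>Follow \<open>x\<close> on the finitely many restricted coordinates and take
        \<open>False\<close> elsewhere.\<close>
      define S where "S = {i. U i \<noteq> UNIV \<and> x i}"
      have "finite S" by (rule finite_subset[OF _ U(1)]) (auto simp: S_def)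
      then have SQ: "(\<lambda>i. i \<in> S) \<in> ?Q" by blast
      have "(\<lambda>i. i \<in> S) \<in> Pi\<^sub>E UNIV U"
        unfolding PiE_UNIV_domain
      proof (rule Pi_I)
        fix i :: nat
        have "x i \<in> U i" using U(2) by auto
        then show "(i \<in> S) \<in> U i" by (cases "U i = UNIV") (simp_all add: S_def)
      qed
      then have "A \<in> Gset (\<lambda>i. i \<in> S)" using A U(3) unfolding Gset_def by blast
      moreover obtain n where "from_nat_into ?Q n = (\<lambda>i. i \<in> S)"
        using from_nat_into_surj[OF Q(1) SQ] by blast
      ultimately have "A \<in> Gset (from_nat_into ?Q n)" by simp
      then show "A \<in> (\<Union>n. Gset (from_nat_into ?Q n))" by blast
    qed
  qed
qed

text \<open>Each \<open>B n\<close> is covered by the generators of a finite set \<open>F n\<close>.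
  An uncountable \<open>W\<close> has a point outside all \<open>F n\<close>, and separating it from
  each of them makes its generator escape every \<open>B n\<close>.\<close>

lemma addw_wit_Solecki:
  assumes W: "\<not> countable W"
  shows "addw_wit Omega Solecki (Gset ` W)"
  unfolding addw_wit_def
proof (intro conjI allI impI)
  show "\<forall>A\<in>Gset ` W. Solecki A \<and> A \<subseteq> Omega" using Solecki_Gset by (auto simp: Gset_def)
  fix B :: "nat \<Rightarrow> (nat \<Rightarrow> bool) set set"
  assume "\<forall>n. Solecki (B n) \<and> B n \<subseteq> Omega"
  then have "\<forall>n. \<exists>F. finite F \<and> B n \<subseteq> (\<Union>x\<in>F. Gset x)" unfolding Solecki_def by blast
  from choice[OF this] obtain F where F: "\<And>n. finite (F n)" "\<And>n. B n \<subseteq> (\<Union>x\<in>F n. Gset x)" by blast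
  have "countable (\<Union>n. F n)" using F(1) by (intro countable_UN) (auto intro: countable_finite)
  then have "\<not> W \<subseteq> (\<Union>n. F n)" using W countable_subset by blast
  then obtain x where x: "x \<in> W" "x \<notin> (\<Union>n. F n)" by blast
  have "\<not> Gset x \<subseteq> B n" for n
  proof -
    obtain C where C: "C \<in> Omega" "x \<in> C" "C \<inter> F n = {}"
      using ex_Omega_separating[OF F(1)[of n], of x] x(2) by blast
    then have "C \<in> Gset x" "C \<notin> B n" using F(2)[of n] by (auto simp: Gset_def)
    then show ?thesis by blast
  qed
  then show "\<exists>A\<in>Gset ` W. \<forall>n. \<not> A \<subseteq> B n" using x(1) by blast
qed

text \<open>\<open>1\<dots>1 0 w\<close> with \<open>i\<close> ones: turns \<open>\<omega>\<^sub>1\<close> points \<open>w\<close> into \<open>\<omega>\<^sub>1\<close> pairwise disjoint injective sequences.\<close>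

definition prefixed_point :: "(nat \<Rightarrow> bool) \<Rightarrow> nat \<Rightarrow> nat \<Rightarrow> bool" where
  "prefixed_point w i m = (if m < i then True else if m = i then False else w (m - Suc i))"

lemma prefixed_point_inject:
  assumes eq: "prefixed_point w i = prefixed_point v j"
  shows "w = v" "i = j"
proof -
  show ij: "i = j"
  proof (rule ccontr)
    assume "i \<noteq> j"
    moreover have "prefixed_point w i i = prefixed_point v j i" "prefixed_point w i j = prefixed_point v j j"
      using eq by simp_all
    ultimately show False by (cases "i < j") (auto simp: prefixed_point_def)
  qed
  show "w = v"
  proof
    fix m
    have "prefixed_point w i (Suc (i + m)) = prefixed_point v j (Suc (i + m))" using eq by simp
    then show "w m = v m" using ij by (simp add: prefixed_point_def)
  qed
qed

text \<open>The partition involves only countably many points, and by injectivity some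
  \<open>w\<close> has none of its prefixed points among them. A finite \<open>G\<close> supposed to
  cover the tested set may contain some of these points, which is why each \<open>w\<close> gets
  infinitely many: one outside \<open>G\<close> is separated from \<open>G\<close> and
  \<open>F i\<close> at once, and the separating clopen set lies in the tested set.\<close>

lemma bs_wit_Solecki:
  assumes W: "\<not> countable W"
  shows "bs_wit Omega Solecki ((\<lambda>w. disjointed (\<lambda>i. Gset (prefixed_point w i))) ` W)"
  unfolding bs_wit_def
proof (intro conjI ballI)
  let ?E = "\<lambda>w. disjointed (\<lambda>i. Gset (prefixed_point w i))"
  show "?E ` W \<subseteq> Phat Omega Solecki"
  proof (rule image_subsetI)
    fix w
    have "Solecki (?E w n)" for n
      using disjointed_subset by (rule set_ideal_subset[OF set_ideal_Solecki Solecki_Gset])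
    then show "?E w \<in> Phat Omega Solecki"
      unfolding Phat_def by (simp add: disjoint_family_disjointed Solecki_def)
  qed
  fix A assume A: "A \<in> Ppart Omega Solecki"
  define B where "B n = (\<Union>i\<le>n. A i)" for n
  have AI: "Solecki (A n)" for n using A by (simp add: Ppart_def Phat_def)
  have AU: "(\<Union>n. A n) = Omega" using A by (simp add: Ppart_def)
  have "Solecki (B n)" for n unfolding B_def by (rule set_ideal_UN[OF set_ideal_Solecki]) (simp_all add: AI)
  then have "\<forall>n. \<exists>F. finite F \<and> B n \<subseteq> (\<Union>x\<in>F. Gset x)" unfolding Solecki_def by blast
  from choice[OF this] obtain F where F: "\<And>n. finite (F n)" "\<And>n. B n \<subseteq> (\<Union>x\<in>F n. Gset x)" by blast
  let ?P = "\<Union>n. F n"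
  have "countable ?P" using F(1) by (intro countable_UN) (auto intro: countable_finite)
  moreover define Q where "Q = {p. case_prod prefixed_point p \<in> ?P}"
  have "case_prod prefixed_point ` Q \<subseteq> ?P" unfolding Q_def by blast
  ultimately have "countable (case_prod prefixed_point ` Q)" by (rule countable_subset[rotated])
  moreover have "inj_on (case_prod prefixed_point) Q"
    by (rule inj_onI) (auto dest: prefixed_point_inject)
  ultimately have "countable (fst ` Q)" using countable_image_inj_on by blast
  then have "\<not> W \<subseteq> fst ` Q" using W countable_subset by blast
  then obtain w where w: "w \<in> W" "w \<notin> fst ` Q" by blast
  have wP: "prefixed_point w i \<notin> ?P" for i
    using w(2) image_eqI[of w fst "(w, i)" Q] unfolding Q_def by auto
  let ?X = "\<Union>n. A (Suc n) \<inter> (\<Union>i\<le>n. ?E w i)"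
  have "\<not> Solecki ?X"
  proof
    assume "Solecki ?X"
    then obtain G where G: "finite G" "?X \<subseteq> (\<Union>x\<in>G. Gset x)" unfolding Solecki_def by blast
    have "inj (prefixed_point w)" by (rule injI) (rule prefixed_point_inject(2))
    then have "infinite (range (prefixed_point w))" by (rule range_inj_infinite)
    then have "\<not> range (prefixed_point w) \<subseteq> G" using G(1) finite_subset by blast
    then obtain i where i: "prefixed_point w i \<notin> G" by blast
    then have "prefixed_point w i \<notin> G \<union> F i" using wP[of i] by blast
    then obtain C where C: "C \<in> Omega" "prefixed_point w i \<in> C" "C \<inter> (G \<union> F i) = {}"
      using ex_Omega_separating[of "G \<union> F i"] G(1) F(1) by blast
    have "C \<notin> B i" using F(2)[of i] C(3) by (auto simp: Gset_def)
    obtain n where n: "C \<in> A n" using C(1) AU by blast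
    have "\<not> n \<le> i" using n \<open>C \<notin> B i\<close> unfolding B_def by blast
    then obtain n' where n': "n = Suc n'" "i \<le> n'" by (cases n) auto
    have "C \<in> Gset (prefixed_point w i)" using C(1,2) by (simp add: Gset_def)
    then have "C \<in> (\<Union>k\<in>{0..<Suc i}. Gset (prefixed_point w k))" by (intro UN_I[of i]) simp_all
    then have "C \<in> (\<Union>k\<in>{0..<Suc i}. ?E w k)" unfolding finite_UN_disjointed_eq .
    moreover have "(\<Union>k\<in>{0..<Suc i}. ?E w k) \<subseteq> (\<Union>k\<le>n'. ?E w k)"
      using n'(2) by (intro UN_mono) auto
    ultimately have "C \<in> (\<Union>k\<le>n'. ?E w k)" by (rule rev_subsetD)
    then have "C \<in> ?X" using n n'(1) by blast
    then have "C \<in> (\<Union>x\<in>G. Gset x)" using G(2) by blast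
    then show False using C(3) by (auto simp: Gset_def)
  qed
  then show "\<exists>E\<in>?E ` W. \<not> Solecki (\<Union>n. A (Suc n) \<inter> (\<Union>i\<le>n. E i))"
    by (intro bexI[OF _ imageI[OF w(1)]])
qed

lemma mincard_Solecki:
  "mincard_omega1 (bsigma_wit Omega Solecki)"
  "mincard_omega1 (bs_wit Omega Solecki)"
  "mincard_omega1 (addw_wit Omega Solecki)"
proof -
  obtain W :: "(nat \<Rightarrow> bool) set" where W: "\<not> countable W"
    "(card_of W, cardSuc (card_of (UNIV :: nat set))) \<in> ordLeq"
    by (rule uncountable_set_of_size_omega1)
  obtain q :: "nat \<Rightarrow> nat \<Rightarrow> bool" where q: "(\<Union>n. Gset (q n)) = Omega" by (rule Omega_countable_cover)
  have unc: "\<And>X. bsigma_wit Omega Solecki X \<Longrightarrow> \<not> countable X"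
    by (rule bsigma_wit_uncountable[OF set_ideal_Solecki])
  have bs: "mincard_le (bsigma_wit Omega Solecki) (bs_wit Omega Solecki)"
    using set_ideal_Solecki Solecki_Gset q by (rule bsigma_le_bs)
  show "mincard_omega1 (bsigma_wit Omega Solecki)" "mincard_omega1 (bs_wit Omega Solecki)"
    using mincard_omega1_cases[OF unc bs bs_wit_Solecki[OF W(1)] ordLeq_transitive[OF card_of_image W(2)]]
    by blast+
  show "mincard_omega1 (addw_wit Omega Solecki)"
    using mincard_omega1_cases(2)[OF unc bsigma_le_addw addw_wit_Solecki[OF W(1)]
        ordLeq_transitive[OF card_of_image W(2)]] by blast
qed

lemma mincard_eqI: "mincard_le P Q \<Longrightarrow> mincard_le Q P \<Longrightarrow> mincard_eq P Q"
  by (simp add: mincard_eq_def)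

theorem theorem5p15:
  shows
  \<comment> \<open>(1)\<close>
  "(mincard_eq (bsigma_wit UNIV FinI) (bs_wit UNIV FinI) \<and>
    mincard_eq (bs_wit UNIV FinI) b_wit \<and>
    mincard_finite b_wit \<and>
    \<not> mincard_finite (addw_wit UNIV FinI))
  \<and> \<comment> \<open>(2)\<close>
   (mincard_eq (bsigma_wit UNIV Fin_x_empty) (bs_wit UNIV Fin_x_empty) \<and>
    mincard_eq (bs_wit UNIV Fin_x_empty) b_wit \<and>
    mincard_finite b_wit \<and>
    \<not> mincard_finite (addw_wit UNIV Fin_x_empty))
  \<and> \<comment> \<open>(3)\<close>
   (mincard_eq (bsigma_wit UNIV Id_dens) (addw_wit UNIV Id_dens) \<and>
    mincard_eq (addw_wit UNIV Id_dens) addN_wit \<and>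
    mincard_le addN_wit b_wit \<and>
    mincard_eq b_wit (bs_wit UNIV Id_dens))
  \<and> \<comment> \<open>(4)\<close>
   (mincard_eq (bsigma_wit UNIV I_summ) (addw_wit UNIV I_summ) \<and>
    mincard_eq (addw_wit UNIV I_summ) addN_wit \<and>
    mincard_le addN_wit b_wit \<and>
    mincard_eq b_wit (bs_wit UNIV I_summ))
  \<and> \<comment> \<open>(5)\<close>
   (mincard_eq (bsigma_wit UNIV Fin_x_Fin) (bs_wit UNIV Fin_x_Fin) \<and>
    mincard_eq (bs_wit UNIV Fin_x_Fin) (addw_wit UNIV Fin_x_Fin) \<and>
    mincard_eq (addw_wit UNIV Fin_x_Fin) b_wit)
  \<and> \<comment> \<open>(6)\<close>
   (mincard_eq (bsigma_wit UNIV empty_x_Fin) (bs_wit UNIV empty_x_Fin) \<and>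
    mincard_eq (bs_wit UNIV empty_x_Fin) (addw_wit UNIV empty_x_Fin) \<and>
    mincard_eq (addw_wit UNIV empty_x_Fin) b_wit)
  \<and> \<comment> \<open>(7)\<close>
   (mincard_omega1 (bsigma_wit Omega Solecki) \<and>
    mincard_omega1 (bs_wit Omega Solecki) \<and>
    mincard_omega1 (addw_wit Omega Solecki))"
proof -
  note tr = mincard_le_trans
  have fin: "mincard_finite b_wit" unfolding mincard_finite_def using b_wit_UNIV by blast
  have addN_b: "mincard_le addN_wit b_wit" by (rule tr[OF addN_le_loc loc_le_b])
  have summ_b: "mincard_le (addw_wit UNIV I_summ) b_wit" by (rule tr[OF addw_I_summ_le_addN addN_b])
  \<comment> \<open>The density ideal gets below add(N) by a detour: through loc to the summable
    ideal, which dyadic covers compare with null sets.\<close>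
  have dens_N: "mincard_le (addw_wit UNIV Id_dens) addN_wit"
    by (rule tr[OF addw_Id_dens_le_loc tr[OF mincard_I_summ(3) addw_I_summ_le_addN]])
  have "mincard_eq (bsigma_wit UNIV FinI) (bs_wit UNIV FinI)" "mincard_eq (bs_wit UNIV FinI) b_wit"
    by (rule mincard_eqI; blast intro: tr mincard_FinI)+
  moreover have "mincard_eq (bsigma_wit UNIV Fin_x_empty) (bs_wit UNIV Fin_x_empty)"
    "mincard_eq (bs_wit UNIV Fin_x_empty) b_wit"
    by (rule mincard_eqI; blast intro: tr mincard_Fin_x_empty)+
  moreover have "mincard_eq (bsigma_wit UNIV Id_dens) (addw_wit UNIV Id_dens)"
    by (rule mincard_eqI[OF bsigma_le_addw mincard_Id_dens(4)[OF addw_Id_dens_le_b]])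
  moreover have "mincard_eq (addw_wit UNIV Id_dens) addN_wit"
    by (rule mincard_eqI[OF dens_N tr[OF addN_le_loc mincard_Id_dens(3)]])
  moreover have "mincard_eq b_wit (bs_wit UNIV Id_dens)"
    by (rule mincard_eqI[OF mincard_Id_dens(1,2)])
  moreover have "mincard_eq (bsigma_wit UNIV I_summ) (addw_wit UNIV I_summ)"
    by (rule mincard_eqI[OF bsigma_le_addw mincard_I_summ(4)[OF summ_b]])
  moreover have "mincard_eq (addw_wit UNIV I_summ) addN_wit"
    by (rule mincard_eqI[OF addw_I_summ_le_addN tr[OF addN_le_loc mincard_I_summ(3)]])
  moreover have "mincard_eq b_wit (bs_wit UNIV I_summ)"
    by (rule mincard_eqI[OF mincard_I_summ(1,2)])
  moreover have "mincard_eq (bsigma_wit UNIV Fin_x_Fin) (bs_wit UNIV Fin_x_Fin)"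
    "mincard_eq (bs_wit UNIV Fin_x_Fin) (addw_wit UNIV Fin_x_Fin)"
    "mincard_eq (addw_wit UNIV Fin_x_Fin) b_wit"
    by (rule mincard_eqI; blast intro: tr bsigma_le_addw mincard_Fin_x_Fin)+
  moreover have "mincard_eq (bsigma_wit UNIV empty_x_Fin) (bs_wit UNIV empty_x_Fin)"
    "mincard_eq (bs_wit UNIV empty_x_Fin) (addw_wit UNIV empty_x_Fin)"
    "mincard_eq (addw_wit UNIV empty_x_Fin) b_wit"
    by (rule mincard_eqI; blast intro: tr bsigma_le_addw mincard_empty_x_Fin)+
  ultimately show ?thesis
    using fin addN_b no_addw_wit_FinI no_addw_wit_Fin_x_empty mincard_Solecki by simp
qed

end
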